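(* Let $q\in[0,1)$ and let $\{X_t\}_{t\ge 0}$ be a $q$-Brownian motion in a non-commutative probability space $(\mathcal{A},\varphi)$. For $n\ge 0$ let $\{X^n_t\}_{t\ge 0}$ be the linear interpolation of $X$ along the dyadic partition $D^n=\{t^n_i:\ i\ge 0\}$, $t_i^n:=i/2^n$, and for $0\le s<t$ and $\mathbf{U}\in\mathcal{A}\hat\otimes\mathcal{A}$ let $$\mathbb{X}^{2,n}_{st}[\mathbf{U}]:=\int_s^t(\mathbf{U}\sharp\delta X^n_{su})\,\mathrm{d}X^n_u ,$$ the integral being understood in the classical Lebesgue sense ($X^n$ being piecewise linear). Then there exists a product Lévy area $\mathbb{X}^{2,S}=(\mathbb{X}^{2,S}_{st})_{0\le s<t}$ above $X$ such that for every $T>0$ and every $0<\gamma<1/2$, as $n\to\infty$, $$X^n\to X \ \text{ in } \ \mathcal{C}_1^\gamma([0,T];\mathcal{A})\qquad\text{and}\qquad \mathbb{X}^{2,n}\to\mathbb{X}^{2,S}\ \text{ in } \ \mathcal{C}_2^{2\gamma}(\mathcal{L}_T(\mathcal{A}_{\rightharpoonup})) .$$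
   Context: A non-commutative probability space $(\mathcal{A},\varphi)$ is a von Neumann algebra $\mathcal{A}$ with a weakly continuous, positive, faithful, normalized ($\varphi(1)=1$) trace $\varphi$; $\|\cdot\|$ is the operator norm. A $q$-Brownian motion is a family $\{X_t\}_{t\ge0}$ of self-adjoint elements of $\mathcal{A}$ such that for all $r\ge 1$ and $t_1,\dots,t_r\ge 0$, $$\varphi(X_{t_1}\cdots X_{t_r})=\sum_{\pi\in\mathcal{P}_2(\{1,\dots,r\})}q^{\mathrm{Cr}(\pi)}\prod_{\{a,b\}\in\pi}(t_a\wedge t_b),$$ where $\mathcal{P}_2(\{1,\dots,r\})$ is the set of partitions of $\{1,\dots,r\}$ into two-element blocks (empty if $r$ is odd) and $\mathrm{Cr}(\pi)$ is the number of crossings of $\pi$, i.e. of sets $\{\{x_1,y_1\},\{x_2,y_2\}\}$ of blocks with $x_1<x_2<y_1<y_2$ (convention $0^0=1$). Notation. For a path $g$, $\delta g_{st}:=g_t-g_s$. $\mathcal{A}\hat\otimes\mathcal{A}$ is the projective tensor product, i.e. the completion of the algebraic tensor product for $\|\mathbf{U}\|=\inf\sum_i\|U_i\|\|V_i\|$ over representations $\mathbf{U}=\sum_iU_i\otimes V_i$; $\sharp$ is the continuous linear extension of $(U_1\otimes U_2)\sharp Y:=U_1YU_2$. The linear interpolation is $X^n_t:=X_{t_i^n}+\frac{t-t_i^n}{t_{i+1}^n-t_i^n}\,\delta X_{t_i^nt_{i+1}^n}$ for $t\in[t_i^n,t_{i+1}^n]$. $\mathcal{A}_t$ is the operator-norm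 closure of the unital subalgebra of $\mathcal{A}$ generated by $\{X_s\}_{0\le s\le t}$. Convergence in $\mathcal{C}_1^\gamma([0,T];\mathcal{A})$ means $\sup_{0\le s<t\le T}\|\delta(X^n-X)_{st}\|/|t-s|^\gamma\to0$. $\mathcal{L}_T(\mathcal{A}_{\rightharpoonup})$ (resp. $\mathcal{L}_T(\mathcal{A}_{\to})$) is the set of families $L=(L_{st})_{0\le s<t\le T}$ where $L_{st}$ is a bounded linear map from $\mathcal{A}_s\hat\otimes\mathcal{A}_s$ to $\mathcal{A}$ (resp. to $\mathcal{A}_t$). For $\lambda\in[0,1]$, $\mathcal{C}_2^\lambda(\mathcal{L}_T(\mathcal{A}_{\rightharpoonup}))$ (resp. $\mathcal{C}_2^\lambda(\mathcal{L}_T(\mathcal{A}_{\to}))$) is the set of those $L$ for which $$\sup_{0\le s<t\le T}\ \sup_{\mathbf{U}\in\mathcal{A}_s\hat\otimes\mathcal{A}_s,\,\mathbf{U}\ne0}\frac{\|L_{st}[\mathbf{U}]\|}{|t-s|^\lambda\|\mathbf{U}\|}<\infty ,$$ with this quantity as norm. A product Lévy area above $X$ is a family $\mathbb{X}^2=(\mathbb{X}^2_{st})_{0\le s<t}$ such that, for every $T>0$ and $\gamma\in(1/3,1/2)$: (i) its restriction to $0\le s<t\le T$ belongs to $\mathcal{C}_2^{2\gamma}(\mathcal{L}_T(\mathcal{A}_\to))$; (ii) for all $s<u<t$ and $\mathbf{U}\in\mathcal{A}_s\hat\otimes\mathcal{A}_s$, $$\mathbb{X}^2_{st}[\mathbf{U}]-\mathbb{X}^2_{su}[\mathbf{U}]-\mathbb{X}^2_{ut}[\mathbf{U}]=(\mathbf{U}\sharp\delta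 X_{su})\,\delta X_{ut}.$$ *)

theory Defs
  imports "HOL-Analysis.Analysis" "HOL-Library.Function_Algebras" "HOL-Library.Disjoint_Sets"
begin

section \<open>Operators on a complex Hilbert space\<close>

text \<open>Positivity, definiteness, the norm and completeness come from the underlying real Hilbert
  space, whose inner product is the real part of the complex one.\<close>

class complex_hilbert = real_inner + banach +
  fixes scaleC :: "complex \<Rightarrow> 'a \<Rightarrow> 'a" (infixr \<open>*\<^sub>C\<close> 75)
    and cinner :: "'a \<Rightarrow> 'a \<Rightarrow> complex"
  assumes scaleC_add_right: "a *\<^sub>C (x + y) = a *\<^sub>C x + a *\<^sub>C y"
    and scaleC_add_left: "(a + b) *\<^sub>C x = a *\<^sub>C x + b *\<^sub>C x"
    and scaleC_scaleC: "a *\<^sub>C (b *\<^sub>C x) = (a * b) *\<^sub>C x"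
    and scaleC_of_real: "complex_of_real r *\<^sub>C x = r *\<^sub>R x"
    and cinner_commute: "cinner x y = cnj (cinner y x)"
    and cinner_add_right: "cinner x (y + z) = cinner x y + cinner x z"
    and cinner_scaleC_right: "cinner x (a *\<^sub>C y) = a * cinner x y"
    and Re_cinner: "Re (cinner x y) = inner x y"

lemma inner_scaleC_right:
  "inner x (a *\<^sub>C y) = Re (a * cinner x y)" for x y :: "'a::complex_hilbert"
  by (metis Re_cinner cinner_scaleC_right)

lemma norm_scaleC: "norm (a *\<^sub>C x) = cmod a * norm x" for x :: "'a::complex_hilbert"
proof -
  have im: "Im (cinner x x) = 0"
    using cinner_commute[of x x] by (metis Reals_cnj_iff complex_is_Real_iff)
  have "cinner (a *\<^sub>C x) (a *\<^sub>C x) = a * cnj (a * cinner x x)"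
    by (metis cinner_commute cinner_scaleC_right)
  also have "\<dots> = complex_of_real ((cmod a)\<^sup>2) * cnj (cinner x x)"
    by (metis complex_cnj_mult complex_norm_square mult.assoc)
  finally have "inner (a *\<^sub>C x) (a *\<^sub>C x) = (cmod a)\<^sup>2 * inner x x"
    using im by (simp flip: Re_cinner)
  then show ?thesis
    by (simp add: norm_eq_sqrt_inner real_sqrt_mult)
qed

type_synonym 'h op = "'h \<Rightarrow>\<^sub>L 'h"

text \<open>The library's \<open>\<Rightarrow>\<^sub>L\<close> consists of the bounded real-linear maps; \<open>bounded_ops\<close> is the
  algebra of bounded complex-linear operators.  The operator norm does not depend on the scalar
  field.\<close>

definition bounded_ops :: "'h::complex_hilbert op set" where
  "bounded_ops = {U. \<forall>a x. blinfun_apply U (a *\<^sub>C x) = a *\<^sub>C blinfun_apply U x}"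

lift_definition op_scale :: "complex \<Rightarrow> 'h::complex_hilbert op \<Rightarrow> 'h op"
  is "\<lambda>a U x. a *\<^sub>C U x"
proof -
  fix a :: complex and U :: "'h \<Rightarrow> 'h"
  assume "bounded_linear U"
  then interpret U: bounded_linear U .
  have "bounded_linear (\<lambda>x::'h. a *\<^sub>C x)"
  proof (rule bounded_linear_intro[where K = "cmod a"])
    show "a *\<^sub>C (r *\<^sub>R x) = r *\<^sub>R (a *\<^sub>C x)" for r and x :: 'h
      by (metis scaleC_of_real scaleC_scaleC mult.commute)
  qed (simp_all add: scaleC_add_right norm_scaleC)
  then show "bounded_linear (\<lambda>x. a *\<^sub>C U x)"
    using bounded_linear_compose U.bounded_linear_axioms by blast
qed

definition is_adjoint :: "'h::complex_hilbert op \<Rightarrow> 'h op \<Rightarrow> bool" where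
  "is_adjoint U V \<longleftrightarrow>
    (\<forall>x y. cinner (blinfun_apply U x) y = cinner x (blinfun_apply V y))"

definition weak_operator_topology :: "'h::complex_hilbert op topology" where
  "weak_operator_topology =
    pullback_topology UNIV (\<lambda>U (x, y). cinner x (blinfun_apply U y)) euclidean"

definition unital_subalgebra :: "'h::complex_hilbert op set \<Rightarrow> bool" where
  "unital_subalgebra B \<longleftrightarrow>
    B \<subseteq> bounded_ops \<and> id_blinfun \<in> B \<and>
    (\<forall>U\<in>B. \<forall>V\<in>B. U + V \<in> B \<and> U o\<^sub>L V \<in> B) \<and>
    (\<forall>a. \<forall>U\<in>B. op_scale a U \<in> B)"

definition von_neumann_algebra :: "'h::complex_hilbert op set \<Rightarrow> bool" where
  "von_neumann_algebra A \<longleftrightarrow>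
    unital_subalgebra A \<and> (\<forall>U\<in>A. \<exists>V\<in>A. is_adjoint U V) \<and>
    closedin weak_operator_topology A"

section \<open>Non-commutative probability and the q-Brownian motion\<close>

definition nc_probability_space ::
    "'h::complex_hilbert op set \<Rightarrow> ('h op \<Rightarrow> complex) \<Rightarrow> bool" where
  "nc_probability_space A \<phi> \<longleftrightarrow>
    von_neumann_algebra A \<and>
    (\<forall>U\<in>A. \<forall>V\<in>A. \<phi> (U + V) = \<phi> U + \<phi> V) \<and>
    (\<forall>a. \<forall>U\<in>A. \<phi> (op_scale a U) = a * \<phi> U) \<and>
    continuous_map (subtopology weak_operator_topology A) euclidean \<phi> \<and>
    (\<forall>U\<in>A. \<forall>V\<in>A. is_adjoint U V \<longrightarrow> \<phi> (V o\<^sub>L U) \<in> \<real>\<^sub>\<ge>\<^sub>0) \<and>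
    (\<forall>U\<in>A. \<forall>V\<in>A. is_adjoint U V \<and> \<phi> (V o\<^sub>L U) = 0 \<longrightarrow> U = 0) \<and>
    \<phi> id_blinfun = 1 \<and>
    (\<forall>U\<in>A. \<forall>V\<in>A. \<phi> (U o\<^sub>L V) = \<phi> (V o\<^sub>L U))"

definition pairings :: "nat \<Rightarrow> nat set set set" where
  "pairings r = {\<pi>. partition_on {..<r} \<pi> \<and> (\<forall>b\<in>\<pi>. card b = 2)}"

definition crossings :: "nat set set \<Rightarrow> nat" where
  "crossings \<pi> = card {{{x1, y1}, {x2, y2}} | x1 y1 x2 y2.
    {x1, y1} \<in> \<pi> \<and> {x2, y2} \<in> \<pi> \<and> x1 < x2 \<and> x2 < y1 \<and> y1 < y2}"

text \<open>The times \<open>t\<^sub>1, \<dots>, t\<^sub>r\<close> form a list, so that positions start at 0.\<close>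

definition q_brownian_motion ::
    "'h::complex_hilbert op set \<Rightarrow> ('h op \<Rightarrow> complex) \<Rightarrow> real \<Rightarrow> (real \<Rightarrow> 'h op) \<Rightarrow> bool" where
  "q_brownian_motion A \<phi> q X \<longleftrightarrow>
    (\<forall>t\<ge>0. X t \<in> A \<and> is_adjoint (X t) (X t)) \<and>
    (\<forall>ts. ts \<noteq> [] \<and> (\<forall>t\<in>set ts. 0 \<le> t) \<longrightarrow>
      \<phi> (foldr (o\<^sub>L) (map X ts) id_blinfun) =
      complex_of_real (\<Sum>\<pi>\<in>pairings (length ts).
        q ^ crossings \<pi> * (\<Prod>b\<in>\<pi>. MIN i\<in>b. ts ! i)))"

definition filtration :: "(real \<Rightarrow> 'h::complex_hilbert op) \<Rightarrow> real \<Rightarrow> 'h op set" where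
  "filtration X t = closure (unital_subalgebra hull (X ` {0..t}))"

section \<open>Completion of a normed space\<close>

text \<open>The normed space is given by a carrier \<open>V\<close> and a norm \<open>N\<close> on it; the points of its completion
  are the classes of Cauchy sequences modulo null sequences.\<close>

definition cauchy_seqs :: "'v::ab_group_add set \<Rightarrow> ('v \<Rightarrow> real) \<Rightarrow> (nat \<Rightarrow> 'v) set" where
  "cauchy_seqs V N =
    {c. range c \<subseteq> V \<and> (\<forall>e>0. \<exists>M. \<forall>m\<ge>M. \<forall>n\<ge>M. N (c m - c n) < e)}"

definition null_rel ::
    "'v::ab_group_add set \<Rightarrow> ('v \<Rightarrow> real) \<Rightarrow> ((nat \<Rightarrow> 'v) \<times> (nat \<Rightarrow> 'v)) set" where
  "null_rel V N = {(c, d). c \<in> cauchy_seqs V N \<and> d \<in> cauchy_seqs V N \<and>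
    (\<lambda>k. N (c k - d k)) \<longlonglongrightarrow> 0}"

definition completion :: "'v::ab_group_add set \<Rightarrow> ('v \<Rightarrow> real) \<Rightarrow> (nat \<Rightarrow> 'v) set set" where
  "completion V N = cauchy_seqs V N // null_rel V N"

definition completion_norm :: "('v \<Rightarrow> real) \<Rightarrow> (nat \<Rightarrow> 'v) set \<Rightarrow> real" where
  "completion_norm N C = (THE r. \<forall>c\<in>C. (\<lambda>k. N (c k)) \<longlonglongrightarrow> r)"

section \<open>The projective tensor product\<close>

text \<open>The algebraic tensor product of the space \<open>bounded_ops\<close> with itself is realised, as usual, inside
  the functionals on its bilinear forms, with \<open>U \<otimes> V\<close> acting by evaluation at \<open>(U, V)\<close>.  Bilinear
  forms on subspaces extend, so for a subspace \<open>S\<close> the algebraic tensor product of \<open>S\<close> with itself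
  is the span of the \<open>U \<otimes> V\<close> with \<open>U, V \<in> S\<close>.  In contrast, the projective norm and the completion
  depend on \<open>S\<close>.\<close>

definition bilinear_form :: "('h::complex_hilbert op \<Rightarrow> 'h op \<Rightarrow> complex) \<Rightarrow> bool" where
  "bilinear_form \<beta> \<longleftrightarrow>
    (\<forall>U\<in>bounded_ops. \<forall>V\<in>bounded_ops. \<forall>W\<in>bounded_ops. \<forall>a.
      \<beta> (U + V) W = \<beta> U W + \<beta> V W \<and> \<beta> W (U + V) = \<beta> W U + \<beta> W V \<and>
      \<beta> (op_scale a U) W = a * \<beta> U W \<and> \<beta> W (op_scale a U) = a * \<beta> W U)"

type_synonym 'h tensor = "('h op \<Rightarrow> 'h op \<Rightarrow> complex) \<Rightarrow> complex"

definition elem_tensor :: "'h::complex_hilbert op \<Rightarrow> 'h op \<Rightarrow> 'h tensor" where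
  "elem_tensor U V = (\<lambda>\<beta>. if bilinear_form \<beta> then \<beta> U V else 0)"

definition scale_tensor :: "complex \<Rightarrow> 'h tensor \<Rightarrow> 'h tensor" where
  "scale_tensor a \<tau> = (\<lambda>\<beta>. a * \<tau> \<beta>)"

definition represents ::
    "'h::complex_hilbert op set \<Rightarrow> ('h op \<times> 'h op) list \<Rightarrow> 'h tensor \<Rightarrow> bool" where
  "represents S ps \<tau> \<longleftrightarrow> set ps \<subseteq> S \<times> S \<and> \<tau> = (\<Sum>(U, V)\<leftarrow>ps. elem_tensor U V)"

definition alg_tensor :: "'h::complex_hilbert op set \<Rightarrow> 'h tensor set" where
  "alg_tensor S = {\<tau>. \<exists>ps. represents S ps \<tau>}"

definition tensor_norm :: "'h::complex_hilbert op set \<Rightarrow> 'h tensor \<Rightarrow> real" where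
  "tensor_norm S \<tau> = (INF ps\<in>{ps. represents S ps \<tau>}. \<Sum>(U, V)\<leftarrow>ps. norm U * norm V)"

type_synonym 'h ctensor = "(nat \<Rightarrow> 'h tensor) set"

definition proj_tensor :: "'h::complex_hilbert op set \<Rightarrow> 'h ctensor set" where
  "proj_tensor S = completion (alg_tensor S) (tensor_norm S)"

definition proj_norm :: "'h::complex_hilbert op set \<Rightarrow> 'h ctensor \<Rightarrow> real" where
  "proj_norm S = completion_norm (tensor_norm S)"

definition proj_class :: "'h::complex_hilbert op set \<Rightarrow> (nat \<Rightarrow> 'h tensor) \<Rightarrow> 'h ctensor" where
  "proj_class S c = null_rel (alg_tensor S) (tensor_norm S) `` {c}"

text \<open>The canonical map from the projective tensor square of a smaller space into that of
  \<open>S\<close>: it sends the class of a sequence to the larger class of the same sequence.\<close>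

definition proj_embed :: "'h::complex_hilbert op set \<Rightarrow> 'h ctensor \<Rightarrow> 'h ctensor" where
  "proj_embed S C = null_rel (alg_tensor S) (tensor_norm S) `` C"

definition alg_sharp :: "'h::complex_hilbert tensor \<Rightarrow> 'h op \<Rightarrow> 'h op" where
  "alg_sharp \<tau> Y = (THE W. \<exists>ps. represents bounded_ops ps \<tau> \<and>
    W = (\<Sum>(U, V)\<leftarrow>ps. U o\<^sub>L Y o\<^sub>L V))"

definition sharp :: "'h::complex_hilbert ctensor \<Rightarrow> 'h op \<Rightarrow> 'h op" (infixl \<open>\<sharp>\<close> 70) where
  "C \<sharp> Y = (THE W. \<forall>c\<in>C. (\<lambda>k. alg_sharp (c k) Y) \<longlonglongrightarrow> W)"

section \<open>Path spaces and product Levy areas\<close>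

definition bounded_linear_maps ::
    "'h::complex_hilbert op set \<Rightarrow> 'h op set \<Rightarrow> ('h ctensor \<Rightarrow> 'h op) set" where
  "bounded_linear_maps S B = {L.
    (\<forall>C\<in>proj_tensor S. L C \<in> B) \<and>
    (\<forall>c\<in>cauchy_seqs (alg_tensor S) (tensor_norm S).
      \<forall>d\<in>cauchy_seqs (alg_tensor S) (tensor_norm S).
        L (proj_class S (c + d)) = L (proj_class S c) + L (proj_class S d)) \<and>
    (\<forall>a. \<forall>c\<in>cauchy_seqs (alg_tensor S) (tensor_norm S).
      L (proj_class S (\<lambda>k. scale_tensor a (c k))) = op_scale a (L (proj_class S c))) \<and>
    (\<exists>K. \<forall>C\<in>proj_tensor S. norm (L C) \<le> K * proj_norm S C)}"

text \<open>In the following, \<open>F\<close> is the filtration and \<open>G t\<close> the space in which \<open>L s t\<close> takes its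
  values: the whole algebra for the spaces written with a right harpoon, \<open>F t\<close> for those written
  with a right arrow.\<close>

definition op_families ::
    "(real \<Rightarrow> 'h::complex_hilbert op set) \<Rightarrow> (real \<Rightarrow> 'h op set) \<Rightarrow> real \<Rightarrow>
      (real \<Rightarrow> real \<Rightarrow> 'h ctensor \<Rightarrow> 'h op) set" where
  "op_families F G T =
    {L. \<forall>s t. 0 \<le> s \<and> s < t \<and> t \<le> T \<longrightarrow> L s t \<in> bounded_linear_maps (F s) (G t)}"

definition C2_norm ::
    "(real \<Rightarrow> 'h::complex_hilbert op set) \<Rightarrow> real \<Rightarrow> real \<Rightarrow>
      (real \<Rightarrow> real \<Rightarrow> 'h ctensor \<Rightarrow> 'h op) \<Rightarrow> ereal" where
  "C2_norm F T r L =
    (SUP (s, t)\<in>{(s, t). 0 \<le> s \<and> s < t \<and> t \<le> T}.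
     SUP U\<in>proj_tensor (F s) - {proj_class (F s) 0}.
       ereal (norm (L s t U) / (\<bar>t - s\<bar> powr r * proj_norm (F s) U)))"

definition C2_space ::
    "(real \<Rightarrow> 'h::complex_hilbert op set) \<Rightarrow> (real \<Rightarrow> 'h op set) \<Rightarrow> real \<Rightarrow> real \<Rightarrow>
      (real \<Rightarrow> real \<Rightarrow> 'h ctensor \<Rightarrow> 'h op) set" where
  "C2_space F G T r = {L \<in> op_families F G T. C2_norm F T r L < \<infinity>}"

definition C2_tendsto ::
    "(real \<Rightarrow> 'h::complex_hilbert op set) \<Rightarrow> (real \<Rightarrow> 'h op set) \<Rightarrow> real \<Rightarrow> real \<Rightarrow>
      (nat \<Rightarrow> real \<Rightarrow> real \<Rightarrow> 'h ctensor \<Rightarrow> 'h op) \<Rightarrow>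
      (real \<Rightarrow> real \<Rightarrow> 'h ctensor \<Rightarrow> 'h op) \<Rightarrow> bool" where
  "C2_tendsto F G T r Ls L \<longleftrightarrow>
    (\<forall>n. Ls n \<in> C2_space F G T r) \<and> L \<in> C2_space F G T r \<and>
    (\<lambda>n. C2_norm F T r (\<lambda>s t U. Ls n s t U - L s t U)) \<longlonglongrightarrow> 0"

definition C1_norm :: "real \<Rightarrow> real \<Rightarrow> (real \<Rightarrow> 'h::complex_hilbert op) \<Rightarrow> ereal" where
  "C1_norm T r g =
    (SUP (s, t)\<in>{(s, t). 0 \<le> s \<and> s < t \<and> t \<le> T}. ereal (norm (g t - g s) / \<bar>t - s\<bar> powr r))"

definition product_levy_area ::
    "(real \<Rightarrow> 'h::complex_hilbert op) \<Rightarrow> (real \<Rightarrow> real \<Rightarrow> 'h ctensor \<Rightarrow> 'h op) \<Rightarrow> bool" where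
  "product_levy_area X L \<longleftrightarrow>
    (\<forall>T>0. \<forall>\<gamma>. 1 / 3 < \<gamma> \<and> \<gamma> < 1 / 2 \<longrightarrow>
      L \<in> C2_space (filtration X) (filtration X) T (2 * \<gamma>)) \<and>
    (\<forall>s u t. 0 \<le> s \<and> s < u \<and> u < t \<longrightarrow> (\<forall>U\<in>proj_tensor (filtration X s).
      L s t U - L s u U - L u t (proj_embed (filtration X u) U) =
      (U \<sharp> (X u - X s)) o\<^sub>L (X t - X u)))"

section \<open>Dyadic interpolation\<close>

definition dyadic :: "nat \<Rightarrow> nat \<Rightarrow> real" where
  "dyadic n i = real i / 2 ^ n"

definition interp :: "(real \<Rightarrow> 'h::complex_hilbert op) \<Rightarrow> nat \<Rightarrow> real \<Rightarrow> 'h op" where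
  "interp X n t = (let i = nat \<lfloor>t * 2 ^ n\<rfloor> in
    X (dyadic n i) +
    ((t - dyadic n i) / (dyadic n (Suc i) - dyadic n i)) *\<^sub>R
      (X (dyadic n (Suc i)) - X (dyadic n i)))"

text \<open>The library's Bochner integral requires a second countable target, which an operator algebra
  is not.  The integrand is piecewise affine, so its gauge integral is the Lebesgue integral;
  the derivative is undefined at finitely many points only.\<close>

definition interp_area ::
    "(real \<Rightarrow> 'h::complex_hilbert op) \<Rightarrow> nat \<Rightarrow> real \<Rightarrow> real \<Rightarrow> 'h ctensor \<Rightarrow> 'h op" where
  "interp_area X n s t U = integral {s..t} (\<lambda>u.
    (U \<sharp> (interp X n u - interp X n s)) o\<^sub>L vector_derivative (interp X n) (at u))"

end

theory Submission
  imports Defs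
begin

text \<open>Since \<open>\<phi>\<close> is faithful, the norm of \<open>Y \<in> A\<close> is controlled by the growth of the moments
  \<open>\<phi> ((Y\<^sup>* Y)\<^sup>n)\<close>.  The crux is the bound
  \<open>\<parallel>\<Sum>i<N. a\<^sub>i U b\<^sub>i\<parallel> \<le> \<parallel>U\<parallel> h \<surd>N \<parallel>X\<^sub>1\<parallel>\<^sup>2\<close> for \<open>U\<close> in the past \<open>A\<^sub>s\<close> and increments
  \<open>a\<^sub>i, b\<^sub>i\<close> of \<open>X\<close> over disjoint intervals of length \<open>h\<close> after \<open>s\<close>.  To see it, sort the pairings
  in a mixed moment \<open>\<phi> (y\<^sub>0 U\<^sub>0 y\<^sub>1 U\<^sub>1 \<dots>)\<close> of future letters \<open>y\<^sub>j\<close> and past elements \<open>U\<^sub>j\<close> by the pairing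
  \<open>\<pi>\<close> they induce on the future letters.  What is left is a moment of the \<open>U\<^sub>j\<close> in which each
  \<open>X\<^sub>t\<close> is replaced by a copy \<open>X\<^sub>t\<^sup>D\<close>, with \<open>D\<close> the set of arcs of \<open>\<pi>\<close> above the slot \<open>j\<close> and covariances
  \<open>q ^ card (sym_diff D D') * min t u\<close>.  Such copies can be built inside \<open>A\<close> from later increments of \<open>X\<close>
  and have the same norms as the originals, so the mixed moment is at most
  \<open>\<Sum>\<pi>. q\<^bsup>Cr \<pi>\<^esup> \<bar>cov\<^sub>\<pi>\<bar> \<Prod>j. \<parallel>U\<^sub>j\<parallel>\<close>; for \<open>((Y\<^sup>* Y)\<^sup>n)\<close> each \<open>\<pi>\<close> leaves at most \<open>N\<^sup>n\<close> choices of indices, and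
  \<open>\<Sum>\<pi>. q\<^bsup>Cr \<pi>\<^esup>\<close> is a moment of \<open>X\<^sub>1\<close>.

  Between two dyadic levels the area changes, over complete cells, by
  \<open>(1/2) \<Sum>k. (U \<sharp> a\<^sub>k) b\<^sub>k - (U \<sharp> b\<^sub>k) a\<^sub>k\<close> with \<open>a\<^sub>k, b\<^sub>k\<close> the increments over the two halves of the
  cell \<open>k\<close>.  With the crux this is of order \<open>\<surd>(t - s) 2\<^bsup>-n/2\<^esup>\<close>, hence summable in \<open>n\<close>.\<close>

section \<open>Operators\<close>

text \<open>The triangle inequality bounds the crux sum only by a multiple of \<open>N * h\<close>,
  the length of the time interval, and the changes between levels would then not decay. The gain is
  a matter of counting: in a nonvanishing term of a moment every summation index has to agree with
  another one, so at most half of the indices are free. The counting tolerates absolute values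
  inside the sum over pairings: as 0 \<le> q, the weights \<open>q ^ crossings \<pi>\<close> are
  nonnegative, and their total grows only geometrically because \<open>X 1\<close> is bounded,
  although the number of pairings grows factorially. The obstacle is the past elements between the
  future letters. They cannot be estimated one by one, since their letters are paired with each
  other from slot to slot and cross the future arcs on the way. Giving every slot its own copy of
  the path turns these crossings into covariances, so that what remains is again a moment, bounded
  by a product of norms. Constant factors in front of a moment bound, such as the 2 in
  \<open>phi_bound\<close>, disappear when the growth of moments is turned into a norm.\<close>

lemma cinner_add_left: "cinner (x + y) z = cinner x z + cinner y z"
  by (metis cinner_add_right cinner_commute complex_cnj_add)

lemma cinner_scaleC_left: "cinner (a *\<^sub>C x) y = cnj a * cinner x y"
  by (metis cinner_commute cinner_scaleC_right complex_cnj_mult)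

lemma cinner_scaleR_left: "cinner (r *\<^sub>R x) y = of_real r * cinner x y"
  by (metis cinner_scaleC_left complex_cnj_complex_of_real scaleC_of_real)

lemma cinner_scaleR_right: "cinner x (r *\<^sub>R y) = of_real r * cinner x y"
  by (metis cinner_scaleC_right scaleC_of_real)

lemma scaleC_scaleR: "a *\<^sub>C (r *\<^sub>R x) = r *\<^sub>R (a *\<^sub>C x)"
  by (metis mult.commute scaleC_of_real scaleC_scaleC)

lemma cinner_Im: "Im (cinner x y) = - inner x (\<i> *\<^sub>C y)"
  by (simp add: inner_scaleC_right)

text \<open>Real and imaginary part are bounded separately. The crude factor 2 suffices, as the
  bound only serves to make \<open>cinner\<close> continuous.\<close>

lemma norm_cinner_le: "cmod (cinner x y) \<le> 2 * norm x * norm y"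
proof -
  have "\<bar>Re (cinner x y)\<bar> \<le> norm x * norm y"
    by (metis Re_cinner Cauchy_Schwarz_ineq2)
  moreover have "\<bar>Im (cinner x y)\<bar> \<le> norm x * norm y"
    using Cauchy_Schwarz_ineq2[of x "\<i> *\<^sub>C y"] by (simp add: cinner_Im norm_scaleC)
  ultimately show ?thesis
    using cmod_le[of "cinner x y"] by linarith
qed

lemma bounded_bilinear_cinner: "bounded_bilinear (cinner :: 'h::complex_hilbert \<Rightarrow> _)"
proof
  show "\<exists>K. \<forall>a b. norm (cinner a b) \<le> norm (a::'h) * norm b * K"
    by (rule exI[of _ 2]) (metis norm_cinner_le mult.assoc mult.commute)
qed (simp_all add: cinner_add_left cinner_add_right cinner_scaleR_left cinner_scaleR_right scaleR_conv_of_real)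

lemmas tendsto_cinner = bounded_bilinear.tendsto[OF bounded_bilinear_cinner]
lemmas cinner_zero_right = bounded_bilinear.zero_right[OF bounded_bilinear_cinner]

lemma cinner_eqI:
  assumes "\<And>x. cinner x y = cinner x z"
  shows "y = z"
proof -
  have "inner (y - z) y = inner (y - z) z"
    using assms by (metis Re_cinner)
  then show ?thesis
    by (metis eq_iff_diff_eq_0 inner_diff_right inner_eq_zero_iff)
qed

lemma op_scale_apply [simp]: "blinfun_apply (op_scale a U) x = a *\<^sub>C blinfun_apply U x"
  by (simp add: op_scale.rep_eq)

lemma op_scale_of_real: "op_scale (of_real r) U = r *\<^sub>R U"
  by (rule blinfun_eqI) (simp add: scaleC_of_real scaleR_blinfun.rep_eq)

lemma op_scale_one [simp]: "op_scale 1 U = U"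
  using op_scale_of_real[of 1 U] by simp

lemma op_scale_add_right: "op_scale a (U + V) = op_scale a U + op_scale a V"
  by (rule blinfun_eqI) (simp add: plus_blinfun.rep_eq scaleC_add_right)

lemma op_scale_op_scale: "op_scale a (op_scale b U) = op_scale (a * b) U"
  by (rule blinfun_eqI) (simp add: scaleC_scaleC)

lemma op_scale_scaleR: "op_scale a (r *\<^sub>R U) = r *\<^sub>R op_scale a U"
  by (rule blinfun_eqI) (simp add: scaleR_blinfun.rep_eq scaleC_scaleR)

lemma norm_op_scale: "norm (op_scale a U) \<le> cmod a * norm U"
  by (rule norm_blinfun_bound)
    (simp_all add: norm_scaleC mult.assoc mult_left_mono norm_blinfun)

lemma bounded_linear_op_scale: "bounded_linear (op_scale a)"
  by (rule bounded_linear_intro[where K = "cmod a"])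
    (simp_all add: op_scale_add_right op_scale_scaleR norm_op_scale mult.commute)

lemma op_scale_zero_right [simp]: "op_scale a 0 = 0"
  by (rule linear_simps(3)[OF bounded_linear_op_scale])

lemma op_assoc: "(U o\<^sub>L V) o\<^sub>L W = U o\<^sub>L (V o\<^sub>L W)"
  by (rule blinfun_eqI) simp

lemma op_scale_compose_left: "op_scale a U o\<^sub>L V = op_scale a (U o\<^sub>L V)"
  by (rule blinfun_eqI) simp

lemma op_scale_compose_right:
  "U \<in> bounded_ops \<Longrightarrow> U o\<^sub>L op_scale a V = op_scale a (U o\<^sub>L V)"
  by (rule blinfun_eqI) (simp add: bounded_ops_def)

lemmas compose_add_left = bounded_bilinear.add_left[OF bounded_bilinear_blinfun_compose]
lemmas compose_add_right = bounded_bilinear.add_right[OF bounded_bilinear_blinfun_compose]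
lemmas compose_diff_left = bounded_bilinear.diff_left[OF bounded_bilinear_blinfun_compose]
lemmas compose_diff_right = bounded_bilinear.diff_right[OF bounded_bilinear_blinfun_compose]
lemmas compose_minus_left = bounded_bilinear.minus_left[OF bounded_bilinear_blinfun_compose]
lemmas compose_minus_right = bounded_bilinear.minus_right[OF bounded_bilinear_blinfun_compose]
lemmas compose_scaleR_left = bounded_bilinear.scaleR_left[OF bounded_bilinear_blinfun_compose]
lemmas compose_scaleR_right = bounded_bilinear.scaleR_right[OF bounded_bilinear_blinfun_compose]
lemmas compose_zero_left = bounded_bilinear.zero_left[OF bounded_bilinear_blinfun_compose]
lemmas compose_zero_right = bounded_bilinear.zero_right[OF bounded_bilinear_blinfun_compose]
lemmas compose_sum_left = bounded_bilinear.sum_left[OF bounded_bilinear_blinfun_compose]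
lemmas compose_sum_right = bounded_bilinear.sum_right[OF bounded_bilinear_blinfun_compose]
lemmas tendsto_compose_op = bounded_bilinear.tendsto[OF bounded_bilinear_blinfun_compose]

lemma compose_id [simp]: "U o\<^sub>L id_blinfun = U" "id_blinfun o\<^sub>L U = U"
  by (auto intro: blinfun_eqI)

lemmas compose_ring = op_assoc compose_add_left compose_add_right compose_diff_left
  compose_diff_right compose_scaleR_left compose_scaleR_right compose_minus_left
  compose_minus_right compose_zero_left compose_zero_right

section \<open>Adjoints, powers and subalgebras of operators\<close>

lemma is_adjointI: "(\<And>x y. cinner (blinfun_apply U x) y = cinner x (blinfun_apply V y)) \<Longrightarrow> is_adjoint U V"
  by (simp add: is_adjoint_def)

lemma is_adjointD: "is_adjoint U V \<Longrightarrow> cinner (blinfun_apply U x) y = cinner x (blinfun_apply V y)"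
  by (simp add: is_adjoint_def)

lemma is_adjoint_sym: "is_adjoint U V \<Longrightarrow> is_adjoint V U"
  by (metis is_adjoint_def cinner_commute)

lemma is_adjoint_add: "is_adjoint U U' \<Longrightarrow> is_adjoint V V' \<Longrightarrow> is_adjoint (U + V) (U' + V')"
  by (simp add: is_adjoint_def plus_blinfun.rep_eq cinner_add_left cinner_add_right)

lemma is_adjoint_op_scale: "is_adjoint U V \<Longrightarrow> is_adjoint (op_scale a U) (op_scale (cnj a) V)"
  by (simp add: is_adjoint_def cinner_scaleC_left cinner_scaleC_right)

lemma is_adjoint_scaleR: "is_adjoint U V \<Longrightarrow> is_adjoint (r *\<^sub>R U) (r *\<^sub>R V)"
  by (metis is_adjoint_op_scale complex_cnj_complex_of_real op_scale_of_real)

lemma is_adjoint_uminus: "is_adjoint U V \<Longrightarrow> is_adjoint (- U) (- V)"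
  using is_adjoint_scaleR[of U V "-1"] by simp

lemma is_adjoint_diff: "is_adjoint U U' \<Longrightarrow> is_adjoint V V' \<Longrightarrow> is_adjoint (U - V) (U' - V')"
  using is_adjoint_add[of U U' "- V" "- V'"] is_adjoint_uminus[of V V'] by simp

lemma is_adjoint_compose:
  "is_adjoint U U' \<Longrightarrow> is_adjoint V V' \<Longrightarrow> is_adjoint (U o\<^sub>L V) (V' o\<^sub>L U')"
  by (simp add: is_adjoint_def)

lemma is_adjoint_id: "is_adjoint id_blinfun id_blinfun"
  by (simp add: is_adjoint_def)

lemma is_adjoint_zero: "is_adjoint 0 (0::'h::complex_hilbert op)"
  by (metis is_adjoint_scaleR is_adjoint_id scaleR_zero_left)

lemma is_adjoint_sum: "(\<And>i. i \<in> I \<Longrightarrow> is_adjoint (U i) (V i)) \<Longrightarrow> is_adjoint (sum U I) (sum V I)"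
  by (induction I rule: infinite_finite_induct) (auto intro: is_adjoint_add is_adjoint_zero)

lemma is_adjoint_limit:
  fixes U :: "nat \<Rightarrow> 'h::complex_hilbert op"
  assumes "\<And>n. is_adjoint (U n) (V n)" "U \<longlonglongrightarrow> U'" "V \<longlonglongrightarrow> V'"
  shows "is_adjoint U' V'"
proof (rule is_adjointI)
  fix x y
  have "(\<lambda>n. cinner (blinfun_apply (U n) x) y) \<longlonglongrightarrow> cinner (blinfun_apply U' x) y"
    by (intro tendsto_cinner blinfun.tendsto assms tendsto_const)
  moreover have "(\<lambda>n. cinner x (blinfun_apply (V n) y)) \<longlonglongrightarrow> cinner x (blinfun_apply V' y)"
    by (intro tendsto_cinner blinfun.tendsto assms tendsto_const)
  ultimately show "cinner (blinfun_apply U' x) y = cinner x (blinfun_apply V' y)"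
    using assms(1) by (simp add: is_adjoint_def LIMSEQ_unique)
qed

lemma adjoint_inner: "is_adjoint U V \<Longrightarrow> inner (blinfun_apply U x) y = inner x (blinfun_apply V y)"
  by (metis is_adjointD Re_cinner)

lemma norm_adjoint_le:
  assumes "is_adjoint U V" shows "norm V \<le> norm U"
proof (rule norm_blinfun_bound)
  fix x
  have "(norm (blinfun_apply V x))\<^sup>2 = inner (blinfun_apply U (blinfun_apply V x)) x"
    using assms by (simp add: adjoint_inner power2_norm_eq_inner)
  also have "\<dots> \<le> norm (blinfun_apply U (blinfun_apply V x)) * norm x"
    by (rule norm_cauchy_schwarz)
  also have "\<dots> \<le> (norm U * norm (blinfun_apply V x)) * norm x"
    by (intro mult_right_mono norm_blinfun norm_ge_zero)
  finally have "norm (blinfun_apply V x) * norm (blinfun_apply V x) \<le> norm (blinfun_apply V x) * (norm U * norm x)"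
    by (simp add: power2_eq_square algebra_simps)
  then show "norm (blinfun_apply V x) \<le> norm U * norm x"
    by (cases "norm (blinfun_apply V x) = 0") (auto simp: mult_le_cancel_left)
qed simp

lemma norm_adjoint: "is_adjoint U V \<Longrightarrow> norm V = norm U"
  using norm_adjoint_le[of U V] norm_adjoint_le[of V U] is_adjoint_sym[of U V] by simp

fun opow :: "'h::complex_hilbert op \<Rightarrow> nat \<Rightarrow> 'h op" where
  "opow B 0 = id_blinfun"
| "opow B (Suc n) = B o\<^sub>L opow B n"

lemma opow_add: "opow B m o\<^sub>L opow B n = opow B (m + n)"
  by (induction m) (simp_all add: op_assoc)

lemma opow_commute: "B o\<^sub>L C = C o\<^sub>L B \<Longrightarrow> opow B n o\<^sub>L C = C o\<^sub>L opow B n"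
proof (induction n)
  case (Suc n)
  have "opow B (Suc n) o\<^sub>L C = B o\<^sub>L (opow B n o\<^sub>L C)" by (simp add: op_assoc)
  also have "\<dots> = (B o\<^sub>L C) o\<^sub>L opow B n" using Suc.IH[OF Suc.prems] by (simp only: op_assoc)
  finally show ?case using Suc.prems by (simp add: op_assoc)
qed simp

lemma opow_Suc2: "opow B (Suc n) = opow B n o\<^sub>L B"
  by (simp add: opow_commute)

lemma norm_opow_le: "norm B \<le> 1 \<Longrightarrow> norm (opow B n) \<le> 1"
proof (induction n)
  case 0
  show ?case by (rule norm_blinfun_bound) simp_all
next
  case (Suc n)
  have "norm (B o\<^sub>L opow B n) \<le> norm B * norm (opow B n)"
    by (rule norm_blinfun_compose)
  also have "\<dots> \<le> 1 * 1"
    using Suc by (intro mult_mono) auto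
  finally show ?case by simp
qed

lemma is_adjoint_opow: "is_adjoint B B' \<Longrightarrow> is_adjoint (opow B n) (opow B' n)"
proof (induction n)
  case 0 show ?case by (simp add: is_adjoint_id)
next
  case (Suc n)
  then have "is_adjoint (B o\<^sub>L opow B n) (opow B' n o\<^sub>L B')" by (intro is_adjoint_compose) auto
  then show ?case by (simp add: opow_commute)
qed

context
  fixes A :: "'h::complex_hilbert op set"
  assumes sub: "unital_subalgebra A"
begin

lemma subalg_id: "id_blinfun \<in> A"
  and subalg_add: "U \<in> A \<Longrightarrow> V \<in> A \<Longrightarrow> U + V \<in> A"
  and subalg_compose: "U \<in> A \<Longrightarrow> V \<in> A \<Longrightarrow> U o\<^sub>L V \<in> A"
  and subalg_op_scale: "U \<in> A \<Longrightarrow> op_scale a U \<in> A"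
  and subalg_bounded_ops: "U \<in> A \<Longrightarrow> U \<in> bounded_ops"
  using sub by (auto simp: unital_subalgebra_def)

lemma subalg_scaleR: "U \<in> A \<Longrightarrow> r *\<^sub>R U \<in> A"
  using subalg_op_scale[of U "of_real r"] by (simp add: op_scale_of_real)

lemma subalg_zero: "0 \<in> A"
  using subalg_scaleR[OF subalg_id, of 0] by simp

lemma subalg_uminus: "U \<in> A \<Longrightarrow> - U \<in> A"
  using subalg_scaleR[of U "-1"] by simp

lemma subalg_diff: "U \<in> A \<Longrightarrow> V \<in> A \<Longrightarrow> U - V \<in> A"
  using subalg_add[of U "-V"] subalg_uminus by simp

lemma subalg_sum: "(\<And>i. i \<in> I \<Longrightarrow> U i \<in> A) \<Longrightarrow> sum U I \<in> A"
  by (induction I rule: infinite_finite_induct) (auto intro: subalg_add subalg_zero)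

lemma subalg_opow: "U \<in> A \<Longrightarrow> opow U n \<in> A"
  by (induction n) (auto intro: subalg_compose subalg_id)

end

text \<open>The coefficients of the power series of \<open>sqrt (1 - x)\<close>.\<close>

definition sqc :: "nat \<Rightarrow> real" where
  "sqc i = ((1/2) gchoose i) * (- 1) ^ i"

lemma sqc_0 [simp]: "sqc 0 = 1"
  by (simp add: sqc_def)

lemma sqc_partial: "(\<Sum>i\<le>n. sqc i) = (- 1) ^ n * ((- (1/2)) gchoose n)"
  unfolding sqc_def using gbinomial_sum_lower_neg[of "1/2::real" n] by simp

lemma sqc_partial_Suc:
  "(\<Sum>i\<le>Suc n. sqc i) = (\<Sum>i\<le>n. sqc i) * ((2 * real n + 1) / (2 * real n + 2))"
  unfolding sqc_partial by (simp add: gbinomial_prod_rev field_simps)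

lemma sqc_partial_nonneg: "0 \<le> (\<Sum>i\<le>n. sqc i)"
  by (induction n) (simp_all only: sqc_partial_Suc, simp_all)

lemma sqc_nonpos:
  assumes "i > 0" shows "sqc i \<le> 0"
proof -
  obtain n where n: "i = Suc n" using assms by (cases i) auto
  have "(\<Sum>j\<le>n. sqc j) + sqc i = (\<Sum>j\<le>n. sqc j) * ((2 * real n + 1) / (2 * real n + 2))"
    using sqc_partial_Suc[of n] n by simp
  also have "\<dots> \<le> (\<Sum>j\<le>n. sqc j) * 1"
    by (intro mult_left_mono sqc_partial_nonneg) simp
  finally show ?thesis by simp
qed

text \<open>By \<open>sqc_partial_Suc\<close> the partial sums are the Wallis products of the
  factors (2 k - 1) / (2 k). The square of such a factor is at most k / (k + 1), and these bounds
  telescope.\<close>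

lemma sqc_partial_square_le: "(\<Sum>i\<le>n. sqc i)\<^sup>2 \<le> 1 / (real n + 1)"
proof (induction n)
  case (Suc n)
  have "(\<Sum>i\<le>Suc n. sqc i)\<^sup>2 = (\<Sum>i\<le>n. sqc i)\<^sup>2 * ((2 * real n + 1) / (2 * real n + 2))\<^sup>2"
    by (simp only: sqc_partial_Suc power_mult_distrib)
  also have "\<dots> \<le> 1 / (real n + 1) * ((2 * real n + 1) / (2 * real n + 2))\<^sup>2"
    by (intro mult_right_mono Suc.IH) simp
  also have "((2 * real n + 1) / (2 * real n + 2))\<^sup>2 \<le> (real n + 1) / (real n + 2)"
    by (simp add: divide_simps power2_eq_square) (simp add: algebra_simps)
  then have "1 / (real n + 1) * ((2 * real n + 1) / (2 * real n + 2))\<^sup>2 \<le>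
      1 / (real n + 1) * ((real n + 1) / (real n + 2))"
    by (intro mult_left_mono) simp_all
  also have "\<dots> = 1 / (real (Suc n) + 1)"
    by (simp add: field_simps)
  finally show ?case .
qed simp

lemma sqc_partial_square_tendsto: "(\<lambda>n. (\<Sum>i\<le>n. sqc i)\<^sup>2) \<longlonglongrightarrow> 0"
proof (rule tendsto_sandwich[OF _ _ tendsto_const])
  show "(\<lambda>n. 1 / (real n + 1)) \<longlonglongrightarrow> 0"
    using LIMSEQ_inverse_real_of_nat by (simp add: inverse_eq_divide add.commute)
qed (auto intro!: always_eventually sqc_partial_square_le)

text \<open>All coefficients but the first are nonpositive, so the sum of absolute values is 1 minus
  a partial sum, and the partial sums are nonnegative.\<close>

lemma abs_sqc_partial: "(\<Sum>i<n. \<bar>sqc (Suc i)\<bar>) \<le> 1"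
proof -
  have "(\<Sum>i<n. \<bar>sqc (Suc i)\<bar>) = - (\<Sum>i<n. sqc (Suc i))"
    by (simp add: sum_negf[symmetric] sqc_nonpos del: sum_negf)
  also have "\<dots> = 1 - (\<Sum>i\<le>n. sqc i)"
    by (simp add: sum.atMost_shift)
  finally show ?thesis
    using sqc_partial_nonneg[of n] by simp
qed

lemma summable_abs_sqc: "summable (\<lambda>i. \<bar>sqc (Suc i)\<bar>)"
  by (rule summableI_nonneg_bounded[OF _ abs_sqc_partial]) simp

lemma suminf_abs_sqc: "(\<Sum>i. \<bar>sqc (Suc i)\<bar>) \<le> 1"
  by (rule suminf_le_const[OF summable_abs_sqc abs_sqc_partial])

text \<open>Vandermonde's identity for 1/2 + 1/2 = 1: the Cauchy square of the series is 1 -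
  x.\<close>

lemma sqc_convolution:
  "(\<Sum>i\<le>k. sqc i * sqc (k - i)) = (if k = 0 then 1 else if k = 1 then - 1 else 0)"
proof -
  have "(\<Sum>i\<le>k. sqc i * sqc (k - i)) =
      (\<Sum>i\<le>k. (((1/2) gchoose i) * ((1/2) gchoose (k - i))) * (- 1) ^ k)"
  proof (rule sum.cong[OF refl])
    fix i assume "i \<in> {..k}"
    then have "(- 1 :: real) ^ k = (- 1) ^ i * (- 1) ^ (k - i)"
      by (simp flip: power_add)
    then show "sqc i * sqc (k - i) = (((1/2) gchoose i) * ((1/2) gchoose (k - i))) * (- 1) ^ k"
      by (simp add: sqc_def)
  qed
  also have "\<dots> = ((1::real) gchoose k) * (- 1) ^ k"
    using gbinomial_Vandermonde[of "1/2::real" "1/2" k]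
    by (simp add: atLeast0AtMost flip: sum_distrib_right)
  also have "(1::real) gchoose k = of_nat (1 choose k)"
    using binomial_gbinomial[of 1 k, where ?'a = real] by simp
  also have "of_nat (1 choose k) * (- 1) ^ k = (if k = 0 then 1 else if k = 1 then - 1 else 0::real)"
    by (cases "k \<le> 1") (auto simp: le_Suc_eq binomial_eq_0)
  finally show ?thesis .
qed

text \<open>The binomial series of \<open>(1 - B) powr (1/2)\<close> converges absolutely also when \<open>norm B = 1\<close>.\<close>

lemma sqrt_series:
  fixes A :: "'h::complex_hilbert op set"
  assumes sub: "unital_subalgebra A" and cl: "closed A" and BA: "B \<in> A" and B1: "norm B \<le> 1"
  shows "\<exists>V\<in>A. V o\<^sub>L V = id_blinfun - B \<and> norm (id_blinfun - V) \<le> 1 \<and>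
    (is_adjoint B B \<longrightarrow> is_adjoint V V) \<and> (\<forall>C. C o\<^sub>L B = B o\<^sub>L C \<longrightarrow> C o\<^sub>L V = V o\<^sub>L C)"
proof -
  define f where "f i = sqc i *\<^sub>R opow B i" for i
  define R where "R n = (\<Sum>i\<le>n. f i)" for n
  have nf: "norm (f i) \<le> \<bar>sqc i\<bar>" for i
    using norm_opow_le[OF B1, of i] by (simp add: f_def mult_left_le)
  have sf: "summable (\<lambda>i. norm (f (Suc i)))"
    by (rule summable_comparison_test'[OF summable_abs_sqc, of 0]) (simp add: nf)
  then have sf': "summable f"
    using summable_norm_cancel summable_Suc_iff by blast
  define V where "V = suminf f"
  have RV: "R \<longlonglongrightarrow> V"
    unfolding R_def V_def by (rule summable_LIMSEQ'[OF sf'])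
  have RA: "R n \<in> A" for n
    unfolding R_def f_def by (intro subalg_sum[OF sub] subalg_scaleR[OF sub] subalg_opow[OF sub] BA)
  have VA: "V \<in> A"
    using closed_sequentially[OF cl] RA RV by blast
  have "id_blinfun - V = - (\<Sum>i. f (Suc i))"
    unfolding V_def using suminf_split_head[OF sf'] by (simp add: f_def)
  also have "norm \<dots> \<le> (\<Sum>i. norm (f (Suc i)))"
    using summable_norm[OF sf] by simp
  also have "\<dots> \<le> (\<Sum>i. \<bar>sqc (Suc i)\<bar>)"
    by (rule suminf_le[OF nf sf summable_abs_sqc])
  finally have V1: "norm (id_blinfun - V) \<le> 1"
    using suminf_abs_sqc by simp
  have adj: "is_adjoint V V" if "is_adjoint B B"
    unfolding R_def f_def
    by (rule is_adjoint_limit[OF _ RV RV])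
      (unfold R_def f_def, intro is_adjoint_sum is_adjoint_scaleR is_adjoint_opow that)
  have comm: "C o\<^sub>L V = V o\<^sub>L C" if C: "C o\<^sub>L B = B o\<^sub>L C" for C
  proof (rule LIMSEQ_unique)
    show "(\<lambda>n. C o\<^sub>L R n) \<longlonglongrightarrow> (C o\<^sub>L V)"
      by (intro tendsto_compose_op RV tendsto_const)
    have "C o\<^sub>L R n = R n o\<^sub>L C" for n
      using opow_commute[OF C[symmetric]]
      by (simp add: R_def f_def compose_sum_left compose_sum_right compose_scaleR_left compose_scaleR_right)
    then show "(\<lambda>n. C o\<^sub>L R n) \<longlonglongrightarrow> (V o\<^sub>L C)"
      by (simp, intro tendsto_compose_op RV tendsto_const)
  qed
  \<comment> \<open>The terms of the squared partial sum with i + j \<le> n add up to 1 - B exactly;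
    both coefficients of 1 - B are reached as n \<ge> 1. In the remaining terms i and j are
    positive, so their coefficients are nonnegative and their norm is at most their value at B = 1.
    There 1 - B vanishes, which leaves the square of the sum of the coefficients.\<close>
  have est: "norm ((R n o\<^sub>L R n) - (id_blinfun - B)) \<le> (\<Sum>i\<le>n. sqc i)\<^sup>2" if n: "n \<ge> 1" for n
  proof -
    let ?T = "{(i,j). i + j \<le> n}" and ?Q = "{..n} \<times> {..n}"
    let ?g = "\<lambda>(i,j). (sqc i * sqc j) *\<^sub>R opow B (i + j)"
    let ?h = "\<lambda>(i,j). sqc i * sqc j"
    have sub': "?T \<subseteq> ?Q" by auto
    have RR: "R n o\<^sub>L R n = sum ?g ?Q"
    proof -
      have "R n o\<^sub>L R n = (\<Sum>i\<le>n. \<Sum>j\<le>n. f i o\<^sub>L f j)"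
        unfolding R_def by (subst compose_sum_left) (simp only: compose_sum_right)
      also have "\<dots> = (\<Sum>i\<le>n. \<Sum>j\<le>n. (sqc i * sqc j) *\<^sub>R opow B (i + j))"
        by (simp add: f_def compose_scaleR_left compose_scaleR_right opow_add mult.commute)
      finally show ?thesis by (simp only: sum.cartesian_product)
    qed
    have split: "sum k ?Q = sum k ?T + sum k (?Q - ?T)" for k :: "nat \<times> nat \<Rightarrow> 'c::ab_group_add"
      using sum.subset_diff[OF sub', of k] by (simp add: add.commute)
    have k2: "(\<Sum>k\<le>n. (if k = 0 then 1 else if k = 1 then - 1 else 0) *\<^sub>R u k) = u 0 - u 1"
      for u :: "nat \<Rightarrow> 'd::real_vector"
    proof -
      have "(\<Sum>k\<le>n. (if k = 0 then 1 else if k = 1 then - 1 else 0) *\<^sub>R u k) =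
          (\<Sum>k\<in>{0,1}. (if k = 0 then 1 else if k = 1 then - 1 else 0) *\<^sub>R u k)"
        using n by (intro sum.mono_neutral_right) auto
      then show ?thesis by simp
    qed
    have "sum ?g ?T = (\<Sum>k\<le>n. (\<Sum>i\<le>k. sqc i * sqc (k - i)) *\<^sub>R opow B k)"
      by (subst sum.triangle_reindex_eq) (simp add: scaleR_sum_left)
    then have T1: "sum ?g ?T = id_blinfun - B"
      using k2[of "opow B"] by (simp add: sqc_convolution)
    have "sum ?h ?T = (\<Sum>k\<le>n. (\<Sum>i\<le>k. sqc i * sqc (k - i)) *\<^sub>R 1)"
      by (subst sum.triangle_reindex_eq) simp
    then have T2: "sum ?h ?T = 0"
      using k2[of "\<lambda>_. 1::real"] by (simp only: sqc_convolution)
    have "norm ((R n o\<^sub>L R n) - (id_blinfun - B)) = norm (sum ?g (?Q - ?T))"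
      unfolding RR split[of ?g] T1 by simp
    also have "\<dots> \<le> (\<Sum>p\<in>?Q - ?T. norm (?g p))"
      by (rule norm_sum)
    also have "\<dots> \<le> sum ?h (?Q - ?T)"
    proof (rule sum_mono)
      fix p assume p: "p \<in> ?Q - ?T"
      obtain i j where ij: "p = (i, j)" by (cases p)
      with p have "i \<le> n" "j \<le> n" "\<not> i + j \<le> n" by auto
      then have "sqc i \<le> 0" "sqc j \<le> 0"
        by (auto intro!: sqc_nonpos)
      then have "0 \<le> sqc i * sqc j"
        by (rule mult_nonpos_nonpos)
      then show "norm (?g p) \<le> ?h p"
        using norm_opow_le[OF B1, of "i + j"] ij by (simp add: mult_left_le)
    qed
    also have "\<dots> = sum ?h ?Q"
      unfolding split[of ?h] T2 by simp
    also have "\<dots> = (\<Sum>i\<le>n. sqc i)\<^sup>2"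
      by (simp add: power2_eq_square sum_product sum.cartesian_product)
    finally show ?thesis .
  qed
  have "(\<lambda>n. (R n o\<^sub>L R n) - (id_blinfun - B)) \<longlonglongrightarrow> 0"
    by (rule tendsto_0_le[OF sqc_partial_square_tendsto, where K = 1])
      (use est in \<open>auto intro!: eventually_sequentiallyI[of 1]\<close>)
  moreover have "(\<lambda>n. (R n o\<^sub>L R n) - (id_blinfun - B)) \<longlonglongrightarrow> (V o\<^sub>L V) - (id_blinfun - B)"
    by (intro tendsto_diff tendsto_compose_op RV tendsto_const)
  ultimately have "V o\<^sub>L V = id_blinfun - B"
    using LIMSEQ_unique by fastforce
  then show ?thesis
    using VA V1 adj comm by blast
qed

section \<open>Norms and moments\<close>

locale nc_prob =
  fixes A :: "'h::complex_hilbert op set" and \<phi> :: "'h op \<Rightarrow> complex"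
  assumes nc: "nc_probability_space A \<phi>"
begin

lemma vN: "von_neumann_algebra A"
  using nc by (simp add: nc_probability_space_def)

lemma subA: "unital_subalgebra A"
  using vN by (simp add: von_neumann_algebra_def)

lemma adjointA: "U \<in> A \<Longrightarrow> \<exists>V\<in>A. is_adjoint U V"
  using vN by (simp add: von_neumann_algebra_def)

text \<open>Matrix coefficients are norm continuous, so a weakly closed set is norm closed. This
  keeps the limits of series, such as the square root, inside \<open>A\<close>.\<close>

lemma closedA: "closed A"
proof -
  let ?f = "\<lambda>U::'h op. \<lambda>(x, y). cinner x (blinfun_apply U y)"
  have "openin weak_operator_topology (- A)"
    using vN by (simp add: von_neumann_algebra_def closedin_def weak_operator_topology_def
        topspace_pullback_topology Compl_eq_Diff_UNIV)
  then obtain C where C: "open C" "- A = ?f -` C"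
    by (auto simp: weak_operator_topology_def openin_pullback_topology)
  have "continuous_on UNIV ?f"
  proof (rule continuous_on_coordinatewise_then_product)
    fix p :: "'h \<times> 'h"
    have "continuous_on UNIV (\<lambda>U::'h op. cinner (fst p) (blinfun_apply U (snd p)))"
      by (intro bounded_bilinear.continuous_on[OF bounded_bilinear_cinner] continuous_intros)
    then show "continuous_on UNIV (\<lambda>U::'h op. ?f U p)"
      by (simp add: case_prod_beta)
  qed
  then show ?thesis
    using C open_vimage[of C ?f] by (simp add: closed_def)
qed

lemmas A_id = subalg_id[OF subA]
lemmas A_add = subalg_add[OF subA]
lemmas A_compose = subalg_compose[OF subA]
lemmas A_op_scale = subalg_op_scale[OF subA]
lemmas A_bounded_ops = subalg_bounded_ops[OF subA]
lemmas A_scaleR = subalg_scaleR[OF subA]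
lemmas A_zero = subalg_zero[OF subA]
lemmas A_uminus = subalg_uminus[OF subA]
lemmas A_diff = subalg_diff[OF subA]
lemmas A_sum = subalg_sum[OF subA]
lemmas A_opow = subalg_opow[OF subA]
lemmas A_intros = A_id A_add A_compose A_op_scale A_scaleR A_zero A_uminus A_diff A_sum A_opow

lemma phi_add: "U \<in> A \<Longrightarrow> V \<in> A \<Longrightarrow> \<phi> (U + V) = \<phi> U + \<phi> V"
  using nc by (simp add: nc_probability_space_def)

lemma phi_op_scale: "U \<in> A \<Longrightarrow> \<phi> (op_scale a U) = a * \<phi> U"
  using nc by (simp add: nc_probability_space_def)

lemma phi_pos: "U \<in> A \<Longrightarrow> V \<in> A \<Longrightarrow> is_adjoint U V \<Longrightarrow> \<phi> (V o\<^sub>L U) \<in> \<real>\<^sub>\<ge>\<^sub>0"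
  using nc unfolding nc_probability_space_def by blast

lemma phi_faithful: "U \<in> A \<Longrightarrow> V \<in> A \<Longrightarrow> is_adjoint U V \<Longrightarrow> \<phi> (V o\<^sub>L U) = 0 \<Longrightarrow> U = 0"
  using nc unfolding nc_probability_space_def by blast

lemma phi_id [simp]: "\<phi> id_blinfun = 1"
  using nc by (simp add: nc_probability_space_def)

lemma phi_trace: "U \<in> A \<Longrightarrow> V \<in> A \<Longrightarrow> \<phi> (U o\<^sub>L V) = \<phi> (V o\<^sub>L U)"
  using nc by (simp add: nc_probability_space_def)

lemma phi_scaleR: "U \<in> A \<Longrightarrow> \<phi> (r *\<^sub>R U) = of_real r * \<phi> U"
  using phi_op_scale[of U "of_real r"] by (simp add: op_scale_of_real)

lemma phi_zero [simp]: "\<phi> 0 = 0"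
  using phi_scaleR[OF A_id, of 0] by simp

lemma phi_uminus: "U \<in> A \<Longrightarrow> \<phi> (- U) = - \<phi> U"
  using phi_scaleR[of U "-1"] by simp

lemma phi_diff: "U \<in> A \<Longrightarrow> V \<in> A \<Longrightarrow> \<phi> (U - V) = \<phi> U - \<phi> V"
  using phi_add[of U "- V"] by (simp add: phi_uminus A_uminus)

lemma phi_sum: "(\<And>i. i \<in> I \<Longrightarrow> U i \<in> A) \<Longrightarrow> \<phi> (sum U I) = (\<Sum>i\<in>I. \<phi> (U i))"
  by (induction I rule: infinite_finite_induct) (simp_all add: phi_add A_sum)

lemma Re_phi_pos: "U \<in> A \<Longrightarrow> V \<in> A \<Longrightarrow> is_adjoint U V \<Longrightarrow> 0 \<le> Re (\<phi> (V o\<^sub>L U))"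
  using phi_pos[of U V] by (auto simp: complex_nonneg_Reals_iff)

lemma Re_phi_faithful:
  "U \<in> A \<Longrightarrow> V \<in> A \<Longrightarrow> is_adjoint U V \<Longrightarrow> Re (\<phi> (V o\<^sub>L U)) \<le> 0 \<Longrightarrow> U = 0"
  using phi_pos[of U V] phi_faithful[of U V] by (auto simp: complex_nonneg_Reals_iff complex_eq_iff)

text \<open>Positivity gives real values on squares only. The square of S + r has a real value for
  every r, and comparing r = 1 with r = 0 isolates \<open>\<phi> S\<close>.\<close>

lemma phi_selfadjoint_real:
  assumes "S \<in> A" "is_adjoint S S" shows "Im (\<phi> S) = 0"
proof -
  have p: "Im (\<phi> ((S + r *\<^sub>R id_blinfun) o\<^sub>L (S + r *\<^sub>R id_blinfun))) = 0" for r
    using phi_pos[of "S + r *\<^sub>R id_blinfun" "S + r *\<^sub>R id_blinfun"] assms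
    by (auto simp: complex_nonneg_Reals_iff A_intros intro: is_adjoint_add is_adjoint_scaleR is_adjoint_id)
  have "(S + r *\<^sub>R id_blinfun) o\<^sub>L (S + r *\<^sub>R id_blinfun) = (S o\<^sub>L S) + (2 * r) *\<^sub>R S + (r * r) *\<^sub>R id_blinfun" for r
    by (simp add: compose_ring algebra_simps scaleR_2[symmetric])
  with p have "Im (\<phi> (S o\<^sub>L S)) + 2 * r * Im (\<phi> S) = 0" for r
    using assms(1) by (simp add: phi_add phi_scaleR A_intros)
  from this[of 1] this[of 0] show ?thesis by simp
qed

text \<open>By \<open>sqrt_series\<close>, 1 - S is the square of a self-adjoint element of
  \<open>A\<close>, hence has a nonnegative value.\<close>

lemma phi_selfadjoint_le:
  assumes S: "S \<in> A" "is_adjoint S S" "norm S \<le> 1" shows "Re (\<phi> S) \<le> 1"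
proof -
  obtain V where V: "V \<in> A" "V o\<^sub>L V = id_blinfun - S" "is_adjoint V V"
    using sqrt_series[OF subA closedA S(1,3)] S(2) by metis
  then have "0 \<le> Re (\<phi> (id_blinfun - S))"
    using Re_phi_pos[of V V] by simp
  then show ?thesis
    using S by (simp add: phi_diff A_id)
qed

lemma phi_selfadjoint_bound:
  assumes S: "S \<in> A" "is_adjoint S S" shows "cmod (\<phi> S) \<le> norm S"
proof (cases "S = 0")
  case False
  define r where "r = inverse (norm S)"
  have r: "r > 0" "r * norm S = 1" using False by (auto simp: r_def)
  have "Re (\<phi> (r *\<^sub>R S)) \<le> 1"
    by (rule phi_selfadjoint_le) (use S r in \<open>auto intro: A_intros is_adjoint_scaleR\<close>)
  moreover have "Re (\<phi> ((- r) *\<^sub>R S)) \<le> 1"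
    by (rule phi_selfadjoint_le) (use S r in \<open>auto intro!: A_intros is_adjoint_scaleR is_adjoint_uminus\<close>)
  ultimately have "\<bar>r * Re (\<phi> S)\<bar> \<le> r * norm S"
    using S r by (simp add: phi_scaleR phi_uminus A_intros)
  then have "\<bar>Re (\<phi> S)\<bar> \<le> norm S"
    using r by (simp add: abs_mult) (metis mult_le_cancel_left_pos)
  then show ?thesis
    using phi_selfadjoint_real[OF S] by (simp add: cmod_def)
qed simp

text \<open>Sum of the bounds for the self-adjoint and the skew part. The resulting 2 is harmless:
  the bound is only applied to moments of growing order, where constant factors do not
  matter.\<close>

lemma phi_bound:
  assumes W: "W \<in> A" shows "cmod (\<phi> W) \<le> 2 * norm W"
proof -
  obtain W' where W': "W' \<in> A" "is_adjoint W W'" using adjointA[OF W] by blast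
  note n = norm_adjoint[OF W'(2)]
  define S where "S = (1/2) *\<^sub>R (W + W')"
  define D where "D = op_scale (\<i>/2) (W - W')"
  have S: "S \<in> A" "is_adjoint S S"
    using W W'(1) is_adjoint_scaleR[OF is_adjoint_add[OF W'(2) is_adjoint_sym[OF W'(2)]], of "1/2"]
    unfolding S_def by (auto intro: A_intros simp: add.commute)
  have "is_adjoint D (op_scale (cnj (\<i>/2)) (W' - W))"
    unfolding D_def using W' by (intro is_adjoint_op_scale is_adjoint_diff is_adjoint_sym[OF W'(2)])
  moreover have "op_scale (cnj (\<i>/2)) (W' - W) = D"
    unfolding D_def using op_scale_op_scale[of "\<i>/2" "-1" "W' - W"]
    by (simp add: op_scale_of_real[of "-1", simplified])
  ultimately have D: "D \<in> A" "is_adjoint D D"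
    using W W' unfolding D_def by (auto intro!: A_intros)
  have "W = S + op_scale (- \<i>) D"
    unfolding S_def D_def op_scale_op_scale
    using op_scale_of_real[of "1/2" "W - W'"]
    by (simp add: scaleR_add_right scaleR_diff_right) (simp flip: scaleR_add_left)
  then have "\<phi> W = \<phi> S - \<i> * \<phi> D"
    using S D by (metis A_op_scale mult_minus_left phi_add phi_op_scale uminus_add_conv_diff add.commute)
  then have "cmod (\<phi> W) \<le> cmod (\<phi> S) + cmod (\<phi> D)"
    by (metis norm_ii norm_mult norm_triangle_ineq4 mult_1)
  also have "\<dots> \<le> norm S + norm D"
    by (intro add_mono phi_selfadjoint_bound S D)
  also have "norm S \<le> norm W"
    unfolding S_def using norm_triangle_ineq[of W W'] n by simp
  also have "norm D \<le> norm W"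
    unfolding D_def using norm_op_scale[of "\<i>/2" "W - W'"] norm_triangle_ineq4[of W W'] n
    by (simp add: norm_divide)
  finally show ?thesis by simp
qed

text \<open>The operator inequality g^2 \<le> (norm g)^2 as \<open>\<phi>\<close> sees it: up to
  scaling, the difference of the two sides is the square of a self-adjoint element V, and
  conjugating it by W gives a positive element.\<close>

lemma phi_square_le:
  assumes g: "g \<in> A" "is_adjoint g g" and W: "W \<in> A" "W' \<in> A" "is_adjoint W W'"
  shows "Re (\<phi> (W' o\<^sub>L (g o\<^sub>L (g o\<^sub>L W)))) \<le> (norm g)\<^sup>2 * Re (\<phi> (W' o\<^sub>L W))"
proof (cases "g = 0")
  case False
  define r where "r = inverse ((norm g)\<^sup>2)"
  have r: "r > 0" "(norm g)\<^sup>2 * r = 1" using False by (auto simp: r_def)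
  define B where "B = r *\<^sub>R (g o\<^sub>L g)"
  have "norm B \<le> r * (norm g * norm g)"
    unfolding B_def using r norm_blinfun_compose[of g g] by simp
  then have B1: "norm B \<le> 1" using r by (simp add: power2_eq_square mult.commute)
  have B: "B \<in> A" "is_adjoint B B"
    using g by (auto simp: B_def intro!: A_intros is_adjoint_scaleR is_adjoint_compose)
  obtain V where V: "V \<in> A" "V o\<^sub>L V = id_blinfun - B" "is_adjoint V V"
    using sqrt_series[OF subA closedA B(1) B1] B(2) by metis
  have "0 \<le> Re (\<phi> ((W' o\<^sub>L V) o\<^sub>L (V o\<^sub>L W)))"
    using V W by (intro Re_phi_pos A_intros is_adjoint_compose)
  also have "(W' o\<^sub>L V) o\<^sub>L (V o\<^sub>L W) = W' o\<^sub>L ((V o\<^sub>L V) o\<^sub>L W)"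
    by (simp add: op_assoc)
  also have "\<dots> = (W' o\<^sub>L W) - r *\<^sub>R (W' o\<^sub>L (g o\<^sub>L (g o\<^sub>L W)))"
    unfolding V B_def by (simp add: compose_ring)
  finally have "r * Re (\<phi> (W' o\<^sub>L (g o\<^sub>L (g o\<^sub>L W)))) \<le> Re (\<phi> (W' o\<^sub>L W))"
    using g W by (simp add: phi_diff phi_scaleR A_intros)
  then have "(norm g)\<^sup>2 * (r * Re (\<phi> (W' o\<^sub>L (g o\<^sub>L (g o\<^sub>L W))))) \<le> (norm g)\<^sup>2 * Re (\<phi> (W' o\<^sub>L W))"
    by (rule mult_left_mono) simp
  then show ?thesis using r by (simp flip: mult.assoc)
qed (simp add: compose_ring)

text \<open>Faithfulness turns moment bounds into norm bounds: with \<open>S = T - d\<close> the operator \<open>g = \<bar>S\<bar> + S\<close>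
  satisfies \<open>\<phi> (g T\<^sup>n g) \<ge> d\<^sup>n \<phi> (g\<^sup>2)\<close>, so that \<open>g = 0\<close> if the moments of \<open>T\<close> grow slower than \<open>d\<^sup>n\<close>.\<close>

lemma quadratic_form_le_of_moments:
  assumes T: "T \<in> A" "is_adjoint T T" and c: "0 \<le> c" "c < d"
    and mom: "\<And>n. Re (\<phi> (opow T n)) \<le> K * c ^ n"
  shows "inner x (blinfun_apply T x) \<le> d * (norm x)\<^sup>2"
proof -
  define S where "S = T - d *\<^sub>R id_blinfun"
  have S: "S \<in> A" "is_adjoint S S"
    using T by (auto simp: S_def intro!: A_intros is_adjoint_diff is_adjoint_scaleR is_adjoint_id)
  \<comment> \<open>The added 1 keeps M positive also for S = 0, so that S / M makes sense.\<close>
  define M where "M = norm S + 1"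
  have M: "M > 0" "norm S \<le> M" by (auto simp: M_def add_nonneg_pos)
  define r where "r = inverse (M\<^sup>2)"
  have r: "r > 0" "M\<^sup>2 * r = 1" using M by (auto simp: r_def)
  define B where "B = id_blinfun - r *\<^sub>R (S o\<^sub>L S)"
  have B: "B \<in> A" "is_adjoint B B"
    using S by (auto simp: B_def intro!: A_intros is_adjoint_diff is_adjoint_scaleR is_adjoint_id is_adjoint_compose)
  \<comment> \<open>As a quadratic form S^2 / M^2 lies between 0 and 1, hence so does B; the
    computation shows directly that B does not increase norms.\<close>
  have "norm B \<le> 1"
  proof (rule norm_blinfun_bound)
    fix x
    let ?y = "blinfun_apply S x" let ?z = "blinfun_apply S ?y"
    have "(norm (x - r *\<^sub>R ?z))\<^sup>2 = (norm x)\<^sup>2 - 2 * r * inner x ?z + r * r * (norm ?z)\<^sup>2"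
      by (simp add: power2_norm_eq_inner inner_diff_left inner_diff_right inner_commute algebra_simps)
    also have "inner x ?z = (norm ?y)\<^sup>2"
      using adjoint_inner[OF S(2), of x ?y] by (simp add: power2_norm_eq_inner)
    also have "(norm ?z)\<^sup>2 \<le> (M * norm ?y)\<^sup>2"
      using norm_blinfun[of S ?y] M mult_right_mono[OF M(2), of "norm ?y"] by (intro power_mono) auto
    then have "r * r * (norm ?z)\<^sup>2 \<le> r * r * (M * norm ?y)\<^sup>2"
      using r by (intro mult_left_mono) auto
    also have "r * r * (M * norm ?y)\<^sup>2 = r * (norm ?y)\<^sup>2 * (M\<^sup>2 * r)"
      by (simp add: power_mult_distrib)
    finally have "(norm (x - r *\<^sub>R ?z))\<^sup>2 \<le> (norm x)\<^sup>2 - r * (norm ?y)\<^sup>2"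
      using r by simp
    also have "\<dots> \<le> (norm x)\<^sup>2" using r by simp
    finally have "norm (x - r *\<^sub>R ?z) \<le> norm x"
      by (rule power2_le_imp_le) simp
    then show "norm (blinfun_apply B x) \<le> 1 * norm x"
      by (simp add: B_def minus_blinfun.rep_eq scaleR_blinfun.rep_eq)
  qed simp
  \<comment> \<open>V is |S| / M and P is its square root, so that R = |S| and Q = sqrt |S|. Since V
    is a limit of polynomials in S^2, it commutes with S. From R^2 = S^2 and S R = R S follows S g =
    R g for g = R + S.\<close>
  then obtain V where V0: "V \<in> A" "V o\<^sub>L V = id_blinfun - B" "norm (id_blinfun - V) \<le> 1"
        "is_adjoint B B \<Longrightarrow> is_adjoint V V"
      and Vc: "\<And>C. C o\<^sub>L B = B o\<^sub>L C \<Longrightarrow> C o\<^sub>L V = V o\<^sub>L C"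
    using sqrt_series[OF subA closedA B(1)] by blast
  have V: "V \<in> A" "V o\<^sub>L V = r *\<^sub>R (S o\<^sub>L S)" "norm (id_blinfun - V) \<le> 1" "is_adjoint V V"
    using V0(1-3) V0(4)[OF B(2)] by (simp_all add: B_def)
  have "id_blinfun - V \<in> A" "is_adjoint (id_blinfun - V) (id_blinfun - V)"
    using V by (auto intro!: A_intros is_adjoint_diff is_adjoint_id)
  then obtain P where P: "P \<in> A" "P o\<^sub>L P = V" "is_adjoint P P"
    using sqrt_series[OF subA closedA _ V(3)] by (metis diff_diff_eq2 add_diff_cancel_left')
  define Q where "Q = sqrt M *\<^sub>R P"
  define R where "R = M *\<^sub>R V"
  have Q: "Q \<in> A" "is_adjoint Q Q" and R: "R \<in> A"
    using P V by (auto simp: Q_def R_def intro!: A_intros is_adjoint_scaleR)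
  have QQ: "Q o\<^sub>L Q = R"
    using M P by (simp add: Q_def R_def compose_ring)
  then have Rs: "is_adjoint R R" using is_adjoint_compose[OF Q(2) Q(2)] by simp
  have "S o\<^sub>L B = B o\<^sub>L S"
    by (simp add: B_def compose_ring)
  then have SR: "S o\<^sub>L R = R o\<^sub>L S"
    using Vc by (simp add: R_def compose_ring)
  have RR: "R o\<^sub>L R = S o\<^sub>L S"
    using V(2) r by (simp add: R_def compose_ring power2_eq_square mult.assoc)
  define g where "g = R + S"
  have g: "g \<in> A" "is_adjoint g g"
    using R Rs S by (auto simp: g_def intro!: A_intros is_adjoint_add)
  have Tg: "T o\<^sub>L g = d *\<^sub>R g + (R o\<^sub>L g)"
  proof -
    have "S o\<^sub>L g = R o\<^sub>L g" by (simp add: g_def compose_ring SR RR)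
    moreover have "T = S + d *\<^sub>R id_blinfun" by (simp add: S_def)
    ultimately show ?thesis by (simp add: compose_ring)
  qed
  have TR: "T o\<^sub>L R = R o\<^sub>L T"
    using SR by (simp add: S_def compose_ring)
  \<comment> \<open>From T g = d g + R g one gets f (n + 1) k = d f n k + f n (k + 1). All terms are
    nonnegative, because R has the square root Q, so f n 0 is at least d^n f 0 0.\<close>
  define f where "f n k = Re (\<phi> (g o\<^sub>L (opow R k o\<^sub>L (opow T n o\<^sub>L g))))" for n k
  have f0: "0 \<le> f 0 k" for k
  proof -
    have "opow R k = opow Q k o\<^sub>L opow Q k"
    proof (induction k)
      case (Suc k)
      have "opow Q (Suc k) o\<^sub>L opow Q (Suc k) = Q o\<^sub>L (opow Q k o\<^sub>L (Q o\<^sub>L opow Q k))"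
        by (simp add: op_assoc)
      also have "opow Q k o\<^sub>L (Q o\<^sub>L opow Q k) = Q o\<^sub>L (opow Q k o\<^sub>L opow Q k)"
        by (metis op_assoc opow_commute)
      finally show ?case using Suc by (simp add: QQ flip: op_assoc)
    qed simp
    then have "f 0 k = Re (\<phi> ((g o\<^sub>L opow Q k) o\<^sub>L (opow Q k o\<^sub>L g)))"
      by (simp add: f_def op_assoc)
    then show ?thesis
      using g Q by (auto intro!: Re_phi_pos A_intros is_adjoint_compose is_adjoint_opow)
  qed
  have fS: "f (Suc n) k = d * f n k + f n (Suc k)" for n k
  proof -
    have "opow T (Suc n) o\<^sub>L g = opow T n o\<^sub>L (T o\<^sub>L g)"
      by (simp only: opow_Suc2 op_assoc)
    also have "\<dots> = d *\<^sub>R (opow T n o\<^sub>L g) + (R o\<^sub>L (opow T n o\<^sub>L g))"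
      using opow_commute[OF TR, of n] by (simp add: Tg compose_add_right compose_scaleR_right flip: op_assoc)
    finally have "g o\<^sub>L (opow R k o\<^sub>L (opow T (Suc n) o\<^sub>L g)) =
        d *\<^sub>R (g o\<^sub>L (opow R k o\<^sub>L (opow T n o\<^sub>L g))) + (g o\<^sub>L (opow R (Suc k) o\<^sub>L (opow T n o\<^sub>L g)))"
      by (simp add: compose_add_right compose_scaleR_right opow_Suc2 op_assoc del: opow.simps)
    then show ?thesis
      unfolding f_def using g R T by (simp add: phi_add phi_scaleR A_intros del: opow.simps)
  qed
  have fpos: "0 \<le> f n k" for n k
    by (induction n arbitrary: k) (use f0 fS c in auto)
  have fge: "d ^ n * f 0 0 \<le> f n 0" for n
  proof (induction n)
    case (Suc n)
    have "d ^ Suc n * f 0 0 \<le> d * f n 0"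
      using mult_left_mono[OF Suc, of d] c by (simp add: mult.assoc)
    then show ?case using fpos[of n 1] by (simp add: fS)
  qed simp
  \<comment> \<open>The even exponent splits as T^n T^n. By the trace property g^2 moves between the
    two factors, where it costs only its norm and leaves a moment of T.\<close>
  have fle: "f (2 * n) 0 \<le> (norm g)\<^sup>2 * (K * c ^ (2 * n))" for n
  proof -
    have "f (2 * n) 0 = Re (\<phi> ((g o\<^sub>L opow T n) o\<^sub>L (opow T n o\<^sub>L g)))"
      by (simp add: f_def mult_2 op_assoc flip: opow_add)
    also have "\<dots> = Re (\<phi> (opow T n o\<^sub>L (g o\<^sub>L (g o\<^sub>L opow T n))))"
      using g T by (subst phi_trace) (auto intro!: A_intros simp: op_assoc)
    also have "\<dots> \<le> (norm g)\<^sup>2 * Re (\<phi> (opow T n o\<^sub>L opow T n))"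
      using g T by (intro phi_square_le A_intros is_adjoint_opow)
    also have "\<dots> \<le> (norm g)\<^sup>2 * (K * c ^ (2 * n))"
      unfolding opow_add mult_2[symmetric] by (intro mult_left_mono mom) simp
    finally show ?thesis .
  qed
  have "f 0 0 \<le> (norm g)\<^sup>2 * K * ((c / d)\<^sup>2) ^ n" for n
  proof -
    have "d ^ (2 * n) * f 0 0 \<le> (norm g)\<^sup>2 * (K * c ^ (2 * n))"
      using fge[of "2 * n"] fle[of n] by linarith
    then show ?thesis
      using c by (simp add: power_mult[symmetric] power_divide field_simps)
  qed
  moreover have "(\<lambda>n. (norm g)\<^sup>2 * K * ((c / d)\<^sup>2) ^ n) \<longlonglongrightarrow> (norm g)\<^sup>2 * K * 0"
    using c by (intro tendsto_intros LIMSEQ_power_zero) (simp add: power_less_one_iff abs_square_less_1)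
  ultimately have "f 0 0 \<le> 0"
    using LIMSEQ_le_const by (metis mult_zero_right)
  then have "g = 0"
    using Re_phi_faithful[OF g(1) g(1) g(2)] by (simp add: f_def)
  \<comment> \<open>g = 0 says S = - |S| = - Q^2, so that d - T is the square of a self-adjoint
    operator.\<close>
  then have "T = d *\<^sub>R id_blinfun - (Q o\<^sub>L Q)"
    unfolding QQ by (simp add: g_def S_def algebra_simps)
  then have "inner x (blinfun_apply T x) = d * (norm x)\<^sup>2 - inner x (blinfun_apply Q (blinfun_apply Q x))"
    by (simp add: minus_blinfun.rep_eq scaleR_blinfun.rep_eq inner_diff_right power2_norm_eq_inner)
  also have "inner x (blinfun_apply Q (blinfun_apply Q x)) = (norm (blinfun_apply Q x))\<^sup>2"
    using adjoint_inner[OF Q(2), of x "blinfun_apply Q x"] by (simp add: power2_norm_eq_inner)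
  finally show ?thesis by simp
qed

text \<open>The previous lemma for T = Z' Z, whose quadratic form at x is the squared norm of Z x.
  The constant \<open>K\<close> disappears because only the growth rate of the moments
  counts.\<close>

lemma norm_le_of_moments:
  assumes Z: "Z \<in> A" "Z' \<in> A" "is_adjoint Z Z'" and c: "0 \<le> c"
    and mom: "\<And>n. Re (\<phi> (opow (Z' o\<^sub>L Z) n)) \<le> K * (c\<^sup>2) ^ n"
  shows "norm Z \<le> c"
proof (rule field_le_epsilon)
  fix e :: real assume e: "e > 0"
  have "is_adjoint (Z' o\<^sub>L Z) (Z' o\<^sub>L Z)"
    by (rule is_adjoint_compose[OF is_adjoint_sym[OF Z(3)] Z(3)])
  moreover have "c\<^sup>2 < (c + e)\<^sup>2"
    using c e by (intro power_strict_mono) auto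
  ultimately have *: "inner x (blinfun_apply (Z' o\<^sub>L Z) x) \<le> (c + e)\<^sup>2 * (norm x)\<^sup>2" for x
    using quadratic_form_le_of_moments[OF A_compose[OF Z(2,1)] _ _ _ mom] by simp
  show "norm Z \<le> c + e"
  proof (rule norm_blinfun_bound)
    fix x
    have "(norm (blinfun_apply Z x))\<^sup>2 = inner x (blinfun_apply (Z' o\<^sub>L Z) x)"
      unfolding power2_norm_eq_inner by (simp add: adjoint_inner[OF Z(3)])
    also have "\<dots> \<le> ((c + e) * norm x)\<^sup>2"
      unfolding power_mult_distrib by (rule *)
    finally show "norm (blinfun_apply Z x) \<le> (c + e) * norm x"
      by (rule power2_le_imp_le) (use c e in simp)
  qed (use c e in simp)
qed

end

section \<open>Pairings and the Wick formula\<close>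

text \<open>Pairings of arbitrary sets of positions: when a pairing is split into two families of
  letters, the positions of a family are no initial segment.\<close>

definition pairs_on :: "nat set \<Rightarrow> nat set set set" where
  "pairs_on S = {\<pi>. partition_on S \<pi> \<and> (\<forall>b\<in>\<pi>. card b = 2)}"

lemma pairings_eq: "pairings r = pairs_on {..<r}"
  by (simp add: pairings_def pairs_on_def)

lemma finite_pairs_on: "finite S \<Longrightarrow> finite (pairs_on S)"
  by (rule finite_subset[of _ "Pow (Pow S)"]) (auto simp: pairs_on_def partition_on_def)

lemma pairs_on_finite: "\<pi> \<in> pairs_on S \<Longrightarrow> finite S \<Longrightarrow> finite \<pi>"
  by (simp add: pairs_on_def) (metis finite_elements)

lemma card2_MinMax:
  fixes b :: "nat set"
  assumes "card b = 2" shows "b = {Min b, Max b}" "Min b < Max b"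
proof -
  obtain x y where "b = {x, y}" "x \<noteq> y" using assms by (auto simp: card_2_iff)
  then show "b = {Min b, Max b}" "Min b < Max b" by (auto simp: min_def max_def)
qed

lemma pairs_on_block:
  assumes "\<pi> \<in> pairs_on S" "b \<in> \<pi>"
  shows "b \<subseteq> S" "card b = 2" "finite b" "b = {Min b, Max b}" "Min b < Max b" "Min b \<in> b" "Max b \<in> b"
proof -
  show c: "card b = 2" and s: "b \<subseteq> S" using assms by (auto simp: pairs_on_def partition_on_def)
  then show f: "finite b" by (metis card.infinite zero_neq_numeral)
  show "b = {Min b, Max b}" "Min b < Max b" by (fact card2_MinMax[OF c])+
  then show "Min b \<in> b" "Max b \<in> b" by blast+
qed

lemma pairs_on_unique: "\<pi> \<in> pairs_on S \<Longrightarrow> b \<in> \<pi> \<Longrightarrow> c \<in> \<pi> \<Longrightarrow> x \<in> b \<Longrightarrow> x \<in> c \<Longrightarrow> b = c"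
  by (auto simp: pairs_on_def partition_on_def disjoint_def)

lemma pairs_on_cover: "\<pi> \<in> pairs_on S \<Longrightarrow> x \<in> S \<Longrightarrow> \<exists>b\<in>\<pi>. x \<in> b"
  by (auto simp: pairs_on_def partition_on_def)

lemma card_pairs_on: "\<pi> \<in> pairs_on S \<Longrightarrow> finite S \<Longrightarrow> 2 * card \<pi> = card S"
proof -
  assume p: "\<pi> \<in> pairs_on S" and f: "finite S"
  have "card S = (\<Sum>b\<in>\<pi>. card b)"
    using p f by (intro product_partition) (auto simp: pairs_on_def intro: pairs_on_block(3)[OF p])
  also have "\<dots> = (\<Sum>b\<in>\<pi>. 2)" using p by (intro sum.cong) (auto simp: pairs_on_def)
  finally show ?thesis by simp
qed

lemma pairs_on_empty: "pairs_on {} = {{}}"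
  by (auto simp: pairs_on_def partition_on_def)

lemma crossings_empty [simp]: "crossings {} = 0"
  by (simp add: crossings_def)

text \<open>The covariance is a parameter, so that one formula serves for times, for linear
  combinations of the path and for covariances damped by powers of q.\<close>

definition wick_sum :: "real \<Rightarrow> ('l \<Rightarrow> 'l \<Rightarrow> real) \<Rightarrow> 'l list \<Rightarrow> real" where
  "wick_sum q K w =
    (\<Sum>\<pi>\<in>pairings (length w). q ^ crossings \<pi> * (\<Prod>b\<in>\<pi>. K (w ! Min b) (w ! Max b)))"

lemma wick_sum_Nil [simp]: "wick_sum q K [] = 1"
  by (simp add: wick_sum_def pairings_eq pairs_on_empty)

lemma wick_sum_map: "wick_sum q K (map f w) = wick_sum q (\<lambda>x y. K (f x) (f y)) w"
  unfolding wick_sum_def length_map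
proof (intro sum.cong refl arg_cong2[where f = "(*)"] prod.cong)
  fix \<pi> b assume "\<pi> \<in> pairings (length w)" "b \<in> \<pi>"
  then have "Min b < length w" "Max b < length w"
    using pairs_on_block(1,6,7)[of \<pi> "{..<length w}" b] by (auto simp: pairings_eq)
  then show "K (map f w ! Min b) (map f w ! Max b) = K (f (w ! Min b)) (f (w ! Max b))"
    by simp
qed

lemma wick_sum_cong:
  assumes "\<And>x y. x \<in> set w \<Longrightarrow> y \<in> set w \<Longrightarrow> K x y = K' x y"
  shows "wick_sum q K w = wick_sum q K' w"
  unfolding wick_sum_def
proof (intro sum.cong refl arg_cong2[where f = "(*)"] prod.cong)
  fix \<pi> b assume "\<pi> \<in> pairings (length w)" "b \<in> \<pi>"
  then have "Min b < length w" "Max b < length w"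
    using pairs_on_block(1,6,7)[of \<pi> "{..<length w}" b] by (auto simp: pairings_eq)
  then show "K (w ! Min b) (w ! Max b) = K' (w ! Min b) (w ! Max b)"
    using assms by simp
qed

lemma wick_sum_replicate:
  assumes "n = 2 * m"
  shows "wick_sum q K (replicate n z) = K z z ^ m * (\<Sum>\<pi>\<in>pairings n. q ^ crossings \<pi>)"
  unfolding wick_sum_def sum_distrib_left length_replicate
proof (intro sum.cong refl)
  fix \<pi> assume p: "\<pi> \<in> pairings n"
  then have c: "card \<pi> = m"
    using card_pairs_on[of \<pi> "{..<n}"] assms by (simp add: pairings_eq)
  have "(\<Prod>b\<in>\<pi>. K (replicate n z ! Min b) (replicate n z ! Max b)) = (\<Prod>b\<in>\<pi>. K z z)"
  proof (intro prod.cong refl)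
    fix b assume "b \<in> \<pi>"
    then have "Min b < n" "Max b < n"
      using pairs_on_block(1,6,7)[of \<pi> "{..<n}" b] p by (auto simp: pairings_eq)
    then show "K (replicate n z ! Min b) (replicate n z ! Max b) = K z z" by simp
  qed
  then show "q ^ crossings \<pi> * (\<Prod>b\<in>\<pi>. K (replicate n z ! Min b) (replicate n z ! Max b)) =
      K z z ^ m * q ^ crossings \<pi>"
    using c by simp
qed

text \<open>Multilinearity in a single letter: the position of x lies in exactly one block of each
  pairing, and only the factor of this block sees x.\<close>

lemma wick_sum_slot:
  assumes "\<And>l. K x l = (\<Sum>i\<in>I. c i * K (u i) l)" "\<And>l. K l x = (\<Sum>i\<in>I. c i * K l (u i))"
  shows "wick_sum q K (xs @ x # ys) = (\<Sum>i\<in>I. c i * wick_sum q K (xs @ u i # ys))"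
proof -
  let ?k = "length xs" and ?n = "length (xs @ x # ys)"
  have "(\<Prod>b\<in>\<pi>. K ((xs @ x # ys) ! Min b) ((xs @ x # ys) ! Max b)) =
      (\<Sum>i\<in>I. c i * (\<Prod>b\<in>\<pi>. K ((xs @ u i # ys) ! Min b) ((xs @ u i # ys) ! Max b)))"
    if p: "\<pi> \<in> pairs_on {..<?n}" for \<pi>
  proof -
    obtain b0 where b0: "b0 \<in> \<pi>" "?k \<in> b0"
      using pairs_on_cover[OF p, of ?k] by auto
    have fin: "finite \<pi>" using pairs_on_finite[OF p] by simp
    let ?F = "\<lambda>y b. K ((xs @ y # ys) ! Min b) ((xs @ y # ys) ! Max b)"
    have nth: "(xs @ y # ys) ! i = (xs @ x # ys) ! i" if "i \<noteq> ?k" for i y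
      using that by (auto simp: nth_append nth_Cons split: nat.splits)
    have rest: "(\<Prod>b\<in>\<pi> - {b0}. ?F y b) = (\<Prod>b\<in>\<pi> - {b0}. ?F x b)" for y
    proof (intro prod.cong refl)
      fix b assume b: "b \<in> \<pi> - {b0}"
      then have "?k \<notin> b" using pairs_on_unique[OF p _ b0(1) _ b0(2)] by blast
      then have "Min b \<noteq> ?k" "Max b \<noteq> ?k"
        using pairs_on_block(6,7)[OF p, of b] b by auto
      then show "?F y b = ?F x b" using nth by metis
    qed
    have split: "(\<Prod>b\<in>\<pi>. ?F y b) = ?F y b0 * (\<Prod>b\<in>\<pi> - {b0}. ?F x b)" for y
      using prod.remove[OF fin b0(1), of "?F y"] rest[of y] by simp
    have "?F x b0 = (\<Sum>i\<in>I. c i * ?F (u i) b0)"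
    proof -
      have lt: "Min b0 < Max b0" and eq: "b0 = {Min b0, Max b0}"
        using pairs_on_block[OF p b0(1)] by auto
      have kk: "(xs @ y # ys) ! ?k = y" for y by simp
      from eq b0(2) consider "?k = Min b0" "Max b0 \<noteq> ?k" | "?k = Max b0" "Min b0 \<noteq> ?k"
        using lt by auto
      then show ?thesis
      proof cases
        case 1
        have "?F y b0 = K y ((xs @ x # ys) ! Max b0)" for y
          using kk[of y] nth[OF 1(2), of y] by (simp only: 1(1))
        then show ?thesis by (simp only: assms(1))
      next
        case 2
        have "?F y b0 = K ((xs @ x # ys) ! Min b0) y" for y
          using kk[of y] nth[OF 2(2), of y] by (simp only: 2(1))
        then show ?thesis by (simp only: assms(2))
      qed
    qed
    then show ?thesis
      unfolding split by (simp add: sum_distrib_right mult.assoc)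
  qed
  then have "wick_sum q K (xs @ x # ys) = (\<Sum>\<pi>\<in>pairs_on {..<?n}. q ^ crossings \<pi> *
      (\<Sum>i\<in>I. c i * (\<Prod>b\<in>\<pi>. K ((xs @ u i # ys) ! Min b) ((xs @ u i # ys) ! Max b))))"
    unfolding wick_sum_def pairings_eq by (intro sum.cong) auto
  also have "\<dots> = (\<Sum>i\<in>I. c i * wick_sum q K (xs @ u i # ys))"
    unfolding wick_sum_def pairings_eq sum_distrib_left
    by (subst sum.swap) (simp add: mult.left_commute)
  finally show ?thesis .
qed

section \<open>Moments of words in linear combinations of the path\<close>

definition oprod :: "'h::complex_hilbert op list \<Rightarrow> 'h op" where
  "oprod Us = foldr (o\<^sub>L) Us id_blinfun"

lemma oprod_Nil [simp]: "oprod [] = id_blinfun"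
  and oprod_Cons [simp]: "oprod (U # Us) = U o\<^sub>L oprod Us"
  by (simp_all add: oprod_def)

lemma oprod_append [simp]: "oprod (Us @ Vs) = oprod Us o\<^sub>L oprod Vs"
  by (induction Us) (simp_all add: op_assoc)

lemma oprod_replicate: "oprod (replicate n U) = opow U n"
  by (induction n) simp_all

lemma oprod_in: "unital_subalgebra B \<Longrightarrow> set Us \<subseteq> B \<Longrightarrow> oprod Us \<in> B"
  by (induction Us) (auto intro: subalg_id subalg_compose)

type_synonym combo = "(real \<times> real) list"

text \<open>A combination \<open>[(c\<^sub>1, t\<^sub>1), \<dots>]\<close> stands for \<open>c\<^sub>1 X\<^sub>t\<^sub>1 + \<dots>\<close>.\<close>

definition cov :: "combo \<Rightarrow> combo \<Rightarrow> real" where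
  "cov z w = (\<Sum>p\<leftarrow>z. \<Sum>r\<leftarrow>w. fst p * fst r * min (snd p) (snd r))"

definition val :: "(real \<Rightarrow> 'h::complex_hilbert op) \<Rightarrow> combo \<Rightarrow> 'h op" where
  "val X z = (\<Sum>p\<leftarrow>z. fst p *\<^sub>R X (snd p))"

definition times_in :: "real set \<Rightarrow> combo \<Rightarrow> bool" where
  "times_in S z \<longleftrightarrow> (\<forall>(c, t)\<in>set z. t \<in> S)"

lemma sum_list_scale: "(\<Sum>x\<leftarrow>xs. (a::real) * f x) = a * (\<Sum>x\<leftarrow>xs. f x)"
  by (induction xs) (simp_all add: algebra_simps)

lemma sum_list_add: "(\<Sum>x\<leftarrow>xs. f x + g x) = (\<Sum>x\<leftarrow>xs. f x) + (\<Sum>x\<leftarrow>xs. (g x::'a::comm_monoid_add))"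
  by (induction xs) (simp_all add: algebra_simps)

lemma cov_Nil [simp]: "cov [] w = 0" "cov w [] = 0"
  by (simp_all add: cov_def)

lemma cov_Cons_left: "cov ((c, t) # z) w = c * cov [(1, t)] w + cov z w"
  by (simp add: cov_def mult.assoc sum_list_scale)

lemma cov_sym: "cov z w = cov w z"
proof (induction z)
  case (Cons a z)
  have "cov w (a # z) = (\<Sum>r\<leftarrow>w. fst r * fst a * min (snd r) (snd a)) + cov w z"
    by (simp add: cov_def sum_list_add)
  then show ?case
    using Cons by (cases a) (simp add: cov_def mult.commute min.commute mult.left_commute)
qed simp

lemma cov_append_left: "cov (z @ z') w = cov z w + cov z' w"
  by (simp add: cov_def)

lemma cov_append_right: "cov w (z @ z') = cov w z + cov w z'"
  by (metis cov_append_left cov_sym)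

lemma val_Nil [simp]: "val X [] = 0"
  and val_Cons [simp]: "val X ((c, t) # z) = c *\<^sub>R X t + val X z"
  and val_append [simp]: "val X (z @ z') = val X z + val X z'"
  by (simp_all add: val_def)

lemma cov_expand: "cov z w = (\<Sum>i<length z. fst (z ! i) * cov [(1, snd (z ! i))] w)"
proof (induction z)
  case (Cons a z)
  then show ?case by (cases a) (simp add: cov_Cons_left[of _ _ z] sum.lessThan_Suc_shift del: sum.lessThan_Suc)
qed simp

lemma val_expand: "val X z = (\<Sum>i<length z. fst (z ! i) *\<^sub>R X (snd (z ! i)))"
proof (induction z)
  case (Cons a z)
  then show ?case by (cases a) (simp add: sum.lessThan_Suc_shift del: sum.lessThan_Suc)
qed simp

locale q_brownian = nc_prob A \<phi>
  for A :: "'h::complex_hilbert op set" and \<phi> +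
  fixes q :: real and X :: "real \<Rightarrow> 'h op"
  assumes q0: "0 \<le> q" and q1: "q < 1" and qbm: "q_brownian_motion A \<phi> q X"
begin

lemma X_A: "0 \<le> t \<Longrightarrow> X t \<in> A"
  and X_adj: "0 \<le> t \<Longrightarrow> is_adjoint (X t) (X t)"
  using qbm by (simp_all add: q_brownian_motion_def)

lemma val_A: "times_in {0..} z \<Longrightarrow> val X z \<in> A"
  by (induction z) (auto simp: times_in_def intro!: A_intros X_A)

lemma val_adj: "times_in {0..} z \<Longrightarrow> is_adjoint (val X z) (val X z)"
  by (induction z) (auto simp: times_in_def intro!: is_adjoint_zero is_adjoint_add is_adjoint_scaleR X_adj)

lemma wick_base:
  assumes "\<forall>t\<in>set ts. 0 \<le> t"
  shows "\<phi> (oprod (map X ts)) = of_real (wick_sum q min ts)"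
proof (cases "ts = []")
  case False
  have "(MIN i\<in>b. ts ! i) = min (ts ! Min b) (ts ! Max b)" if "\<pi> \<in> pairings (length ts)" "b \<in> \<pi>" for \<pi> b
  proof -
    have "b = {Min b, Max b}"
      using pairs_on_block(4) that pairings_eq by metis
    then have "(\<lambda>i. ts ! i) ` b = {ts ! Min b, ts ! Max b}" by (metis image_empty image_insert)
    then show ?thesis by simp
  qed
  then show ?thesis
    using qbm False assms by (simp add: q_brownian_motion_def oprod_def wick_sum_def)
qed simp

text \<open>The moment formula extends from times to combinations by multilinearity. The induction
  is on the number of letters that are not yet a single time with coefficient 1; each step expands
  one of them.\<close>

lemma wick:
  assumes "\<forall>z\<in>set zs. times_in {0..} z"
  shows "\<phi> (oprod (map (val X) zs)) = of_real (wick_sum q cov zs)"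
  using assms
proof (induction "length (filter (\<lambda>z. \<forall>t. z \<noteq> [(1, t)]) zs)" arbitrary: zs)
  case 0
  then have "\<forall>z\<in>set zs. \<exists>t. z = [(1, t)]" by (auto simp: filter_empty_conv)
  then obtain ts where ts: "zs = map (\<lambda>t. [(1, t)]) ts"
    by (metis ex_map_conv)
  have "wick_sum q cov zs = wick_sum q min ts"
    unfolding ts wick_sum_map by (simp add: cov_def)
  moreover have "map (val X) zs = map X ts" by (simp add: ts)
  moreover have "\<forall>t\<in>set ts. 0 \<le> t" using 0(2) by (auto simp: ts times_in_def)
  ultimately show ?case using wick_base by simp
next
  case (Suc n)
  then obtain z where z: "z \<in> set zs" "\<forall>t. z \<noteq> [(1, t)]"
    by (metis (mono_tags, lifting) filter_empty_conv list.size(3) nat.distinct(1))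
  obtain xs ys where zs: "zs = xs @ z # ys" using z(1) by (meson split_list)
  let ?u = "\<lambda>i. [(1, snd (z ! i))]" and ?I = "{..<length z}"
  have t: "times_in {0..} z" using Suc(3) zs by simp
  have u: "times_in {0..} (?u i)" if "i \<in> ?I" for i
    using t that nth_mem[of i z] by (auto simp: times_in_def case_prod_beta)
  have IH: "\<phi> (oprod (map (val X) (xs @ ?u i # ys))) = of_real (wick_sum q cov (xs @ ?u i # ys))" if "i \<in> ?I" for i
  proof (rule Suc.hyps(1))
    show "n = length (filter (\<lambda>z. \<forall>t. z \<noteq> [(1, t)]) (xs @ ?u i # ys))"
      using Suc.hyps(2) z(2) by (simp add: zs)
    show "\<forall>z\<in>set (xs @ ?u i # ys). times_in {0..} z"
      using Suc(3) zs u[OF that] by auto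
  qed
  have A: "oprod (map (val X) (xs @ ?u i # ys)) \<in> A" if "i \<in> ?I" for i
    using Suc(3) u[OF that] by (intro oprod_in subA) (auto simp: zs intro: val_A simp del: val_Cons)
  have "oprod (map (val X) zs) = (\<Sum>i\<in>?I. fst (z ! i) *\<^sub>R oprod (map (val X) (xs @ ?u i # ys)))"
    by (simp add: zs val_expand[of X z] compose_sum_left compose_sum_right compose_scaleR_left compose_scaleR_right)
  then have "\<phi> (oprod (map (val X) zs)) = (\<Sum>i\<in>?I. \<phi> (fst (z ! i) *\<^sub>R oprod (map (val X) (xs @ ?u i # ys))))"
    using A by (simp only:) (intro phi_sum A_scaleR)
  also have "\<dots> = (\<Sum>i\<in>?I. of_real (fst (z ! i) * wick_sum q cov (xs @ ?u i # ys)))"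
    by (intro sum.cong refl) (simp add: phi_scaleR A IH del: map_append list.map)
  also have "\<dots> = of_real (\<Sum>i\<in>?I. fst (z ! i) * wick_sum q cov (xs @ ?u i # ys))"
    by (rule of_real_sum[symmetric])
  also have "(\<Sum>i\<in>?I. fst (z ! i) * wick_sum q cov (xs @ ?u i # ys)) = wick_sum q cov (xs @ z # ys)"
  proof (rule wick_sum_slot[where u = ?u, symmetric])
    show "cov z l = (\<Sum>i\<in>?I. fst (z ! i) * cov (?u i) l)" for l
      by (rule cov_expand)
    then show "cov l z = (\<Sum>i\<in>?I. fst (z ! i) * cov l (?u i))" for l
      by (simp only: cov_sym[of l])
  qed
  finally show ?case
    by (simp only: zs)
qed

definition x1 :: real where "x1 = norm (X 1)"

lemma pairings_mass: "(\<Sum>\<pi>\<in>pairings (2 * m). q ^ crossings \<pi>) \<le> 2 * (x1\<^sup>2) ^ m"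
proof -
  have "(\<Sum>\<pi>\<in>pairings (2 * m). q ^ crossings \<pi>) = wick_sum q min (replicate (2 * m) 1)"
    by (subst wick_sum_replicate[OF refl]) simp
  also have "\<dots> = Re (\<phi> (opow (X 1) (2 * m)))"
    using wick_base[of "replicate (2 * m) 1"] by (simp add: oprod_replicate)
  also have "\<dots> \<le> cmod (\<phi> (opow (X 1) (2 * m)))"
    by (rule complex_Re_le_cmod)
  also have "\<dots> \<le> 2 * norm (opow (X 1) (2 * m))"
    by (intro phi_bound A_opow X_A) simp
  also have "norm (opow (X 1) n) \<le> norm (X 1) ^ n" for n
  proof (induction n)
    case (Suc n)
    have "norm (opow (X 1) (Suc n)) \<le> norm (X 1) * norm (opow (X 1) n)"
      by (simp add: norm_blinfun_compose)
    also have "\<dots> \<le> norm (X 1) * norm (X 1) ^ n"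
      by (intro mult_left_mono Suc) simp
    finally show ?case by simp
  qed (rule norm_blinfun_bound, simp_all)
  then have "2 * norm (opow (X 1) (2 * m)) \<le> 2 * norm (X 1) ^ (2 * m)" by simp
  finally show ?thesis by (simp add: x1_def power_mult)
qed

text \<open>In a constant word every block contributes the same variance, so the moments of
  \<open>val X z\<close> are those of \<open>X 1\<close> up to powers of the standard
  deviation.\<close>

lemma norm_val_le:
  assumes z: "times_in {0..} z" and v: "0 \<le> cov z z"
  shows "norm (val X z) \<le> sqrt (cov z z) * x1"
proof (rule norm_le_of_moments[OF val_A[OF z] val_A[OF z] val_adj[OF z], where K = 2])
  show "0 \<le> sqrt (cov z z) * x1"
    by (intro mult_nonneg_nonneg real_sqrt_ge_zero v) (simp add: x1_def)
  fix n
  have "opow (val X z o\<^sub>L val X z) n = opow (val X z) (2 * n)"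
  proof (induction n)
    case (Suc n)
    then show ?case by (simp add: op_assoc)
  qed simp
  also have "\<dots> = oprod (map (val X) (replicate (2 * n) z))"
    by (simp add: oprod_replicate)
  also have "Re (\<phi> \<dots>) = wick_sum q cov (replicate (2 * n) z)"
    using z by (subst wick) auto
  also have "\<dots> \<le> cov z z ^ n * (2 * (x1\<^sup>2) ^ n)"
    unfolding wick_sum_replicate[OF refl] using v by (intro mult_left_mono pairings_mass) auto
  also have "\<dots> = 2 * ((sqrt (cov z z) * x1)\<^sup>2) ^ n"
    using v by (simp add: power_mult_distrib)
  finally show "Re (\<phi> (opow (val X z o\<^sub>L val X z) n)) \<le> 2 * ((sqrt (cov z z) * x1)\<^sup>2) ^ n" .
qed

lemma norm_increment_le:
  assumes "0 \<le> s" "s \<le> t"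
  shows "norm (X t - X s) \<le> sqrt (t - s) * x1"
proof -
  have "cov [(1, t), (-1, s)] [(1, t), (-1, s)] = t - s"
    using assms by (simp add: cov_def)
  then show ?thesis
    using norm_val_le[of "[(1, t), (-1, s)]"] assms by (simp add: times_in_def)
qed

end

section \<open>Separating two families of letters\<close>

definition crosses :: "nat set \<Rightarrow> nat set \<Rightarrow> bool" where
  "crosses b c \<longleftrightarrow> Min b < Min c \<and> Min c < Max b \<and> Max b < Max c"

text \<open>Counting ordered pairs, with the block that opens first in front, makes the crossing
  number additive over a union of two families of blocks.\<close>

definition ncross :: "nat set set \<Rightarrow> nat set set \<Rightarrow> nat" where
  "ncross \<sigma> \<pi> = card {(b, c) \<in> \<sigma> \<times> \<pi>. crosses b c}"

lemma crossings_eq: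
  assumes "\<And>b. b \<in> \<pi> \<Longrightarrow> card b = 2"
  shows "crossings \<pi> = ncross \<pi> \<pi>"
proof -
  let ?C = "{(b, c) \<in> \<pi> \<times> \<pi>. crosses b c}"
  have "{{{x1, y1}, {x2, y2}} | x1 y1 x2 y2.
      {x1, y1} \<in> \<pi> \<and> {x2, y2} \<in> \<pi> \<and> x1 < x2 \<and> x2 < y1 \<and> y1 < y2} = (\<lambda>(b, c). {b, c}) ` ?C"
    (is "?L = ?R")
  proof (intro equalityI subsetI)
    fix z assume "z \<in> ?L"
    then obtain x1 y1 x2 y2 where *: "z = {{x1, y1}, {x2, y2}}" "{x1, y1} \<in> \<pi>" "{x2, y2} \<in> \<pi>"
        "x1 < x2" "x2 < y1" "y1 < y2"
      by blast
    then have "({x1, y1}, {x2, y2}) \<in> ?C" by (auto simp: crosses_def)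
    then show "z \<in> ?R"
      by (rule image_eqI[rotated]) (simp add: *(1))
  next
    fix z assume "z \<in> ?R"
    then obtain b c where *: "z = {b, c}" "b \<in> \<pi>" "c \<in> \<pi>" "crosses b c" by auto
    have "b = {Min b, Max b}" "c = {Min c, Max c}"
      using card2_MinMax(1) assms *(2,3) by blast+
    then show "z \<in> ?L"
      using * unfolding crosses_def by (intro CollectI exI[of _ "Min b"] exI[of _ "Max b"] exI[of _ "Min c"] exI[of _ "Max c"]) auto
  qed
  moreover have "inj_on (\<lambda>(b, c). {b, c}) ?C"
    by (auto simp: inj_on_def crosses_def doubleton_eq_iff)
  ultimately show ?thesis
    by (simp add: crossings_def ncross_def card_image)
qed

lemma ncross_Un:
  assumes "finite \<sigma>" "finite \<sigma>'" "finite \<pi>" "\<sigma> \<inter> \<sigma>' = {}"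
  shows "ncross (\<sigma> \<union> \<sigma>') \<pi> = ncross \<sigma> \<pi> + ncross \<sigma>' \<pi>"
    and "ncross \<pi> (\<sigma> \<union> \<sigma>') = ncross \<pi> \<sigma> + ncross \<pi> \<sigma>'"
proof -
  have "{(b, c) \<in> (\<sigma> \<union> \<sigma>') \<times> \<pi>. crosses b c} =
      {(b, c) \<in> \<sigma> \<times> \<pi>. crosses b c} \<union> {(b, c) \<in> \<sigma>' \<times> \<pi>. crosses b c}" by auto
  moreover have "finite {(b, c) \<in> \<sigma> \<times> \<pi>. crosses b c}" "finite {(b, c) \<in> \<sigma>' \<times> \<pi>. crosses b c}"
    by (rule finite_subset[of _ "\<sigma> \<times> \<pi>"], use assms in auto) (rule finite_subset[of _ "\<sigma>' \<times> \<pi>"], use assms in auto)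
  moreover have "{(b, c) \<in> \<sigma> \<times> \<pi>. crosses b c} \<inter> {(b, c) \<in> \<sigma>' \<times> \<pi>. crosses b c} = {}"
    using assms(4) by auto
  ultimately show "ncross (\<sigma> \<union> \<sigma>') \<pi> = ncross \<sigma> \<pi> + ncross \<sigma>' \<pi>"
    by (simp add: ncross_def card_Un_disjoint)
  have "{(b, c) \<in> \<pi> \<times> (\<sigma> \<union> \<sigma>'). crosses b c} =
      {(b, c) \<in> \<pi> \<times> \<sigma>. crosses b c} \<union> {(b, c) \<in> \<pi> \<times> \<sigma>'. crosses b c}" by auto
  moreover have "finite {(b, c) \<in> \<pi> \<times> \<sigma>. crosses b c}" "finite {(b, c) \<in> \<pi> \<times> \<sigma>'. crosses b c}"
    by (rule finite_subset[of _ "\<pi> \<times> \<sigma>"], use assms in auto) (rule finite_subset[of _ "\<pi> \<times> \<sigma>'"], use assms in auto)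
  moreover have "{(b, c) \<in> \<pi> \<times> \<sigma>. crosses b c} \<inter> {(b, c) \<in> \<pi> \<times> \<sigma>'. crosses b c} = {}"
    using assms(4) by auto
  ultimately show "ncross \<pi> (\<sigma> \<union> \<sigma>') = ncross \<pi> \<sigma> + ncross \<pi> \<sigma>'"
    by (simp add: ncross_def card_Un_disjoint)
qed

definition arcs_over :: "nat set set \<Rightarrow> nat \<Rightarrow> nat set set" where
  "arcs_over \<pi> x = {c \<in> \<pi>. Min c < x \<and> x < Max c}"

text \<open>A block of \<sigma> crosses an arc of \<pi> exactly when one of its ends lies under the
  arc and the other does not. Ends never coincide, as P and F are disjoint.\<close>

lemma ncross_mixed:
  assumes \<sigma>: "\<sigma> \<in> pairs_on P" and \<pi>: "\<pi> \<in> pairs_on F" and fin: "finite P" "finite F" and PF: "P \<inter> F = {}"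
  shows "ncross \<sigma> \<pi> + ncross \<pi> \<sigma> =
    (\<Sum>b\<in>\<sigma>. card (sym_diff (arcs_over \<pi> (Min b)) (arcs_over \<pi> (Max b))))"
proof -
  have f: "finite \<sigma>" "finite \<pi>" using pairs_on_finite \<sigma> \<pi> fin by auto
  have 1: "ncross \<sigma> \<pi> = (\<Sum>b\<in>\<sigma>. card {c \<in> \<pi>. crosses b c})"
  proof -
    have "{(b, c) \<in> \<sigma> \<times> \<pi>. crosses b c} = (SIGMA b:\<sigma>. {c \<in> \<pi>. crosses b c})" by auto
    then show ?thesis using f by (simp add: ncross_def)
  qed
  have 2: "ncross \<pi> \<sigma> = (\<Sum>b\<in>\<sigma>. card {c \<in> \<pi>. crosses c b})"
  proof -
    have "{(c, b) \<in> \<pi> \<times> \<sigma>. crosses c b} = prod.swap ` (SIGMA b:\<sigma>. {c \<in> \<pi>. crosses c b})" by force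
    then show ?thesis using f by (simp add: ncross_def card_image)
  qed
  have "card {c \<in> \<pi>. crosses b c} + card {c \<in> \<pi>. crosses c b} =
      card (sym_diff (arcs_over \<pi> (Min b)) (arcs_over \<pi> (Max b)))" if b: "b \<in> \<sigma>" for b
  proof -
    have bP: "Min b \<in> P" "Max b \<in> P" "Min b < Max b"
      using pairs_on_block[OF \<sigma> b] by auto
    have "sym_diff (arcs_over \<pi> (Min b)) (arcs_over \<pi> (Max b)) = {c \<in> \<pi>. crosses b c} \<union> {c \<in> \<pi>. crosses c b}"
    proof (intro set_eqI)
      fix c
      show "c \<in> sym_diff (arcs_over \<pi> (Min b)) (arcs_over \<pi> (Max b)) \<longleftrightarrow>
          c \<in> {c \<in> \<pi>. crosses b c} \<union> {c \<in> \<pi>. crosses c b}"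
      proof (cases "c \<in> \<pi>")
        case True
        then have "Min c \<in> F" "Max c \<in> F" "Min c < Max c"
          using pairs_on_block[OF \<pi> True] by auto
        then have "Min c \<noteq> Min b" "Min c \<noteq> Max b" "Max c \<noteq> Min b" "Max c \<noteq> Max b"
          using bP PF by auto
        then show ?thesis
          using True bP(3) \<open>Min c < Max c\<close> by (simp add: arcs_over_def crosses_def) arith
      qed (simp add: arcs_over_def)
    qed
    moreover have "{c \<in> \<pi>. crosses b c} \<inter> {c \<in> \<pi>. crosses c b} = {}"
      by (auto simp: crosses_def)
    ultimately show ?thesis using f by (simp add: card_Un_disjoint)
  qed
  then show ?thesis unfolding 1 2 by (simp flip: sum.distrib)
qed

lemma pairs_on_Un_bij:
  assumes PF: "P \<inter> F = {}"
  shows "bij_betw (\<lambda>(\<pi>, \<sigma>). \<pi> \<union> \<sigma>) (pairs_on F \<times> pairs_on P)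
    {\<rho> \<in> pairs_on (F \<union> P). \<forall>b\<in>\<rho>. b \<subseteq> F \<or> b \<subseteq> P}"
proof (rule bij_betw_byWitness[where f' = "\<lambda>\<rho>. ({b \<in> \<rho>. b \<subseteq> F}, {b \<in> \<rho>. b \<subseteq> P})"])
  have ne: "b \<noteq> {}" if "\<pi> \<in> pairs_on S" "b \<in> \<pi>" for \<pi> S b
    using that by (auto simp: pairs_on_def partition_on_def)
  show "\<forall>a\<in>pairs_on F \<times> pairs_on P. (\<lambda>\<rho>. ({b \<in> \<rho>. b \<subseteq> F}, {b \<in> \<rho>. b \<subseteq> P})) ((\<lambda>(\<pi>, \<sigma>). \<pi> \<union> \<sigma>) a) = a"
  proof
    fix a assume "a \<in> pairs_on F \<times> pairs_on P"
    then obtain \<pi> \<sigma> where a: "a = (\<pi>, \<sigma>)" and p: "\<pi> \<in> pairs_on F" "\<sigma> \<in> pairs_on P" by auto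
    have "b \<subseteq> F \<and> \<not> b \<subseteq> P" if "b \<in> \<pi>" for b
      using pairs_on_block(1)[OF p(1) that] ne[OF p(1) that] PF by blast
    moreover have "b \<subseteq> P \<and> \<not> b \<subseteq> F" if "b \<in> \<sigma>" for b
      using pairs_on_block(1)[OF p(2) that] ne[OF p(2) that] PF by blast
    ultimately show "(\<lambda>\<rho>. ({b \<in> \<rho>. b \<subseteq> F}, {b \<in> \<rho>. b \<subseteq> P})) ((\<lambda>(\<pi>, \<sigma>). \<pi> \<union> \<sigma>) a) = a"
      unfolding a by auto
  qed
  show "\<forall>a'\<in>{\<rho> \<in> pairs_on (F \<union> P). \<forall>b\<in>\<rho>. b \<subseteq> F \<or> b \<subseteq> P}.
      (\<lambda>(\<pi>, \<sigma>). \<pi> \<union> \<sigma>) ({b \<in> a'. b \<subseteq> F}, {b \<in> a'. b \<subseteq> P}) = a'"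
    by auto
  show "(\<lambda>(\<pi>, \<sigma>). \<pi> \<union> \<sigma>) ` (pairs_on F \<times> pairs_on P) \<subseteq> {\<rho> \<in> pairs_on (F \<union> P). \<forall>b\<in>\<rho>. b \<subseteq> F \<or> b \<subseteq> P}"
  proof clarify
    fix \<pi> \<sigma> assume p: "\<pi> \<in> pairs_on F" "\<sigma> \<in> pairs_on P"
    have s: "\<And>b. b \<in> \<pi> \<Longrightarrow> b \<subseteq> F" "\<And>b. b \<in> \<sigma> \<Longrightarrow> b \<subseteq> P"
      using pairs_on_block(1) p by blast+
    have "disjoint (\<pi> \<union> \<sigma>)"
      using p s PF by (intro disjoint_union) (auto simp: pairs_on_def partition_on_def)
    then have "\<pi> \<union> \<sigma> \<in> pairs_on (F \<union> P)"
      using p by (auto simp: pairs_on_def partition_on_def)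
    then show "\<pi> \<union> \<sigma> \<in> pairs_on (F \<union> P) \<and> (\<forall>b\<in>\<pi> \<union> \<sigma>. b \<subseteq> F \<or> b \<subseteq> P)"
      using s by blast
  qed
  have cov: "{b \<in> \<rho>. b \<subseteq> S} \<in> pairs_on S"
    if r: "\<rho> \<in> pairs_on (S \<union> R)" "\<forall>b\<in>\<rho>. b \<subseteq> S \<or> b \<subseteq> R" and SR: "S \<inter> R = {}" for \<rho> S R
  proof -
    have "S \<subseteq> \<Union>{b \<in> \<rho>. b \<subseteq> S}"
    proof
      fix x assume x: "x \<in> S"
      then obtain b where "b \<in> \<rho>" "x \<in> b" using pairs_on_cover[OF r(1), of x] by auto
      then show "x \<in> \<Union>{b \<in> \<rho>. b \<subseteq> S}" using r(2) x SR by blast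
    qed
    moreover have "disjoint {b \<in> \<rho>. b \<subseteq> S}"
      using r(1) by (auto simp: pairs_on_def partition_on_def disjoint_def)
    ultimately show ?thesis using r(1) by (auto simp: pairs_on_def partition_on_def)
  qed
  show "(\<lambda>\<rho>. ({b \<in> \<rho>. b \<subseteq> F}, {b \<in> \<rho>. b \<subseteq> P})) ` {\<rho> \<in> pairs_on (F \<union> P). \<forall>b\<in>\<rho>. b \<subseteq> F \<or> b \<subseteq> P}
      \<subseteq> pairs_on F \<times> pairs_on P"
    using cov[of _ F P] cov[of _ P F] PF by (auto simp: Un_commute Int_commute disj_commute)
qed

text \<open>A block joining P to F has covariance zero, so only unions of a pairing of F and a
  pairing of P contribute. Crossings between the two are charged to the blocks in P, where each
  appears as a factor q on the covariance.\<close>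

lemma wick_split:
  assumes fin: "finite P" "finite F" and PF: "P \<inter> F = {}"
    and h0: "\<And>x y. x \<in> P \<Longrightarrow> y \<in> F \<Longrightarrow> h x y = 0" "\<And>x y. x \<in> P \<Longrightarrow> y \<in> F \<Longrightarrow> h y x = (0::real)"
  shows "(\<Sum>\<rho>\<in>pairs_on (F \<union> P). q ^ crossings \<rho> * (\<Prod>b\<in>\<rho>. h (Min b) (Max b))) =
    (\<Sum>\<pi>\<in>pairs_on F. q ^ crossings \<pi> * (\<Prod>b\<in>\<pi>. h (Min b) (Max b)) *
      (\<Sum>\<sigma>\<in>pairs_on P. q ^ crossings \<sigma> * (\<Prod>b\<in>\<sigma>. h (Min b) (Max b) *
        q ^ card (sym_diff (arcs_over \<pi> (Min b)) (arcs_over \<pi> (Max b))))))"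
proof -
  let ?t = "\<lambda>\<rho>. q ^ crossings \<rho> * (\<Prod>b\<in>\<rho>. h (Min b) (Max b))"
  let ?G = "{\<rho> \<in> pairs_on (F \<union> P). \<forall>b\<in>\<rho>. b \<subseteq> F \<or> b \<subseteq> P}"
  have "sum ?t (pairs_on (F \<union> P)) = sum ?t ?G"
  proof (rule sum.mono_neutral_right)
    show "\<forall>\<rho>\<in>pairs_on (F \<union> P) - ?G. ?t \<rho> = 0"
    proof
      fix \<rho> assume r: "\<rho> \<in> pairs_on (F \<union> P) - ?G"
      then obtain b where b: "b \<in> \<rho>" "\<not> b \<subseteq> F" "\<not> b \<subseteq> P" by auto
      have bl: "b \<subseteq> F \<union> P" "b = {Min b, Max b}"
        using pairs_on_block(1,4)[of \<rho> "F \<union> P" b] r b by auto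
      have "Min b \<in> F \<union> P" "Max b \<in> F \<union> P" using bl by blast+
      moreover have "\<not> (Min b \<in> F \<and> Max b \<in> F)" "\<not> (Min b \<in> P \<and> Max b \<in> P)"
        using b(2,3) bl(2) by (metis empty_subsetI insert_subset)+
      ultimately have "h (Min b) (Max b) = 0" using h0 by blast
      then have "(\<Prod>b\<in>\<rho>. h (Min b) (Max b)) = 0"
        using b(1) pairs_on_finite[of \<rho> "F \<union> P"] r fin by (intro prod_zero) auto
      then show "?t \<rho> = 0" by simp
    qed
  qed (use fin finite_pairs_on in auto)
  also have "\<dots> = (\<Sum>(\<pi>, \<sigma>)\<in>pairs_on F \<times> pairs_on P. ?t (\<pi> \<union> \<sigma>))"
    using sum.reindex_bij_betw[OF pairs_on_Un_bij[OF PF], of ?t] by (simp add: case_prod_beta)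
  also have "\<dots> = (\<Sum>\<pi>\<in>pairs_on F. \<Sum>\<sigma>\<in>pairs_on P. ?t (\<pi> \<union> \<sigma>))"
    by (rule sum.cartesian_product[symmetric])
  also have "\<dots> = (\<Sum>\<pi>\<in>pairs_on F. ?t \<pi> * (\<Sum>\<sigma>\<in>pairs_on P. q ^ crossings \<sigma> * (\<Prod>b\<in>\<sigma>. h (Min b) (Max b) *
        q ^ card (sym_diff (arcs_over \<pi> (Min b)) (arcs_over \<pi> (Max b))))))"
    unfolding sum_distrib_left
  proof (intro sum.cong refl)
    fix \<pi> \<sigma> assume \<pi>: "\<pi> \<in> pairs_on F" and \<sigma>: "\<sigma> \<in> pairs_on P"
    have f: "finite \<sigma>" "finite \<pi>" using pairs_on_finite \<sigma> \<pi> fin by auto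
    have disj: "\<pi> \<inter> \<sigma> = {}"
    proof -
      have "b \<in> \<pi> \<Longrightarrow> b \<in> \<sigma> \<Longrightarrow> False" for b
        using pairs_on_block(1,6)[OF \<pi>, of b] pairs_on_block(1,6)[OF \<sigma>, of b] PF by blast
      then show ?thesis by blast
    qed
    have c2: "card b = 2" if "b \<in> \<pi> \<or> b \<in> \<sigma>" for b
      using that pairs_on_block(2) \<pi> \<sigma> by blast
    have "crossings (\<pi> \<union> \<sigma>) = ncross (\<pi> \<union> \<sigma>) (\<pi> \<union> \<sigma>)"
      by (rule crossings_eq) (use c2 in auto)
    also have "\<dots> = (ncross \<pi> \<pi> + ncross \<pi> \<sigma>) + (ncross \<sigma> \<pi> + ncross \<sigma> \<sigma>)"
      using f disj by (simp add: ncross_Un)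
    also have "\<dots> = crossings \<pi> + crossings \<sigma> +
        (\<Sum>b\<in>\<sigma>. card (sym_diff (arcs_over \<pi> (Min b)) (arcs_over \<pi> (Max b))))"
      using ncross_mixed[OF \<sigma> \<pi> fin PF] c2 by (simp add: crossings_eq)
    finally have "q ^ crossings (\<pi> \<union> \<sigma>) = q ^ crossings \<pi> * q ^ crossings \<sigma> *
        (\<Prod>b\<in>\<sigma>. q ^ card (sym_diff (arcs_over \<pi> (Min b)) (arcs_over \<pi> (Max b))))"
      by (simp add: power_add power_sum)
    then show "?t (\<pi> \<union> \<sigma>) = ?t \<pi> * (q ^ crossings \<sigma> * (\<Prod>b\<in>\<sigma>. h (Min b) (Max b) *
        q ^ card (sym_diff (arcs_over \<pi> (Min b)) (arcs_over \<pi> (Max b)))))"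
      using f disj by (simp add: prod.union_disjoint prod.distrib mult_ac)
  qed
  finally show ?thesis .
qed

lemma pairs_on_image:
  assumes "inj_on f S" "\<pi> \<in> pairs_on S" shows "(`) f ` \<pi> \<in> pairs_on (f ` S)"
proof -
  have "partition_on (f ` S) ((`) f ` \<pi> - {{}})"
    using assms by (intro partition_on_inj_image) (auto simp: pairs_on_def)
  moreover have "card (f ` b) = 2" if "b \<in> \<pi>" for b
    using that pairs_on_block(1,2)[OF assms(2)] card_image[OF inj_on_subset[OF assms(1)]] by metis
  moreover from this have "{} \<notin> (`) f ` \<pi>" by fastforce
  ultimately show ?thesis by (auto simp: pairs_on_def)
qed

lemma Min_Max_image:
  fixes f :: "nat \<Rightarrow> nat"
  assumes "strict_mono_on {..<n} f" "b \<subseteq> {..<n}" "card b = 2"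
  shows "Min (f ` b) = f (Min b)" "Max (f ` b) = f (Max b)"
proof -
  have b: "b = {Min b, Max b}" "Min b < Max b" using card2_MinMax[OF assms(3)] by auto
  then have "Min b < n" "Max b < n" using assms(2) by blast+
  then have lt: "f (Min b) < f (Max b)" using assms(1) b(2) by (auto simp: strict_mono_on_def)
  have "f ` b = {f (Min b), f (Max b)}" using b(1) by (metis image_empty image_insert)
  then show "Min (f ` b) = f (Min b)" "Max (f ` b) = f (Max b)" using lt by auto
qed

text \<open>Crossings and the two ends of a block depend on the order of positions only, and an
  increasing relabelling preserves it.\<close>

lemma wick_relabel:
  assumes ps: "sorted_wrt (<) ps"
  shows "bij_betw ((`) ((`) ((!) ps))) (pairings (length ps)) (pairs_on (set ps))"
    and "\<pi> \<in> pairings (length ps) \<Longrightarrow> crossings ((`) ((!) ps) ` \<pi>) = crossings \<pi>"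
    and "\<pi> \<in> pairings (length ps) \<Longrightarrow> (\<Prod>b\<in>(`) ((!) ps) ` \<pi>. h (Min b) (Max b)) = (\<Prod>b\<in>\<pi>. h (ps ! Min b) (ps ! Max b) :: real)"
proof -
  let ?n = "length ps" and ?f = "(!) ps"
  have sm: "strict_mono_on {..<?n} ?f"
    using ps by (auto simp: strict_mono_on_def sorted_wrt_iff_nth_less)
  then have inj: "inj_on ?f {..<?n}" by (rule strict_mono_on_imp_inj_on)
  have img: "?f ` {..<?n} = set ps" by (auto simp: set_conv_nth)
  let ?g = "inv_into {..<?n} ?f"
  have gf: "?g ` ?f ` b = b" if "b \<subseteq> {..<?n}" for b
    using inv_into_image_cancel[OF inj that] .
  have fg: "?f ` ?g ` b = b" if "b \<subseteq> set ps" for b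
    using image_inv_into_cancel[OF img that] .
  have injg: "inj_on ?g (set ps)" using inj_on_inv_into[of "set ps" ?f "{..<?n}"] img by simp
  have gimg: "?g ` set ps = {..<?n}" using gf[of "{..<?n}"] img by simp
  show "bij_betw ((`) ((`) ?f)) (pairings ?n) (pairs_on (set ps))"
  proof (rule bij_betw_byWitness[where f' = "(`) ((`) ?g)"])
    show "\<forall>a\<in>pairings ?n. (`) ?g ` (`) ?f ` a = a"
    proof
      fix a assume "a \<in> pairings ?n"
      then have "?g ` ?f ` b = b" if "b \<in> a" for b
        using pairs_on_block(1) that by (intro gf) (auto simp: pairings_eq)
      then have "(\<lambda>b. ?g ` (?f ` b)) ` a = (\<lambda>b. b) ` a"
        by (intro image_cong refl)
      then show "(`) ?g ` (`) ?f ` a = a"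
        by (simp only: image_image[of "(`) ?g" "(`) ?f" a] image_ident)
    qed
    show "\<forall>a\<in>pairs_on (set ps). (`) ?f ` (`) ?g ` a = a"
    proof
      fix a assume "a \<in> pairs_on (set ps)"
      then have "?f ` ?g ` b = b" if "b \<in> a" for b
        using pairs_on_block(1) that by (intro fg) auto
      then have "(\<lambda>b. ?f ` (?g ` b)) ` a = (\<lambda>b. b) ` a"
        by (intro image_cong refl)
      then show "(`) ?f ` (`) ?g ` a = a"
        by (simp only: image_image[of "(`) ?f" "(`) ?g" a] image_ident)
    qed
    show "(`) ((`) ?f) ` pairings ?n \<subseteq> pairs_on (set ps)"
      using pairs_on_image[OF inj] by (auto simp: pairings_eq img)
    show "(`) ((`) ?g) ` pairs_on (set ps) \<subseteq> pairings ?n"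
      using pairs_on_image[OF injg] by (auto simp: pairings_eq gimg)
  qed
  assume p: "\<pi> \<in> pairings ?n"
  then have p': "\<pi> \<in> pairs_on {..<?n}" by (simp add: pairings_eq)
  have bl: "b \<subseteq> {..<?n}" "card b = 2" "Min b < ?n" "Max b < ?n" if "b \<in> \<pi>" for b
    using pairs_on_block(1,2,6,7)[OF p' that] by auto
  have injI: "inj_on ((`) ?f) \<pi>"
    by (intro inj_onI) (metis bl(1) gf)
  have q: "(`) ?f ` \<pi> \<in> pairs_on (set ps)"
    using pairs_on_image[OF inj p'] img by simp
  have MM: "Min (?f ` b) = ps ! Min b" "Max (?f ` b) = ps ! Max b" if "b \<in> \<pi>" for b
    using Min_Max_image[OF sm bl(1,2)[OF that]] by auto
  show "(\<Prod>b\<in>(`) ?f ` \<pi>. h (Min b) (Max b)) = (\<Prod>b\<in>\<pi>. h (ps ! Min b) (ps ! Max b) :: real)"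
    by (subst prod.reindex[OF injI]) (auto simp: MM intro!: prod.cong)
  have less: "ps ! i < ps ! j \<longleftrightarrow> i < j" if "i < ?n" "j < ?n" for i j
    using sm that by (simp add: strict_mono_on_less)
  have cr: "crosses (?f ` b) (?f ` c) \<longleftrightarrow> crosses b c" if "b \<in> \<pi>" "c \<in> \<pi>" for b c
    using that bl less by (simp add: crosses_def MM)
  have "crossings ((`) ?f ` \<pi>) = ncross ((`) ?f ` \<pi>) ((`) ?f ` \<pi>)"
    by (rule crossings_eq) (rule pairs_on_block(2)[OF q])
  also have "\<dots> = card (map_prod ((`) ?f) ((`) ?f) ` {(b, c) \<in> \<pi> \<times> \<pi>. crosses b c})"
    unfolding ncross_def by (rule arg_cong[where f = card]) (auto simp: cr)
  also have "\<dots> = ncross \<pi> \<pi>"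
    unfolding ncross_def
    by (rule card_image, rule inj_on_subset[OF map_prod_inj_on[OF injI injI]]) auto
  also have "\<dots> = crossings \<pi>"
    by (rule crossings_eq[symmetric]) (use bl in auto)
  finally show "crossings ((`) ?f ` \<pi>) = crossings \<pi>" .
qed

lemma wick_sum_positions:
  assumes "sorted_wrt (<) ps"
  shows "(\<Sum>\<pi>\<in>pairs_on (set ps). q ^ crossings \<pi> * (\<Prod>b\<in>\<pi>. h (Min b) (Max b))) = wick_sum q h ps"
  unfolding wick_sum_def
  by (subst sum.reindex_bij_betw[OF wick_relabel(1)[OF assms], symmetric])
    (auto intro!: sum.cong simp: wick_relabel(2,3)[OF assms])

text \<open>The last claim translates positions in \<open>w\<close> into indices in the filtered
  word: the selected letters before position x are those counted in the prefix of length x.\<close>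

lemma filter_positions:
  fixes w :: "'l list" and P :: "'l \<Rightarrow> bool"
  defines "fs \<equiv> filter (\<lambda>x. P (w ! x)) [0..<length w]"
  shows "map ((!) w) fs = filter P w" "sorted_wrt (<) fs" "set fs = {x. x < length w \<and> P (w ! x)}"
    and "x \<le> length w \<Longrightarrow> i < length fs \<Longrightarrow> fs ! i < x \<longleftrightarrow> i < length (filter P (take x w))"
proof -
  have *: "map ((!) v) (filter (\<lambda>x. P (v ! x)) [0..<length v]) = filter P v" for v
  proof -
    have "filter P v = filter P (map ((!) v) [0..<length v])" by (simp only: map_nth)
    also have "\<dots> = map ((!) v) (filter (\<lambda>x. P (v ! x)) [0..<length v])"
      by (simp only: filter_map comp_def)
    finally show ?thesis by (rule sym)
  qed
  show "map ((!) w) fs = filter P w" unfolding fs_def by (rule *)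
  show "sorted_wrt (<) fs" unfolding fs_def by (intro sorted_wrt_filter) simp
  show "set fs = {x. x < length w \<and> P (w ! x)}" by (auto simp: fs_def)
  assume x: "x \<le> length w" and i: "i < length fs"
  let ?a = "filter (\<lambda>x. P (w ! x)) [0..<x]" and ?b = "filter (\<lambda>x. P (w ! x)) [x..<length w]"
  have fs: "fs = ?a @ ?b"
    unfolding fs_def filter_append[symmetric] using x upt_add_eq_append[of 0 x "length w - x"] by simp
  have "filter (\<lambda>y. P (take x w ! y)) [0..<length (take x w)] = ?a"
    using x by (intro filter_cong) auto
  then have len: "length ?a = length (filter P (take x w))"
    using *[of "take x w"] by (metis length_map)
  show "fs ! i < x \<longleftrightarrow> i < length (filter P (take x w))"
  proof (cases "i < length ?a")
    case True
    then have "fs ! i \<in> set ?a" unfolding fs by (simp add: nth_append del: set_filter)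
    then show ?thesis using True len by simp
  next
    case False
    then have "fs ! i \<in> set ?b" using i unfolding fs by (simp add: nth_append del: set_filter)
    then show ?thesis using False len by simp
  qed
qed

text \<open>The arcs above the gap between the future letters k and k + 1; an arc that starts at k
  is already open and one that ends at k is already closed.\<close>

definition open_arcs :: "nat set set \<Rightarrow> nat \<Rightarrow> nat set set" where
  "open_arcs \<pi> k = {c \<in> \<pi>. Min c \<le> k \<and> k < Max c}"

text \<open>The slot of a past letter is the index of the last future letter before it.  The arcs of \<open>\<pi>\<close> that
  a pair of past letters crosses are those open at exactly one of the two slots.\<close>

lemma wick_letters:
  fixes w :: "'l list" and K :: "'l \<Rightarrow> 'l \<Rightarrow> real" and fut :: "'l \<Rightarrow> bool" and slot :: "'l \<Rightarrow> nat"
  assumes K0: "\<And>k l. k \<in> set w \<Longrightarrow> l \<in> set w \<Longrightarrow> fut k \<noteq> fut l \<Longrightarrow> K k l = 0"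
    and slot: "\<And>x. x < length w \<Longrightarrow> \<not> fut (w ! x) \<Longrightarrow> Suc (slot (w ! x)) = length (filter fut (take x w))"
  shows "wick_sum q K w = (\<Sum>\<pi>\<in>pairings (length (filter fut w)).
    q ^ crossings \<pi> * (\<Prod>b\<in>\<pi>. K (filter fut w ! Min b) (filter fut w ! Max b)) *
    wick_sum q (\<lambda>k l. K k l * q ^ card (sym_diff (open_arcs \<pi> (slot k)) (open_arcs \<pi> (slot l))))
      (filter (\<lambda>l. \<not> fut l) w))"
proof -
  define fs where "fs = filter (\<lambda>x. fut (w ! x)) [0..<length w]"
  define ps where "ps = filter (\<lambda>x. \<not> fut (w ! x)) [0..<length w]"
  note fs = filter_positions[where P = fut and w = w, folded fs_def]
  note ps = filter_positions[where P = "\<lambda>l. \<not> fut l" and w = w, folded ps_def]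
  let ?h = "\<lambda>x y. K (w ! x) (w ! y)"
  have U: "{..<length w} = set fs \<union> set ps" using fs(3) ps(3) by auto
  have D: "set ps \<inter> set fs = {}" using fs(3) ps(3) by auto
  have lfs: "length (filter fut w) = length fs" using fs(1) by (metis length_map)
  have "wick_sum q K w = (\<Sum>\<rho>\<in>pairs_on (set fs \<union> set ps). q ^ crossings \<rho> * (\<Prod>b\<in>\<rho>. ?h (Min b) (Max b)))"
    unfolding wick_sum_def pairings_eq U ..
  also have "\<dots> = (\<Sum>\<pi>\<in>pairs_on (set fs). q ^ crossings \<pi> * (\<Prod>b\<in>\<pi>. ?h (Min b) (Max b)) *
      (\<Sum>\<sigma>\<in>pairs_on (set ps). q ^ crossings \<sigma> * (\<Prod>b\<in>\<sigma>. ?h (Min b) (Max b) *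
        q ^ card (sym_diff (arcs_over \<pi> (Min b)) (arcs_over \<pi> (Max b))))))"
  proof (rule wick_split[OF _ _ D])
    show "?h x y = 0" "?h y x = 0" if "x \<in> set ps" "y \<in> set fs" for x y
      using K0[of "w ! x" "w ! y"] K0[of "w ! y" "w ! x"] that unfolding fs(3) ps(3) by simp_all
  qed simp_all
  also have "\<dots> = (\<Sum>\<pi>\<in>pairs_on (set fs). q ^ crossings \<pi> * (\<Prod>b\<in>\<pi>. ?h (Min b) (Max b)) *
      wick_sum q (\<lambda>x y. ?h x y * q ^ card (sym_diff (arcs_over \<pi> x) (arcs_over \<pi> y))) ps)"
    by (subst wick_sum_positions[OF ps(2), symmetric]) simp
  also have "\<dots> = (\<Sum>\<pi>\<in>pairings (length fs). q ^ crossings \<pi> * (\<Prod>b\<in>\<pi>. ?h (fs ! Min b) (fs ! Max b)) *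
      wick_sum q (\<lambda>x y. ?h x y * q ^ card (sym_diff (arcs_over ((`) ((!) fs) ` \<pi>) x) (arcs_over ((`) ((!) fs) ` \<pi>) y))) ps)"
    by (subst sum.reindex_bij_betw[OF wick_relabel(1)[OF fs(2)], symmetric])
      (intro sum.cong refl arg_cong2[where f = "(*)"], simp_all only: wick_relabel(2)[OF fs(2)] wick_relabel(3)[OF fs(2), where h = ?h])
  also have "\<dots> = (\<Sum>\<pi>\<in>pairings (length fs). q ^ crossings \<pi> * (\<Prod>b\<in>\<pi>. K (filter fut w ! Min b) (filter fut w ! Max b)) *
      wick_sum q (\<lambda>k l. K k l * q ^ card (sym_diff (open_arcs \<pi> (slot k)) (open_arcs \<pi> (slot l)))) (map ((!) w) ps))"
  proof (intro sum.cong refl arg_cong2[where f = "(*)"] prod.cong)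
    fix \<pi> assume p: "\<pi> \<in> pairings (length fs)"
    then have p': "\<pi> \<in> pairs_on {..<length fs}" by (simp add: pairings_eq)
    have bl: "b \<subseteq> {..<length fs}" "card b = 2" "Min b < length fs" "Max b < length fs" if "b \<in> \<pi>" for b
      using pairs_on_block(1,2,6,7)[OF p' that] by auto
    {
      fix b assume b: "b \<in> \<pi>"
      show "K (w ! (fs ! Min b)) (w ! (fs ! Max b)) = K (filter fut w ! Min b) (filter fut w ! Max b)"
        unfolding fs(1)[symmetric] using bl[OF b] by simp
    }
    have sm: "strict_mono_on {..<length fs} ((!) fs)"
      using fs(2) by (auto simp: strict_mono_on_def sorted_wrt_iff_nth_less)
    then have inj: "inj_on ((!) fs) {..<length fs}" by (rule strict_mono_on_imp_inj_on)
    have injI: "inj_on ((`) ((!) fs)) \<pi>"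
      by (rule inj_on_subset[OF inj_on_image_Pow[OF inj]]) (use bl in auto)
    have arcs: "arcs_over ((`) ((!) fs) ` \<pi>) x = (`) ((!) fs) ` open_arcs \<pi> (slot (w ! x))" if x: "x \<in> set ps" for x
    proof -
      have xw: "x < length w" "\<not> fut (w ! x)" using x ps(3) by auto
      \<comment> \<open>The future letters before x are those with index at most its slot. Position
        x itself holds a past letter, so strict and weak comparison agree.\<close>
      have cmp: "fs ! i < x \<longleftrightarrow> i \<le> slot (w ! x)" "x < fs ! i \<longleftrightarrow> slot (w ! x) < i" if "i < length fs" for i
      proof -
        show 1: "fs ! i < x \<longleftrightarrow> i \<le> slot (w ! x)"
        proof -
          have "i < length (filter fut (take x w)) \<longleftrightarrow> i \<le> slot (w ! x)"
            using slot[OF xw] by linarith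
          then show ?thesis using fs(4)[of x i] xw that by simp
        qed
        have "fs ! i \<in> set fs" using that by simp
        then have "fs ! i \<noteq> x" using x D by blast
        then show "x < fs ! i \<longleftrightarrow> slot (w ! x) < i" using 1 by linarith
      qed
      have "Min ((!) fs ` b) < x \<and> x < Max ((!) fs ` b) \<longleftrightarrow> Min b \<le> slot (w ! x) \<and> slot (w ! x) < Max b"
        if "b \<in> \<pi>" for b
        using bl[OF that] cmp Min_Max_image[OF sm bl(1,2)[OF that]] by simp
      then show ?thesis
        unfolding arcs_over_def open_arcs_def by blast
    qed
    have "card (sym_diff (arcs_over ((`) ((!) fs) ` \<pi>) x) (arcs_over ((`) ((!) fs) ` \<pi>) y)) =
        card (sym_diff (open_arcs \<pi> (slot (w ! x))) (open_arcs \<pi> (slot (w ! y))))"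
      if "x \<in> set ps" "y \<in> set ps" for x y
    proof -
      have s: "open_arcs \<pi> k \<subseteq> \<pi>" for k by (auto simp: open_arcs_def)
      have d: "(`) ((!) fs) ` (open_arcs \<pi> k - open_arcs \<pi> l) =
          (`) ((!) fs) ` open_arcs \<pi> k - (`) ((!) fs) ` open_arcs \<pi> l" for k l
        by (rule inj_on_image_set_diff[OF injI]) (use s in auto)
      have "sym_diff (arcs_over ((`) ((!) fs) ` \<pi>) x) (arcs_over ((`) ((!) fs) ` \<pi>) y) =
          (`) ((!) fs) ` sym_diff (open_arcs \<pi> (slot (w ! x))) (open_arcs \<pi> (slot (w ! y)))"
        unfolding arcs[OF that(1)] arcs[OF that(2)]
        by (simp only: d image_Un)
      also have "card \<dots> = card (sym_diff (open_arcs \<pi> (slot (w ! x))) (open_arcs \<pi> (slot (w ! y))))"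
        by (rule card_image, rule inj_on_subset[OF injI]) (use s in auto)
      finally show ?thesis .
    qed
    then show "wick_sum q (\<lambda>x y. ?h x y * q ^ card (sym_diff (arcs_over ((`) ((!) fs) ` \<pi>) x) (arcs_over ((`) ((!) fs) ` \<pi>) y))) ps =
        wick_sum q (\<lambda>k l. K k l * q ^ card (sym_diff (open_arcs \<pi> (slot k)) (open_arcs \<pi> (slot l)))) (map ((!) w) ps)"
      unfolding wick_sum_map by (intro wick_sum_cong) auto
  qed
  finally show ?thesis
    unfolding lfs ps(1) .
qed

section \<open>Shifted copies of the past\<close>

definition shift_weight :: "real \<Rightarrow> 'e set \<Rightarrow> 'e set \<Rightarrow> real" where
  "shift_weight q D E = (if E \<subseteq> D then q ^ card (D - E) * sqrt (1 - q\<^sup>2) ^ card E else 0)"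

text \<open>The weights are the coordinates of unit vectors \<open>v\<^sub>D\<close> with
  \<open>\<langle>v\<^sub>D, v\<^sub>D'\<rangle> = q ^ card (sym_diff D D')\<close>: the tensor product over \<open>c\<close> of \<open>(q, sqrt (1 - q\<^sup>2))\<close> for
  \<open>c \<in> D\<close> and \<open>(1, 0)\<close> for \<open>c \<notin> D\<close>.\<close>

lemma shift_weight_inner:
  assumes fin: "finite R" and D: "D \<subseteq> R" "D' \<subseteq> R" and q: "q\<^sup>2 \<le> 1"
  shows "(\<Sum>E\<in>Pow R. shift_weight q D E * shift_weight q D' E) = q ^ card (sym_diff D D')"
proof -
  let ?I = "D \<inter> D'"
  have f: "finite D" "finite D'" "finite ?I" using finite_subset[OF D(1) fin] finite_subset[OF D(2) fin] by auto
  have "(\<Sum>E\<in>Pow R. shift_weight q D E * shift_weight q D' E) =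
      (\<Sum>E\<in>Pow ?I. shift_weight q D E * shift_weight q D' E)"
    using D fin by (intro sum.mono_neutral_right) (auto simp: shift_weight_def)
  also have "\<dots> = (\<Sum>E\<in>Pow ?I. q ^ card (sym_diff D D') * ((\<Prod>x\<in>E. 1 - q\<^sup>2) * (\<Prod>x\<in>?I - E. q\<^sup>2)))"
  proof (intro sum.cong refl)
    fix E assume E: "E \<in> Pow ?I"
    have "D - E = (D - D') \<union> (?I - E)" "D' - E = (D' - D) \<union> (?I - E)"
      using E by auto
    moreover have "card ((D - D') \<union> (?I - E)) = card (D - D') + card (?I - E)"
      using f by (intro card_Un_disjoint) auto
    moreover have "card ((D' - D) \<union> (?I - E)) = card (D' - D) + card (?I - E)"
      using f by (intro card_Un_disjoint) auto
    ultimately have c: "card (D - E) = card (D - D') + card (?I - E)" "card (D' - E) = card (D' - D) + card (?I - E)"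
      by simp_all
    have s: "card (sym_diff D D') = card (D - D') + card (D' - D)"
      using f by (intro card_Un_disjoint) auto
    have "sqrt (1 - q\<^sup>2) ^ n * sqrt (1 - q\<^sup>2) ^ n = (1 - q\<^sup>2) ^ n" for n
      using q by (simp flip: power_mult_distrib)
    moreover have "shift_weight q D E * shift_weight q D' E =
        (q ^ card (D - E) * q ^ card (D' - E)) * (sqrt (1 - q\<^sup>2) ^ card E * sqrt (1 - q\<^sup>2) ^ card E)"
      using E by (simp add: shift_weight_def)
    ultimately show "shift_weight q D E * shift_weight q D' E =
        q ^ card (sym_diff D D') * ((\<Prod>x\<in>E. 1 - q\<^sup>2) * (\<Prod>x\<in>?I - E. q\<^sup>2))"
      unfolding c s by (simp add: power_add power2_eq_square power_mult_distrib mult_ac)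
  qed
  \<comment> \<open>Summing over the subsets E of the intersection multiplies out to one factor (1 -
    q^2) + q^2 = 1 for each of its elements.\<close>
  also have "\<dots> = q ^ card (sym_diff D D') * (\<Prod>x\<in>?I. (1 - q\<^sup>2) + q\<^sup>2)"
    unfolding sum_distrib_left[symmetric] prod_add[OF f(3)] ..
  finally show ?thesis by simp
qed

text \<open>The copy attached to \<open>D\<close>.  The coordinate \<open>Es ! i\<close> of \<open>v\<^sub>D\<close> multiplies the increment
  \<open>X\<^bsub>t + i S\<^esub> - X\<^bsub>i S\<^esub>\<close>, and for \<open>t \<le> S\<close> the increments for different \<open>i\<close> are uncorrelated.\<close>

definition shift_combo :: "real \<Rightarrow> real \<Rightarrow> 'e set list \<Rightarrow> 'e set \<Rightarrow> real \<Rightarrow> combo" where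
  "shift_combo q S Es D t = concat (map (\<lambda>i. [(shift_weight q D (Es ! i), t + real i * S),
    (- shift_weight q D (Es ! i), real i * S)]) [0..<length Es])"

lemma cov_concat_left: "cov (concat (map f xs)) w = (\<Sum>x\<leftarrow>xs. cov (f x) w)"
  by (induction xs) (simp_all add: cov_append_left)

lemma cov_concat_right: "cov w (concat (map f xs)) = (\<Sum>x\<leftarrow>xs. cov w (f x))"
  by (induction xs) (simp_all add: cov_append_right)

lemma cov_increments:
  assumes "0 \<le> t" "t \<le> S" "0 \<le> u" "u \<le> S"
  shows "cov [(a, t + real i * S), (- a, real i * S)] [(b, u + real j * S), (- b, real j * S)] =
    (if i = j then a * b * min t u else 0)"
proof -
  have *: "real i * S + S \<le> real j * S" if "i < j" for i j :: nat
  proof -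
    have "(real i + 1) * S \<le> real j * S"
      using that assms by (intro mult_right_mono) auto
    then show ?thesis by (simp add: algebra_simps)
  qed
  consider "i = j" | "i < j" | "j < i" by linarith
  then show ?thesis
  proof cases
    case 1
    have "min (t + real j * S) (u + real j * S) = min t u + real j * S" by (simp add: min_def)
    moreover have "min (t + real j * S) (real j * S) = real j * S" "min (real j * S) (u + real j * S) = real j * S"
      using assms by simp_all
    ultimately show ?thesis using 1 by (simp add: cov_def algebra_simps)
  next
    case 2
    have "min (t + real i * S) (u + real j * S) = t + real i * S" "min (t + real i * S) (real j * S) = t + real i * S"
        "min (real i * S) (u + real j * S) = real i * S" "min (real i * S) (real j * S) = real i * S"
      using *[OF 2] assms by auto
    then show ?thesis using 2 by (simp add: cov_def algebra_simps)
  next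
    case 3
    have "min (t + real i * S) (u + real j * S) = u + real j * S" "min (t + real i * S) (real j * S) = real j * S"
        "min (real i * S) (u + real j * S) = u + real j * S" "min (real i * S) (real j * S) = real j * S"
      using *[OF 3] assms by auto
    then show ?thesis using 3 by (simp add: cov_def algebra_simps)
  qed
qed

text \<open>Increments in different windows of length S are uncorrelated and those in the same
  window have covariance \<open>min t u\<close>, so the covariance is \<open>min t u\<close> times
  the inner product of the two weight vectors.\<close>

lemma cov_shift_combo:
  assumes fin: "finite R" and D: "D \<subseteq> R" "D' \<subseteq> R" and q: "q\<^sup>2 \<le> 1"
    and Es: "distinct Es" "set Es = Pow R" and t: "0 \<le> t" "t \<le> S" "0 \<le> u" "u \<le> S"
  shows "cov (shift_combo q S Es D t) (shift_combo q S Es D' u) = min t u * q ^ card (sym_diff D D')"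
proof -
  have "cov (shift_combo q S Es D t) (shift_combo q S Es D' u) =
      (\<Sum>i<length Es. \<Sum>j<length Es. if i = j then shift_weight q D (Es ! i) * shift_weight q D' (Es ! j) * min t u else 0)"
    unfolding shift_combo_def cov_concat_left cov_concat_right cov_increments[OF t]
    by (simp add: sum_list_sum_nth atLeast0LessThan)
  also have "\<dots> = min t u * (\<Sum>i<length Es. shift_weight q D (Es ! i) * shift_weight q D' (Es ! i))"
    by (simp add: sum_distrib_left mult_ac)
  also have "(\<Sum>i<length Es. shift_weight q D (Es ! i) * shift_weight q D' (Es ! i)) =
      (\<Sum>E\<in>Pow R. shift_weight q D E * shift_weight q D' E)"
    using sum.reindex_bij_betw[OF bij_betw_nth[OF Es(1) refl Es(2)[symmetric]]] by simp
  finally show ?thesis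
    using shift_weight_inner[OF fin D q] by simp
qed

lemma times_in_shift_combo: "0 \<le> t \<Longrightarrow> 0 \<le> S \<Longrightarrow> times_in {0..} (shift_combo q S Es D t)"
  by (auto simp: times_in_def shift_combo_def)

section \<open>Non-commutative polynomials\<close>

text \<open>A polynomial is a list of monomials with coefficients; repeated monomials are added up.\<close>

type_synonym 'l ncpoly = "(complex \<times> 'l list) list"

definition ev :: "('l \<Rightarrow> 'h::complex_hilbert op) \<Rightarrow> 'l ncpoly \<Rightarrow> 'h op" where
  "ev Z p = (\<Sum>x\<leftarrow>p. op_scale (fst x) (oprod (map Z (snd x))))"

definition letters :: "'l ncpoly \<Rightarrow> 'l set" where
  "letters p = (\<Union>x\<in>set p. set (snd x))"

definition pmul :: "'l ncpoly \<Rightarrow> 'l ncpoly \<Rightarrow> 'l ncpoly" where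
  "pmul p r = concat (map (\<lambda>x. map (\<lambda>y. (fst x * fst y, snd x @ snd y)) r) p)"

definition padj :: "'l ncpoly \<Rightarrow> 'l ncpoly" where
  "padj p = map (\<lambda>x. (cnj (fst x), rev (snd x))) p"

definition pmap :: "('l \<Rightarrow> 'm) \<Rightarrow> 'l ncpoly \<Rightarrow> 'm ncpoly" where
  "pmap f p = map (\<lambda>x. (fst x, map f (snd x))) p"

definition ppow :: "'l ncpoly \<Rightarrow> nat \<Rightarrow> 'l ncpoly" where
  "ppow p n = (pmul p ^^ n) [(1, [])]"

lemma ev_Nil [simp]: "ev Z [] = 0"
  and ev_Cons: "ev Z (x # p) = op_scale (fst x) (oprod (map Z (snd x))) + ev Z p"
  and ev_append: "ev Z (p @ p') = ev Z p + ev Z p'"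
  by (simp_all add: ev_def)

lemma letters_simps [simp]: "letters [] = {}" "letters (x # p) = set (snd x) \<union> letters p"
  "letters (p @ r) = letters p \<union> letters r"
  by (auto simp: letters_def)

lemma letters_pmul: "letters (pmul p r) \<subseteq> letters p \<union> letters r"
  by (auto simp: letters_def pmul_def)

lemma letters_padj: "letters (padj p) = letters p"
  by (auto simp: letters_def padj_def)

lemma letters_ppow: "letters (ppow p n) \<subseteq> letters p"
proof (induction n)
  case (Suc n)
  then show ?case using letters_pmul[of p "ppow p n"] by (auto simp: ppow_def)
qed (simp add: ppow_def)

lemma ev_in:
  assumes "unital_subalgebra B" "Z ` letters p \<subseteq> B" shows "ev Z p \<in> B"
  using assms(2)
proof (induction p)
  case (Cons x p)
  then show ?case
    by (simp add: ev_Cons image_Un subalg_add[OF assms(1)] subalg_op_scale[OF assms(1)] oprod_in[OF assms(1)])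
qed (simp add: subalg_zero[OF assms(1)])

lemma ev_pmul:
  assumes sub: "unital_subalgebra B" and Z: "Z ` letters p \<subseteq> B"
  shows "ev Z (pmul p r) = ev Z p o\<^sub>L ev Z r"
  using Z
proof (induction p)
  case (Cons x p)
  have "ev Z (map (\<lambda>y. (fst x * fst y, snd x @ snd y)) r) = op_scale (fst x) (oprod (map Z (snd x)) o\<^sub>L ev Z r)"
  proof (induction r)
    case (Cons y r)
    have "oprod (map Z (snd x)) \<in> B" using Cons.prems \<open>Z ` letters (x # p) \<subseteq> B\<close>
      by (intro oprod_in sub) (simp add: image_Un)
    then have "oprod (map Z (snd x)) \<in> bounded_ops" by (rule subalg_bounded_ops[OF sub])
    then show ?case
      using Cons by (simp add: ev_Cons compose_add_right op_scale_add_right op_scale_compose_right op_scale_op_scale)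
  qed (simp add: compose_zero_right)
  then show ?case
    using Cons by (simp add: pmul_def ev_append ev_Cons compose_add_left op_scale_compose_left image_Un)
qed (simp add: pmul_def compose_zero_left)

lemma ev_ppow:
  assumes "unital_subalgebra B" "Z ` letters p \<subseteq> B"
  shows "ev Z (ppow p n) = opow (ev Z p) n"
  by (induction n) (simp_all add: ppow_def ev_Cons ev_pmul[OF assms])

lemma is_adjoint_oprod:
  "(\<And>l. l \<in> set w \<Longrightarrow> is_adjoint (Z l) (Z l)) \<Longrightarrow> is_adjoint (oprod (map Z w)) (oprod (map Z (rev w)))"
proof (induction w)
  case (Cons a w)
  then have "is_adjoint (Z a o\<^sub>L oprod (map Z w)) (oprod (map Z (rev w)) o\<^sub>L Z a)"
    by (intro is_adjoint_compose) auto
  then show ?case by simp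
qed (simp add: is_adjoint_id)

lemma is_adjoint_ev:
  "(\<And>l. l \<in> letters p \<Longrightarrow> is_adjoint (Z l) (Z l)) \<Longrightarrow> is_adjoint (ev Z p) (ev Z (padj p))"
proof (induction p)
  case (Cons x p)
  then show ?case
    by (auto simp: ev_Cons padj_def intro!: is_adjoint_add is_adjoint_op_scale is_adjoint_oprod)
qed (simp add: padj_def is_adjoint_zero)

lemma ev_pmap: "ev Z (pmap f p) = ev (\<lambda>l. Z (f l)) p"
  by (induction p) (simp_all add: ev_Cons pmap_def comp_def)

text \<open>\<open>mixp 0 [p\<^sub>0, p\<^sub>1, \<dots>]\<close> is \<open>y\<^sub>0 p\<^sub>0 y\<^sub>1 p\<^sub>1 \<dots>\<close>: the letter \<open>Inl j\<close> stands for \<open>y\<^sub>j\<close>, and \<open>Inr (j, t)\<close> for the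
  letter \<open>t\<close> of \<open>p\<^sub>j\<close>, so that each slot can be evaluated at its own copy.\<close>

fun mixp :: "nat \<Rightarrow> 'l ncpoly list \<Rightarrow> (nat + nat \<times> 'l) ncpoly" where
  "mixp k [] = [(1, [])]"
| "mixp k (p # ps) = pmul [(1, [Inl k])] (pmul (pmap (\<lambda>t. Inr (k, t)) p) (mixp (Suc k) ps))"

lemma letters_mixp: "l \<in> letters (mixp k ps) \<Longrightarrow>
    (\<exists>j. l = Inl j \<and> k \<le> j \<and> j < k + length ps) \<or> (\<exists>j t. l = Inr (j, t) \<and> k \<le> j \<and> j < k + length ps \<and> t \<in> letters (ps ! (j - k)))"
proof (induction ps arbitrary: k)
  case (Cons p ps)
  have "l \<in> {Inl k} \<union> (\<lambda>t. Inr (k, t)) ` letters p \<union> letters (mixp (Suc k) ps)"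
  proof -
    have "l \<in> letters [(1, [Inl k])] \<union> letters (pmul (pmap (\<lambda>t. Inr (k, t)) p) (mixp (Suc k) ps))"
      using Cons.prems letters_pmul by (metis mixp.simps(2) subsetD)
    moreover have "letters (pmap (\<lambda>t. Inr (k, t)) p :: (nat + nat \<times> 'a) ncpoly) = (\<lambda>t. Inr (k, t)) ` letters p"
      by (auto simp: letters_def pmap_def)
    ultimately show ?thesis
      using letters_pmul[of "pmap (\<lambda>t. Inr (k, t)) p" "mixp (Suc k) ps"] by auto
  qed
  then consider "l = Inl k" | t where "l = Inr (k, t)" "t \<in> letters p" | "l \<in> letters (mixp (Suc k) ps)" by auto
  then show ?case
  proof cases
    case 3
    from Cons.IH[OF this] show ?thesis
    proof (elim disjE exE conjE)
      fix j t assume j: "l = Inr (j, t)" "Suc k \<le> j" "j < Suc k + length ps" "t \<in> letters (ps ! (j - Suc k))"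
      then have "(p # ps) ! (j - k) = ps ! (j - Suc k)" by (simp add: nth_Cons')
      then show ?thesis using j by auto
    qed auto
  qed auto
qed simp

lemma ev_mixp:
  assumes sub: "unital_subalgebra B"
    and Z: "Z ` letters (mixp k ps) \<subseteq> B" "\<And>j. Z (Inl j) \<in> B" "\<And>j t. j < length ps \<Longrightarrow> t \<in> letters (ps ! j) \<Longrightarrow> Z (Inr (k + j, t)) \<in> B"
  shows "ev Z (mixp k ps) =
    oprod (map (\<lambda>j. Z (Inl (k + j)) o\<^sub>L ev (\<lambda>t. Z (Inr (k + j, t))) (ps ! j)) [0..<length ps])"
  using Z(3)
proof (induction ps arbitrary: k)
  case (Cons p ps)
  have IH: "ev Z (mixp (Suc k) ps) =
    oprod (map (\<lambda>j. Z (Inl (Suc k + j)) o\<^sub>L ev (\<lambda>t. Z (Inr (Suc k + j, t))) (ps ! j)) [0..<length ps])"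
  proof (rule Cons.IH)
    fix j t assume "j < length ps" "t \<in> letters (ps ! j)"
    then show "Z (Inr (Suc k + j, t)) \<in> B" using Cons.prems[of "Suc j" t] by simp
  qed
  have "ev Z (mixp k (p # ps)) = Z (Inl k) o\<^sub>L ev Z (pmul (pmap (\<lambda>t. Inr (k, t)) p) (mixp (Suc k) ps))"
    using Z(2) by (simp add: ev_pmul[OF sub] ev_Cons)
  also have "ev Z (pmul (pmap (\<lambda>t. Inr (k, t)) p) (mixp (Suc k) ps)) =
      ev Z (pmap (\<lambda>t. Inr (k, t)) p) o\<^sub>L ev Z (mixp (Suc k) ps)"
    by (rule ev_pmul[OF sub]) (use Cons.prems[of 0] in \<open>auto simp: letters_def pmap_def\<close>)
  finally show ?case
    unfolding IH ev_pmap
    by (simp add: upt_conv_Cons map_Suc_upt[symmetric] comp_def op_assoc del: upt_Suc)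
qed (simp add: ev_Cons)

text \<open>Supplies the slot hypothesis of \<open>wick_letters\<close>: all monomials have the same
  future letters in the same order, and the index stored in a past letter is that of the last future
  letter before it.\<close>

lemma mixp_word:
  "x \<in> set (mixp k ps) \<Longrightarrow> filter isl (snd x) = map Inl [k..<k + length ps] \<and>
    (\<forall>i<length (snd x). \<not> isl (snd x ! i) \<longrightarrow>
      Suc (fst (projr (snd x ! i))) = k + length (filter isl (take i (snd x))))"
proof (induction ps arbitrary: k x)
  case (Cons p ps)
  then obtain u y where x: "snd x = Inl k # map (\<lambda>t. Inr (k, t)) u @ snd y" and y: "y \<in> set (mixp (Suc k) ps)"
    by (auto simp: pmul_def pmap_def)
  note IH = Cons.IH[OF y]
  have fu: "filter isl (map (\<lambda>t. Inr (k, t)) v) = []" for v by (simp add: filter_empty_conv)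
  have "filter isl (snd x) = map Inl [k..<k + length (p # ps)]"
    using IH by (simp add: x fu upt_conv_Cons del: upt_Suc)
  moreover have "Suc (fst (projr (snd x ! i))) = k + length (filter isl (take i (snd x)))"
    if i: "i < length (snd x)" "\<not> isl (snd x ! i)" for i
  proof -
    obtain i' where i': "i = Suc i'" using i(2) by (cases i) (auto simp: x)
    show ?thesis
    proof (cases "i' < length u")
      case True
      then show ?thesis by (simp add: x i' nth_append take_map fu del: filter_map)
    next
      case False
      define r where "r = i' - length u"
      have r: "i' = length u + r" using False by (simp add: r_def)
      have "r < length (snd y)" "\<not> isl (snd y ! r)" using i by (simp_all add: x i' r nth_append)
      then show ?thesis using IH by (simp add: x i' r nth_append fu del: filter_map)
    qed
  qed
  ultimately show ?case by blast
qed simp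

lemma norm_oprod_le: "norm (oprod (map F xs)) \<le> (\<Prod>x\<leftarrow>xs. norm (F x))"
proof (induction xs)
  case (Cons a xs)
  have "norm (F a o\<^sub>L oprod (map F xs)) \<le> norm (F a) * norm (oprod (map F xs))"
    by (rule norm_blinfun_compose)
  also have "\<dots> \<le> norm (F a) * (\<Prod>x\<leftarrow>xs. norm (F x))"
    by (intro mult_left_mono Cons) simp
  finally show ?case by simp
qed (simp add: norm_blinfun_bound)

lemma oprod_map_id:
  "oprod (map (case_sum (\<lambda>_. id_blinfun) G) w) = oprod (map G (map projr (filter (\<lambda>l. \<not> isl l) w)))"
  by (induction w) (auto split: sum.splits)

lemma sum_list_sum_swap:
  "(\<Sum>x\<leftarrow>xs. \<Sum>i\<in>I. f x i) = (\<Sum>i\<in>I. \<Sum>x\<leftarrow>xs. (f x i :: complex))"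
  by (induction xs) (simp_all add: sum.distrib)

section \<open>Mixed moments of future letters and past elements\<close>

context q_brownian
begin

lemma phi_ev:
  assumes "Z ` letters p \<subseteq> A"
  shows "\<phi> (ev Z p) = (\<Sum>x\<leftarrow>p. fst x * \<phi> (oprod (map Z (snd x))))"
  using assms
proof (induction p)
  case (Cons x p)
  then have "oprod (map Z (snd x)) \<in> A" "ev Z p \<in> A" "Z ` letters p \<subseteq> A"
    by (simp_all add: oprod_in[OF subA] ev_in[OF subA] image_Un)
  then show ?case using Cons by (simp add: ev_Cons phi_add phi_op_scale A_op_scale)
qed simp

lemma norm_opow_le_power: "norm (opow B n) \<le> norm B ^ n"
proof (induction n)
  case (Suc n)
  have "norm (opow B (Suc n)) \<le> norm B * norm (opow B n)"
    by (simp add: norm_blinfun_compose)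
  also have "\<dots> \<le> norm B * norm B ^ n"
    by (intro mult_left_mono Suc) simp
  finally show ?case by simp
qed (simp add: norm_blinfun_bound)

text \<open>Equality of the covariances on \<open>T\<close> gives equality in law, hence of the norms.\<close>

lemma norm_ev_copy_le:
  assumes T: "T \<subseteq> {0..}" and g: "\<And>t. t \<in> T \<Longrightarrow> times_in {0..} (g t)"
    and c: "\<And>t u. t \<in> T \<Longrightarrow> u \<in> T \<Longrightarrow> cov (g t) (g u) = min t u" and p: "letters p \<subseteq> T"
  shows "norm (ev (\<lambda>t. val X (g t)) p) \<le> norm (ev X p)"
proof -
  let ?Z = "\<lambda>t. val X (g t)"
  have ZA: "?Z ` letters r \<subseteq> A" and XA: "X ` letters r \<subseteq> A" if "letters r \<subseteq> T" for r
    using that T g by (auto intro!: val_A X_A)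
  have eq: "\<phi> (ev ?Z r) = \<phi> (ev X r)" if r: "letters r \<subseteq> T" for r
    unfolding phi_ev[OF ZA[OF r]] phi_ev[OF XA[OF r]]
  proof (intro arg_cong[where f = sum_list] map_cong refl arg_cong2[where f = "(*)"])
    fix x assume "x \<in> set r"
    then have x: "set (snd x) \<subseteq> T" using r by (auto simp: letters_def)
    have "\<phi> (oprod (map ?Z (snd x))) = \<phi> (oprod (map (val X) (map g (snd x))))"
      by (simp add: comp_def)
    also have "\<dots> = of_real (wick_sum q cov (map g (snd x)))"
      by (rule wick) (use x g in auto)
    also have "wick_sum q cov (map g (snd x)) = wick_sum q min (snd x)"
      unfolding wick_sum_map by (rule wick_sum_cong) (use x c in auto)
    also have "of_real \<dots> = \<phi> (oprod (map X (snd x)))"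
      by (rule wick_base[symmetric]) (use x T in auto)
    finally show "\<phi> (oprod (map ?Z (snd x))) = \<phi> (oprod (map X (snd x)))" .
  qed
  have pa: "letters (padj p) \<subseteq> T" using p by (simp add: letters_padj)
  have pp: "letters (pmul (padj p) p) \<subseteq> T" using letters_pmul[of "padj p" p] p pa by blast
  have pn: "letters (ppow (pmul (padj p) p) n) \<subseteq> T" for n using letters_ppow[of "pmul (padj p) p" n] pp by blast
  have pw: "opow (ev Z (padj p) o\<^sub>L ev Z p) n = ev Z (ppow (pmul (padj p) p) n)"
    if "\<And>r. letters r \<subseteq> T \<Longrightarrow> Z ` letters r \<subseteq> A" for n and Z :: "real \<Rightarrow> 'h op"
    by (simp add: ev_ppow[OF subA that[OF pp]] ev_pmul[OF subA that[OF pa]])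
  show ?thesis
  proof (rule norm_le_of_moments[where Z' = "ev ?Z (padj p)" and K = 2])
    show "ev ?Z p \<in> A" "ev ?Z (padj p) \<in> A" using ZA p pa by (auto intro!: ev_in subA)
    show "is_adjoint (ev ?Z p) (ev ?Z (padj p))"
      by (rule is_adjoint_ev) (use p g in \<open>auto intro: val_adj\<close>)
    fix n
    have XX: "is_adjoint (ev X p) (ev X (padj p))"
      by (rule is_adjoint_ev) (use p T in \<open>auto intro!: X_adj\<close>)
    have "Re (\<phi> (opow (ev ?Z (padj p) o\<^sub>L ev ?Z p) n)) = Re (\<phi> (opow (ev X (padj p) o\<^sub>L ev X p) n))"
    proof -
      have "opow (ev ?Z (padj p) o\<^sub>L ev ?Z p) n = ev ?Z (ppow (pmul (padj p) p) n)"
        by (rule pw) (rule ZA)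
      moreover have "opow (ev X (padj p) o\<^sub>L ev X p) n = ev X (ppow (pmul (padj p) p) n)"
        by (rule pw) (rule XA)
      ultimately show ?thesis by (simp only: eq[OF pn])
    qed
    also have "\<dots> \<le> cmod (\<phi> (opow (ev X (padj p) o\<^sub>L ev X p) n))"
      by (rule complex_Re_le_cmod)
    also have "\<dots> \<le> 2 * norm (opow (ev X (padj p) o\<^sub>L ev X p) n)"
      by (intro phi_bound A_opow A_compose ev_in subA XA p pa)
    also have "\<dots> \<le> 2 * norm (ev X (padj p) o\<^sub>L ev X p) ^ n"
      using norm_opow_le_power by simp
    also have "\<dots> \<le> 2 * ((norm (ev X p))\<^sup>2) ^ n"
      using norm_blinfun_compose[of "ev X (padj p)" "ev X p"] norm_adjoint[OF XX]
      by (intro mult_left_mono power_mono) (auto simp: power2_eq_square)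
    finally show "Re (\<phi> (opow (ev ?Z (padj p) o\<^sub>L ev ?Z p) n)) \<le> 2 * ((norm (ev X p))\<^sup>2) ^ n" .
  qed simp
qed

lemma q2: "q\<^sup>2 \<le> 1"
  using q0 q1 by (simp add: power_le_one)

text \<open>\<open>wick_letters\<close> for one monomial. The damped covariances of the past letters
  are exactly the covariances of the shifted copies, so each inner Wick sum is again a moment,
  namely that of the word with its future letters evaluated at the identity.\<close>

lemma mixed_word:
  fixes y :: "nat \<Rightarrow> combo"
  assumes y: "\<And>j. j < m \<Longrightarrow> times_in {0..} (y j)"
    and orth: "\<And>j t. j < m \<Longrightarrow> t \<in> {0..s} \<Longrightarrow> cov (y j) [(1, t)] = 0"
    and w: "filter isl w = map Inl [0..<m]" "\<And>j t. Inr (j, t) \<in> set w \<Longrightarrow> t \<in> {0..s}"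
      "\<And>i. i < length w \<Longrightarrow> \<not> isl (w ! i) \<Longrightarrow> Suc (fst (projr (w ! i))) = length (filter isl (take i w))"
    and s: "0 \<le> s"
    and Es: "\<And>\<pi>. \<pi> \<in> pairings m \<Longrightarrow> distinct (Es \<pi>) \<and> set (Es \<pi>) = Pow \<pi>"
  shows "\<phi> (oprod (map (case_sum (\<lambda>j. val X (y j)) (\<lambda>(j, t). X t)) w)) =
    (\<Sum>\<pi>\<in>pairings m. of_real (q ^ crossings \<pi> * (\<Prod>b\<in>\<pi>. cov (y (Min b)) (y (Max b)))) *
      \<phi> (oprod (map (case_sum (\<lambda>_. id_blinfun) (\<lambda>(j, t). val X (shift_combo q s (Es \<pi>) (open_arcs \<pi> j) t))) w)))"
proof -
  let ?c = "case_sum y (\<lambda>(j, t). [(1, t)]) :: nat + nat \<times> real \<Rightarrow> combo"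
  let ?K = "\<lambda>k l. cov (?c k) (?c l)"
  let ?past = "filter (\<lambda>l. \<not> isl l) w"
  have inl: "j < m" if "Inl j \<in> set w" for j
  proof -
    have "Inl j \<in> set (filter isl w)" using that by simp
    then show ?thesis unfolding w(1) by auto
  qed
  have tc: "times_in {0..} (?c l)" if "l \<in> set w" for l
  proof (cases l)
    case (Inl j) then show ?thesis using y inl that by simp
  next
    case (Inr jt)
    then show ?thesis using w(2)[of "fst jt" "snd jt"] that by (cases jt) (auto simp: times_in_def)
  qed
  have "map (case_sum (\<lambda>j. val X (y j)) (\<lambda>(j, t). X t)) w = map (val X) (map ?c w)"
    by (auto split: sum.splits)
  then have "\<phi> (oprod (map (case_sum (\<lambda>j. val X (y j)) (\<lambda>(j, t). X t)) w)) = of_real (wick_sum q ?K w)"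
    using wick[of "map ?c w"] tc by (simp add: wick_sum_map del: map_map)
  also have "wick_sum q ?K w = (\<Sum>\<pi>\<in>pairings (length (filter isl w)).
    q ^ crossings \<pi> * (\<Prod>b\<in>\<pi>. ?K (filter isl w ! Min b) (filter isl w ! Max b)) *
    wick_sum q (\<lambda>k l. ?K k l * q ^ card (sym_diff (open_arcs \<pi> (fst (projr k))) (open_arcs \<pi> (fst (projr l))))) ?past)"
  proof (rule wick_letters[where slot = "\<lambda>l. fst (projr l)"])
    have "?K (Inl j) (Inr (i, t)) = 0" if "Inl j \<in> set w" "Inr (i, t) \<in> set w" for i j t
      using orth[OF inl[OF that(1)] w(2)[OF that(2)]] by simp
    then show "?K k l = 0" if "k \<in> set w" "l \<in> set w" "isl k \<noteq> isl l" for k l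
      using that cov_sym[of "?c k" "?c l"] by (cases k; cases l) auto
  qed (rule w(3))
  also have "\<dots> = (\<Sum>\<pi>\<in>pairings m. q ^ crossings \<pi> * (\<Prod>b\<in>\<pi>. cov (y (Min b)) (y (Max b))) *
    wick_sum q (\<lambda>k l. ?K k l * q ^ card (sym_diff (open_arcs \<pi> (fst (projr k))) (open_arcs \<pi> (fst (projr l))))) ?past)"
    unfolding w(1)
  proof (simp only: length_map length_upt diff_zero, intro sum.cong refl arg_cong2[where f = "(*)"] prod.cong)
    fix \<pi> b assume "\<pi> \<in> pairings m" "b \<in> \<pi>"
    then have "Min b < m" "Max b < m"
      using pairs_on_block(1,6,7)[of \<pi> "{..<m}" b] by (auto simp: pairings_eq)
    then show "?K (map Inl [0..<m] ! Min b) (map Inl [0..<m] ! Max b) = cov (y (Min b)) (y (Max b))"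
      by simp
  qed
  finally have 1: "\<phi> (oprod (map (case_sum (\<lambda>j. val X (y j)) (\<lambda>(j, t). X t)) w)) =
    (\<Sum>\<pi>\<in>pairings m. of_real (q ^ crossings \<pi> * (\<Prod>b\<in>\<pi>. cov (y (Min b)) (y (Max b)))) *
    of_real (wick_sum q (\<lambda>k l. ?K k l * q ^ card (sym_diff (open_arcs \<pi> (fst (projr k))) (open_arcs \<pi> (fst (projr l))))) ?past))"
    by simp
  have 2: "\<phi> (oprod (map (case_sum (\<lambda>_. id_blinfun) (\<lambda>(j, t). val X (shift_combo q s (Es \<pi>) (open_arcs \<pi> j) t))) w)) =
    of_real (wick_sum q (\<lambda>k l. ?K k l * q ^ card (sym_diff (open_arcs \<pi> (fst (projr k))) (open_arcs \<pi> (fst (projr l))))) ?past)"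
    if p: "\<pi> \<in> pairings m" for \<pi>
  proof -
    let ?d = "\<lambda>jt. shift_combo q s (Es \<pi>) (open_arcs \<pi> (fst jt)) (snd jt)"
    have fin: "finite \<pi>" using pairs_on_finite[of \<pi> "{..<m}"] p by (simp add: pairings_eq)
    have past: "\<exists>j t. l = Inr (j, t) \<and> t \<in> {0..s}" if "l \<in> set ?past" for l
    proof -
      have l: "l \<in> set w" "\<not> isl l" using that by simp_all
      from l(2) have "l = Inr (fst (projr l), snd (projr l))" by (simp add: sum.collapse(2))
      then show ?thesis using l(1) w(2) by metis
    qed
    have "oprod (map (case_sum (\<lambda>_. id_blinfun) (\<lambda>(j, t). val X (shift_combo q s (Es \<pi>) (open_arcs \<pi> j) t))) w) =
        oprod (map (val X) (map ?d (map projr ?past)))"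
      unfolding oprod_map_id by (simp add: comp_def case_prod_beta)
    also have "\<phi> \<dots> = of_real (wick_sum q cov (map ?d (map projr ?past)))"
      by (rule wick) (use past s in \<open>fastforce intro!: times_in_shift_combo\<close>)
    also have "wick_sum q cov (map ?d (map projr ?past)) = wick_sum q (\<lambda>k l. ?K k l * q ^ card (sym_diff (open_arcs \<pi> (fst (projr k))) (open_arcs \<pi> (fst (projr l))))) ?past"
      unfolding wick_sum_map
    proof (rule wick_sum_cong)
      fix k l assume "k \<in> set ?past" "l \<in> set ?past"
      then obtain i t j u where kl: "k = Inr (i, t)" "l = Inr (j, u)" "t \<in> {0..s}" "u \<in> {0..s}"
        using past by meson
      have "cov (shift_combo q s (Es \<pi>) (open_arcs \<pi> i) t) (shift_combo q s (Es \<pi>) (open_arcs \<pi> j) u) =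
          min t u * q ^ card (sym_diff (open_arcs \<pi> i) (open_arcs \<pi> j))"
        by (rule cov_shift_combo[OF fin]) (use kl Es[OF p] q2 in \<open>auto simp: open_arcs_def\<close>)
      then show "cov (?d (projr k)) (?d (projr l)) =
          ?K k l * q ^ card (sym_diff (open_arcs \<pi> (fst (projr k))) (open_arcs \<pi> (fst (projr l))))"
        by (simp add: kl cov_def)
    qed
    finally show ?thesis .
  qed
  show ?thesis unfolding 1 by (intro sum.cong refl) (simp only: 2)
qed

text \<open>For fixed \<pi> the copy used in slot j depends on j alone. Summing
  \<open>mixed_word\<close> over the monomials therefore restores the polynomials, each evaluated at
  one copy, and \<open>norm_ev_copy_le\<close> compares their norms with the original ones.\<close>

lemma mixed_moment_bound:
  fixes y :: "nat \<Rightarrow> combo"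
  assumes y: "\<And>j. times_in {0..} (y j)"
    and orth: "\<And>j t. t \<in> {0..s} \<Longrightarrow> cov (y j) [(1, t)] = 0"
    and s: "0 \<le> s" and ps: "\<And>p. p \<in> set ps \<Longrightarrow> letters p \<subseteq> {0..s}"
  shows "cmod (\<phi> (oprod (map (\<lambda>j. val X (y j) o\<^sub>L ev X (ps ! j)) [0..<length ps]))) \<le>
    (\<Sum>\<pi>\<in>pairings (length ps). q ^ crossings \<pi> * \<bar>\<Prod>b\<in>\<pi>. cov (y (Min b)) (y (Max b))\<bar>) *
      (2 * (\<Prod>p\<leftarrow>ps. norm (ev X p)))"
proof -
  let ?m = "length ps"
  let ?Q = "mixp 0 ps"
  let ?Z = "case_sum (\<lambda>j. val X (y j)) (\<lambda>(j, t). X t) :: nat + nat \<times> real \<Rightarrow> 'h op"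
  \<comment> \<open>Any enumeration of the subsets of \<pi> will do: it only decides which window of
    time carries which coordinate of the weight vectors.\<close>
  have "\<exists>Es. distinct Es \<and> set Es = Pow \<pi>" if "\<pi> \<in> pairings ?m" for \<pi>
    using finite_distinct_list[of "Pow \<pi>"] pairs_on_finite[of \<pi> "{..<?m}"] that by (auto simp: pairings_eq)
  then obtain Es where Es: "\<And>\<pi>. \<pi> \<in> pairings ?m \<Longrightarrow> distinct (Es \<pi>) \<and> set (Es \<pi>) = Pow \<pi>"
    by metis
  let ?g = "\<lambda>\<pi> j t. shift_combo q s (Es \<pi>) (open_arcs \<pi> j) t"
  let ?Y = "\<lambda>\<pi>. case_sum (\<lambda>_. id_blinfun) (\<lambda>(j, t). val X (?g \<pi> j t)) :: nat + nat \<times> real \<Rightarrow> 'h op"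
  have psj: "letters (ps ! j) \<subseteq> {0..s}" if "j < ?m" for j using ps that by simp
  have let_Q: "(\<exists>j. l = Inl j) \<or> (\<exists>j t. l = Inr (j, t) \<and> t \<in> {0..s})" if "l \<in> letters ?Q" for l
    using letters_mixp[OF that] psj by fastforce
  have gt: "times_in {0..} (?g \<pi> j t)" if "t \<in> {0..s}" for \<pi> j t
    using that s by (intro times_in_shift_combo) auto
  have ZA: "?Z ` letters ?Q \<subseteq> A" using let_Q y by (force intro!: val_A X_A)
  have YA: "?Y \<pi> ` letters ?Q \<subseteq> A" for \<pi> using let_Q gt by (force intro!: val_A A_id)
  have evZ: "ev ?Z ?Q = oprod (map (\<lambda>j. val X (y j) o\<^sub>L ev X (ps ! j)) [0..<?m])"
    by (subst ev_mixp[OF subA ZA]) (use y psj in \<open>force intro!: val_A X_A\<close>)+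
  have evY: "ev (?Y \<pi>) ?Q = oprod (map (\<lambda>j. ev (\<lambda>t. val X (?g \<pi> j t)) (ps ! j)) [0..<?m])" for \<pi>
    by (subst ev_mixp[OF subA YA]) (use gt psj in \<open>force intro!: val_A A_id\<close>)+
  let ?a = "\<lambda>\<pi>. q ^ crossings \<pi> * (\<Prod>b\<in>\<pi>. cov (y (Min b)) (y (Max b)))"
  have "\<phi> (ev ?Z ?Q) = (\<Sum>x\<leftarrow>?Q. fst x * \<phi> (oprod (map ?Z (snd x))))"
    by (rule phi_ev[OF ZA])
  also have "\<dots> = (\<Sum>x\<leftarrow>?Q. fst x * (\<Sum>\<pi>\<in>pairings ?m. of_real (?a \<pi>) * \<phi> (oprod (map (?Y \<pi>) (snd x)))))"
  proof (intro arg_cong[where f = sum_list] map_cong refl arg_cong2[where f = "(*)"])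
    fix x assume x: "x \<in> set ?Q"
    note mw = mixp_word[OF x]
    show "\<phi> (oprod (map ?Z (snd x))) = (\<Sum>\<pi>\<in>pairings ?m. of_real (?a \<pi>) * \<phi> (oprod (map (?Y \<pi>) (snd x))))"
    proof (rule mixed_word[OF y orth _ _ _ s Es])
      show "filter isl (snd x) = map Inl [0..<?m]" using mw by simp
      show "t \<in> {0..s}" if "Inr (j, t) \<in> set (snd x)" for j t
      proof -
        have "Inr (j, t) \<in> letters ?Q" using that x by (auto simp: letters_def)
        from let_Q[OF this] show ?thesis by simp
      qed
      show "Suc (fst (projr (snd x ! i))) = length (filter isl (take i (snd x)))"
        if "i < length (snd x)" "\<not> isl (snd x ! i)" for i
        using mw that by simp
    qed
  qed
  also have "\<dots> = (\<Sum>\<pi>\<in>pairings ?m. of_real (?a \<pi>) * (\<Sum>x\<leftarrow>?Q. fst x * \<phi> (oprod (map (?Y \<pi>) (snd x)))))"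
  proof -
    have *: "(\<Sum>x\<leftarrow>xs. c * f x) = c * (\<Sum>x\<leftarrow>xs. f x)" for c :: complex and f and xs :: "(complex \<times> (nat + nat \<times> real) list) list"
      by (induction xs) (simp_all add: algebra_simps)
    show ?thesis
      unfolding *[symmetric] sum_list_sum_swap[symmetric] by (simp add: sum_distrib_left mult.left_commute)
  qed
  also have "\<dots> = (\<Sum>\<pi>\<in>pairings ?m. of_real (?a \<pi>) * \<phi> (ev (?Y \<pi>) ?Q))"
    by (simp only: phi_ev[OF YA])
  also have "cmod \<dots> \<le> (\<Sum>\<pi>\<in>pairings ?m. cmod (of_real (?a \<pi>) * \<phi> (ev (?Y \<pi>) ?Q)))"
    by (rule norm_sum)
  also have "\<dots> \<le> (\<Sum>\<pi>\<in>pairings ?m. (q ^ crossings \<pi> * \<bar>\<Prod>b\<in>\<pi>. cov (y (Min b)) (y (Max b))\<bar>) *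
      (2 * (\<Prod>p\<leftarrow>ps. norm (ev X p))))"
  proof (rule sum_mono)
    fix \<pi> assume p: "\<pi> \<in> pairings ?m"
    have fin: "finite \<pi>" using pairs_on_finite[of \<pi> "{..<?m}"] p by (simp add: pairings_eq)
    have "ev (?Y \<pi>) ?Q \<in> A" using YA by (intro ev_in subA)
    then have "cmod (\<phi> (ev (?Y \<pi>) ?Q)) \<le> 2 * norm (ev (?Y \<pi>) ?Q)" by (rule phi_bound)
    also have "norm (ev (?Y \<pi>) ?Q) \<le> (\<Prod>j\<leftarrow>[0..<?m]. norm (ev (\<lambda>t. val X (?g \<pi> j t)) (ps ! j)))"
      unfolding evY by (rule norm_oprod_le)
    also have "\<dots> = (\<Prod>j<?m. norm (ev (\<lambda>t. val X (?g \<pi> j t)) (ps ! j)))"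
      by (simp add: prod.distinct_set_conv_list[symmetric] atLeast0LessThan)
    also have "\<dots> \<le> (\<Prod>j<?m. norm (ev X (ps ! j)))"
    proof (rule prod_mono, safe)
      fix j assume "j < ?m"
      show "norm (ev (\<lambda>t. val X (?g \<pi> j t)) (ps ! j)) \<le> norm (ev X (ps ! j))"
      proof (rule norm_ev_copy_le[of "{0..s}"])
        fix t u assume "t \<in> {0..s}" "u \<in> {0..s}"
        \<comment> \<open>Within one slot both letters have the same arc set, so the symmetric
          difference is empty and the copy has the covariance of the path itself.\<close>
        then show "cov (?g \<pi> j t) (?g \<pi> j u) = min t u"
          using cov_shift_combo[OF fin, of "open_arcs \<pi> j" "open_arcs \<pi> j" q "Es \<pi>" t s u] Es[OF p] q2
          by (auto simp: open_arcs_def)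
      qed (use gt psj \<open>j < ?m\<close> in auto)
    qed simp
    also have "\<dots> = (\<Prod>p\<leftarrow>ps. norm (ev X p))"
    proof -
      have "(\<Prod>j<length us. f (us ! j)) = (\<Prod>p\<leftarrow>us. f p)" for f :: "real ncpoly \<Rightarrow> real" and us
      proof (induction us)
        case (Cons a us)
        then show ?case by (simp add: prod.lessThan_Suc_shift del: prod.lessThan_Suc)
      qed simp
      then show ?thesis .
    qed
    finally have "cmod (\<phi> (ev (?Y \<pi>) ?Q)) \<le> 2 * (\<Prod>p\<leftarrow>ps. norm (ev X p))" by simp
    then have "\<bar>?a \<pi>\<bar> * cmod (\<phi> (ev (?Y \<pi>) ?Q)) \<le> \<bar>?a \<pi>\<bar> * (2 * (\<Prod>p\<leftarrow>ps. norm (ev X p)))"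
      by (rule mult_left_mono) simp
    then show "cmod (of_real (?a \<pi>) * \<phi> (ev (?Y \<pi>) ?Q)) \<le>
        (q ^ crossings \<pi> * \<bar>\<Prod>b\<in>\<pi>. cov (y (Min b)) (y (Max b))\<bar>) * (2 * (\<Prod>p\<leftarrow>ps. norm (ev X p)))"
      using q0 by (simp add: norm_mult abs_mult del: of_real_mult of_real_prod)
  qed
  finally show ?thesis
    unfolding evZ by (simp only: sum_distrib_right)
qed

end

section \<open>The key estimate\<close>

text \<open>A word records which summand is chosen in each factor of an expanded product of
  sums.\<close>

definition index_words :: "nat \<Rightarrow> nat \<Rightarrow> nat list set" where
  "index_words N m = {c. set c \<subseteq> {..<N} \<and> length c = m}"

lemma finite_index_words: "finite (index_words N m)"
  unfolding index_words_def by (rule finite_lists_length_eq) simp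

lemma sum_index_words_Suc:
  "sum g (index_words N (Suc m)) = (\<Sum>i<N. \<Sum>c\<in>index_words N m. g (i # c))"
proof -
  have "index_words N (Suc m) = (\<lambda>(i, c). i # c) ` ({..<N} \<times> index_words N m)"
    by (auto simp: index_words_def length_Suc_conv image_iff)
  moreover have inj: "inj_on (\<lambda>(i, c). i # c) ({..<N} \<times> index_words N m)"
    by (auto simp: inj_on_def)
  ultimately have "sum g (index_words N (Suc m)) = sum (g \<circ> (\<lambda>(i, c). i # c)) ({..<N} \<times> index_words N m)"
    by (simp only: sum.reindex[OF inj])
  also have "\<dots> = (\<Sum>i<N. \<Sum>c\<in>index_words N m. g (i # c))"
    unfolding sum.cartesian_product by (simp add: comp_def case_prod_beta)
  finally show ?thesis .
qed

lemma index_words_0: "index_words N 0 = {[]}"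
  by (auto simp: index_words_def)

lemma oprod_sum_expand:
  "oprod (map (\<lambda>k. \<Sum>i<N. F k i) [k0..<k0 + m]) =
    (\<Sum>c\<in>index_words N m. oprod (map (\<lambda>k. F (k0 + k) (c ! k)) [0..<m]))"
proof (induction m arbitrary: k0)
  case (Suc m)
  have "oprod (map (\<lambda>k. \<Sum>i<N. F k i) [k0..<k0 + Suc m]) =
      (\<Sum>i<N. F k0 i) o\<^sub>L oprod (map (\<lambda>k. \<Sum>i<N. F k i) [Suc k0..<Suc k0 + m])"
    by (simp add: upt_conv_Cons del: upt_Suc)
  also have "\<dots> = (\<Sum>i<N. \<Sum>c\<in>index_words N m. F k0 i o\<^sub>L oprod (map (\<lambda>k. F (Suc k0 + k) (c ! k)) [0..<m]))"
    unfolding Suc.IH by (subst compose_sum_left) (simp only: compose_sum_right)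
  also have "\<dots> = (\<Sum>i<N. \<Sum>c\<in>index_words N m. oprod (map (\<lambda>k. F (k0 + k) ((i # c) ! k)) [0..<Suc m]))"
    by (simp add: upt_conv_Cons map_Suc_upt[symmetric] comp_def del: upt_Suc)
  finally show ?case by (simp only: sum_index_words_Suc)
qed (simp add: index_words_0)

text \<open>Positions on which all words of G agree form classes of at least two elements, so there
  are at most n classes. A word of G is determined by its letters at the minima of the
  classes.\<close>

lemma card_constrained_words:
  assumes N: "N \<ge> 1" and G: "G \<subseteq> index_words N (2 * n)"
    and ex: "\<And>k. k < 2 * n \<Longrightarrow> \<exists>l<2 * n. l \<noteq> k \<and> (\<forall>c\<in>G. c ! k = c ! l)"
  shows "card G \<le> N ^ n"
proof -
  let ?V = "{..<2 * n}"
  have len: "length c = 2 * n" "set c \<subseteq> {..<N}" if "c \<in> G" for c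
    using subsetD[OF G that] by (auto simp: index_words_def)
  define cl where "cl k = {l. l < 2 * n \<and> (\<forall>c\<in>G. c ! k = c ! l)}" for k
  let ?Q = "cl ` ?V"
  have self: "k \<in> cl k" if "k < 2 * n" for k using that by (simp add: cl_def)
  have eq: "cl k = cl l" if "l \<in> cl k" for k l using that by (auto simp: cl_def)
  have fin: "finite (cl k)" for k by (simp add: cl_def)
  have disj: "pairwise disjnt ?Q"
  proof (rule pairwiseI)
    fix C D assume "C \<in> ?Q" "D \<in> ?Q" "C \<noteq> D"
    then obtain k l where "C = cl k" "D = cl l" "cl k \<noteq> cl l" by auto
    then show "disjnt C D" using eq[of _ k] eq[of _ l] unfolding disjnt_iff by metis
  qed
  have "2 * card ?Q = (\<Sum>C\<in>?Q. 2)" by simp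
  also have "\<dots> \<le> (\<Sum>C\<in>?Q. card C)"
  proof (rule sum_mono)
    fix C assume "C \<in> ?Q"
    then obtain k where k: "k < 2 * n" "C = cl k" by auto
    obtain l where l: "l < 2 * n" "l \<noteq> k" "\<forall>c\<in>G. c ! k = c ! l" using ex[OF k(1)] by auto
    have "{k, l} \<subseteq> C" using k l self by (auto simp: cl_def)
    then have "card {k, l} \<le> card C" using fin k by (intro card_mono) auto
    then show "2 \<le> card C" using l by simp
  qed
  also have "\<dots> = card (\<Union>?Q)"
    by (rule card_Union_disjoint[symmetric, OF disj]) (use fin in auto)
  also have "\<dots> \<le> card ?V"
    by (rule card_mono) (auto simp: cl_def)
  finally have cQ: "card ?Q \<le> n" by simp
  define \<Phi> where "\<Phi> c = (\<lambda>C\<in>?Q. c ! Min C)" for c :: "nat list"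
  have MinC: "Min (cl k) \<in> cl k" if "k < 2 * n" for k
    using self[OF that] fin by (intro Min_in) auto
  have "inj_on \<Phi> G"
  proof (rule inj_onI)
    fix c d assume cd: "c \<in> G" "d \<in> G" "\<Phi> c = \<Phi> d"
    show "c = d"
    proof (rule nth_equalityI)
      show "length c = length d" using len cd by simp
      fix k assume "k < length c"
      then have k: "k < 2 * n" using len cd by simp
      have "c ! Min (cl k) = d ! Min (cl k)"
        using fun_cong[OF cd(3), of "cl k"] k by (simp add: \<Phi>_def)
      moreover have "c ! k = c ! Min (cl k)" "d ! k = d ! Min (cl k)"
        using MinC[OF k] cd(1,2) unfolding cl_def by blast+
      ultimately show "c ! k = d ! k" by simp
    qed
  qed
  moreover have "\<Phi> ` G \<subseteq> PiE ?Q (\<lambda>_. {..<N})"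
  proof (rule image_subsetI)
    fix c assume c: "c \<in> G"
    have "c ! Min C < N" if C: "C \<in> ?Q" for C
    proof -
      obtain k where k: "k < 2 * n" "C = cl k" using C by auto
      have "l < 2 * n" if "l \<in> cl k" for l using that by (simp add: cl_def)
      then have "Min C < 2 * n" using MinC[OF k(1)] unfolding k(2) by blast
      then have "c ! Min C \<in> set c" using len[OF c] by simp
      then show ?thesis using len[OF c] by auto
    qed
    then show "\<Phi> c \<in> PiE ?Q (\<lambda>_. {..<N})" unfolding \<Phi>_def by auto
  qed
  moreover have "finite (PiE ?Q (\<lambda>_. {..<N}))" by (intro finite_PiE) auto
  ultimately have "card G \<le> card (PiE ?Q (\<lambda>_. {..<N}))"
    by (metis card_inj_on_le)
  also have "\<dots> = N ^ card ?Q" by (simp add: card_PiE)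
  also have "\<dots> \<le> N ^ n" using N cQ by (intro power_increasing) auto
  finally show ?thesis .
qed

lemma oprod_pairs:
  "oprod (map f [0..<2 * m]) = oprod (map (\<lambda>k. f (2 * k) o\<^sub>L f (Suc (2 * k))) [0..<m])"
  by (induction m) (simp_all add: op_assoc)

lemma opow_alternating:
  "opow (Y' o\<^sub>L Y) n = oprod (map (\<lambda>k. if even k then Y' else Y) [0..<2 * n])"
proof (induction n)
  case (Suc n)
  have "opow (Y' o\<^sub>L Y) (Suc n) = opow (Y' o\<^sub>L Y) n o\<^sub>L (Y' o\<^sub>L Y)" by (rule opow_Suc2)
  then show ?case using Suc by (simp add: op_assoc)
qed simp

text \<open>Factor k of the alternating product carries the future letters 2 k and 2 k + 1. The
  block of the letter 2 k leads to a different factor, which becomes the partner of k.\<close>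

lemma partner_index:
  assumes \<pi>: "\<pi> \<in> pairings (4 * n)" and k: "k < 2 * n"
    and ok: "\<And>b. b \<in> \<pi> \<Longrightarrow> Min b div 2 \<noteq> Max b div 2"
  shows "\<exists>l<2 * n. l \<noteq> k \<and> (\<exists>b\<in>\<pi>. {k, l} = {Min b div 2, Max b div 2})"
proof -
  have p: "\<pi> \<in> pairs_on {..<4 * n}" using \<pi> by (simp add: pairings_eq)
  obtain b where b: "b \<in> \<pi>" "2 * k \<in> b" using pairs_on_cover[OF p, of "2 * k"] k by auto
  note bl = pairs_on_block[OF p b(1)]
  have lt: "Min b div 2 < 2 * n" "Max b div 2 < 2 * n" using bl(1,6,7) by auto
  have "2 * k = Min b \<or> 2 * k = Max b" using b(2) bl(4) by blast
  then show ?thesis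
  proof
    assume e: "2 * k = Min b"
    then have "k = Min b div 2" by (metis nonzero_mult_div_cancel_left zero_neq_numeral)
    then show ?thesis using lt ok[OF b(1)] b(1) by (intro exI[of _ "Max b div 2"]) auto
  next
    assume e: "2 * k = Max b"
    then have "k = Max b div 2" by (metis nonzero_mult_div_cancel_left zero_neq_numeral)
    then show ?thesis using lt ok[OF b(1)] b(1)
      by (intro exI[of _ "Min b div 2"] conjI bexI[of _ b]) auto
  qed
qed

context q_brownian
begin

lemma key_estimate_poly:
  fixes a b :: "nat \<Rightarrow> combo"
  assumes s: "0 \<le> s" and N: "N \<ge> 1" and h: "0 \<le> h"
    and t: "\<And>i. times_in {0..} (a i)" "\<And>i. times_in {0..} (b i)"
    and past: "\<And>i t. t \<in> {0..s} \<Longrightarrow> cov (a i) [(1, t)] = 0" "\<And>i t. t \<in> {0..s} \<Longrightarrow> cov (b i) [(1, t)] = 0"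
    and aa: "\<And>i j. i < N \<Longrightarrow> j < N \<Longrightarrow> cov (a i) (a j) = (if i = j then h else 0)"
    and bb: "\<And>i j. i < N \<Longrightarrow> j < N \<Longrightarrow> cov (b i) (b j) = (if i = j then h else 0)"
    and ab: "\<And>i j. i < N \<Longrightarrow> j < N \<Longrightarrow> cov (a i) (b j) = 0"
    and p: "letters p \<subseteq> {0..s}"
  shows "norm (\<Sum>i<N. val X (a i) o\<^sub>L ev X p o\<^sub>L val X (b i)) \<le> norm (ev X p) * (h * sqrt N * x1\<^sup>2)"
proof -
  let ?U = "ev X p" and ?U' = "ev X (padj p)"
  let ?Y = "\<Sum>i<N. val X (a i) o\<^sub>L ev X p o\<^sub>L val X (b i)"
  let ?Y' = "\<Sum>i<N. val X (b i) o\<^sub>L ev X (padj p) o\<^sub>L val X (a i)"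
  have UA: "?U \<in> A" "?U' \<in> A"
    using p letters_padj[of p] by (auto intro!: ev_in subA X_A)
  have Uadj: "is_adjoint ?U ?U'"
    by (rule is_adjoint_ev) (use p in \<open>auto intro!: X_adj\<close>)
  have adj: "is_adjoint (val X (a i) o\<^sub>L ?U o\<^sub>L val X (b i)) (val X (b i) o\<^sub>L ?U' o\<^sub>L val X (a i))" for i
    unfolding op_assoc[of "val X (b i)"]
    by (rule is_adjoint_compose[OF is_adjoint_compose[OF val_adj[OF t(1)] Uadj] val_adj[OF t(2)]])
  define z where "z \<tau> = (if \<tau> then b else a)" for \<tau> :: bool
  \<comment> \<open>Letter j belongs to factor j div 2. The factors alternate between b U' a and a U
    b, so the letters run b, a, a, b, b, a, a, b and so on, which the comparison of parities
    encodes. Nothing stands between two factors: in \<open>ps\<close> the past element after an odd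
    letter is 1.\<close>
  define y where "y c j = z (even (j div 2) = even j) (c ! (j div 2))" for c :: "nat list" and j :: nat
  define ps where "ps n = map (\<lambda>j. if odd j then [(1, [])] else if even (j div 2) then padj p else p) [0..<4 * n]" for n :: nat
  have tz: "times_in {0..} (z \<tau> i)" for \<tau> i using t by (simp add: z_def)
  have zz: "cov (z \<tau> i) (z \<tau>' j) = (if \<tau> = \<tau>' \<and> i = j then h else 0)" if "i < N" "j < N" for \<tau> \<tau>' i j
    using that aa bb ab cov_sym[of "b i" "a j"] by (auto simp: z_def)
  have normU': "norm ?U' = norm ?U" by (rule norm_adjoint[OF Uadj])
  have normid: "norm (id_blinfun :: 'h op) \<le> 1" by (simp add: norm_blinfun_bound)
  have word: "opow (?Y' o\<^sub>L ?Y) n =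
    (\<Sum>c\<in>index_words N (2 * n). oprod (map (\<lambda>j. val X (y c j) o\<^sub>L ev X (ps n ! j)) [0..<4 * n]))" for n
  proof -
    let ?F = "\<lambda>k i. if even k then val X (b i) o\<^sub>L ?U' o\<^sub>L val X (a i) else val X (a i) o\<^sub>L ?U o\<^sub>L val X (b i)"
    have "opow (?Y' o\<^sub>L ?Y) n = oprod (map (\<lambda>k. \<Sum>i<N. ?F k i) [0..<0 + 2 * n])"
      unfolding opow_alternating by (intro arg_cong[where f = oprod] map_cong) auto
    also have "\<dots> = (\<Sum>c\<in>index_words N (2 * n). oprod (map (\<lambda>k. ?F (0 + k) (c ! k)) [0..<2 * n]))"
      by (rule oprod_sum_expand)
    also have "\<dots> = (\<Sum>c\<in>index_words N (2 * n). oprod (map (\<lambda>j. val X (y c j) o\<^sub>L ev X (ps n ! j)) [0..<4 * n]))"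
    proof (intro sum.cong refl)
      fix c
      have "oprod (map (\<lambda>j. val X (y c j) o\<^sub>L ev X (ps n ! j)) [0..<2 * (2 * n)]) =
          oprod (map (\<lambda>k. ?F (0 + k) (c ! k)) [0..<2 * n])"
        unfolding oprod_pairs
        by (intro arg_cong[where f = oprod] map_cong refl) (auto simp: y_def z_def ps_def ev_Cons op_assoc)
      then show "oprod (map (\<lambda>k. ?F (0 + k) (c ! k)) [0..<2 * n]) =
          oprod (map (\<lambda>j. val X (y c j) o\<^sub>L ev X (ps n ! j)) [0..<4 * n])"
        by simp
    qed
    finally show ?thesis .
  qed
  have psnorm: "(\<Prod>p\<leftarrow>ps n. norm (ev X p)) \<le> norm ?U ^ (2 * n)" for n
  proof (induction n)
    case (Suc n)
    have "[0..<4 * Suc n] = [0..<4 * n] @ [4 * n, 4 * n + 1, 4 * n + 2, 4 * n + 3]"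
      by (simp add: numeral_eq_Suc)
    then have "ps (Suc n) = ps n @ [padj p, [(1, [])], p, [(1, [])]]"
      by (simp add: ps_def)
    then have "(\<Prod>p\<leftarrow>ps (Suc n). norm (ev X p)) = (\<Prod>p\<leftarrow>ps n. norm (ev X p)) *
        (norm ?U * norm (id_blinfun :: 'h op) * (norm ?U * norm (id_blinfun :: 'h op)))"
      by (simp add: normU' ev_Cons mult_ac)
    also have "\<dots> \<le> norm ?U ^ (2 * n) * (norm ?U * 1 * (norm ?U * 1))"
      using normid by (intro mult_mono Suc mult_nonneg_nonneg order_refl) auto
    finally show ?case by (simp add: power2_eq_square mult_ac)
  qed (simp add: ps_def)
  have count: "(\<Sum>c\<in>index_words N (2 * n). \<bar>\<Prod>d\<in>\<pi>. cov (y c (Min d)) (y c (Max d))\<bar>) \<le> h ^ (2 * n) * real N ^ n"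
    if \<pi>: "\<pi> \<in> pairings (4 * n)" for n \<pi>
  proof -
    have p': "\<pi> \<in> pairs_on {..<4 * n}" using \<pi> by (simp add: pairings_eq)
    have fin: "finite \<pi>" using pairs_on_finite[OF p'] by simp
    have card: "card \<pi> = 2 * n" using card_pairs_on[OF p'] by simp
    have lt: "Min d div 2 < 2 * n" "Max d div 2 < 2 * n" if "d \<in> \<pi>" for d
      using pairs_on_block(1,6,7)[OF p' that] by auto
    have covy: "cov (y c (Min d)) (y c (Max d)) =
        (if (even (Min d div 2) = even (Min d)) = (even (Max d div 2) = even (Max d)) \<and> c ! (Min d div 2) = c ! (Max d div 2) then h else 0)"
      if c: "c \<in> index_words N (2 * n)" and d: "d \<in> \<pi>" for c d
    proof -
      have "c ! (Min d div 2) \<in> set c" "c ! (Max d div 2) \<in> set c"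
        using lt[OF d] c by (auto simp: index_words_def)
      then have "c ! (Min d div 2) < N" "c ! (Max d div 2) < N"
        using c by (auto simp: index_words_def)
      then show ?thesis unfolding y_def by (rule zz)
    qed
    show ?thesis
    proof (cases "\<forall>d\<in>\<pi>. (even (Min d div 2) = even (Min d)) = (even (Max d div 2) = even (Max d))")
      case False
      have "(\<Prod>d\<in>\<pi>. cov (y c (Min d)) (y c (Max d))) = 0" if "c \<in> index_words N (2 * n)" for c
        using False covy[OF that] fin by (intro prod_zero) auto
      then show ?thesis using h by simp
    next
      case True
      let ?G = "{c \<in> index_words N (2 * n). \<forall>d\<in>\<pi>. c ! (Min d div 2) = c ! (Max d div 2)}"
      \<comment> \<open>The two letters of one factor are of different kinds, one from a and one
        from b, so a block whose letters are correlated cannot join them. Hence every factor has a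
        partner, which halves the number of free indices.\<close>
      have ne: "Min d div 2 \<noteq> Max d div 2" if "d \<in> \<pi>" for d
      proof
        assume e: "Min d div 2 = Max d div 2"
        have "(even (Min d div 2) = even (Min d)) = (even (Max d div 2) = even (Max d))"
          using True that by blast
        then have "even (Min d) = even (Max d)" unfolding e by blast
        moreover have "Min d < Max d" using pairs_on_block(5)[OF p' that] .
        ultimately show False using e by presburger
      qed
      have "(\<Sum>c\<in>index_words N (2 * n). \<bar>\<Prod>d\<in>\<pi>. cov (y c (Min d)) (y c (Max d))\<bar>) =
          (\<Sum>c\<in>?G. \<bar>\<Prod>d\<in>\<pi>. cov (y c (Min d)) (y c (Max d))\<bar>)"
      proof (rule sum.mono_neutral_right)
        show "\<forall>c\<in>index_words N (2 * n) - ?G. \<bar>\<Prod>d\<in>\<pi>. cov (y c (Min d)) (y c (Max d))\<bar> = 0"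
        proof
          fix c assume c: "c \<in> index_words N (2 * n) - ?G"
          then obtain d where d: "d \<in> \<pi>" "c ! (Min d div 2) \<noteq> c ! (Max d div 2)" by auto
          then have "cov (y c (Min d)) (y c (Max d)) = 0" using covy[of c d] c by simp
          then have "(\<Prod>d\<in>\<pi>. cov (y c (Min d)) (y c (Max d))) = 0" using d(1) fin by (intro prod_zero) auto
          then show "\<bar>\<Prod>d\<in>\<pi>. cov (y c (Min d)) (y c (Max d))\<bar> = 0" by simp
        qed
      qed (auto simp: finite_index_words)
      also have "\<dots> = (\<Sum>c\<in>?G. h ^ (2 * n))"
      proof (intro sum.cong refl)
        fix c assume c: "c \<in> ?G"
        have "(\<Prod>d\<in>\<pi>. cov (y c (Min d)) (y c (Max d))) = (\<Prod>d\<in>\<pi>. h)"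
          using c True covy by (intro prod.cong) auto
        then show "\<bar>\<Prod>d\<in>\<pi>. cov (y c (Min d)) (y c (Max d))\<bar> = h ^ (2 * n)"
          using h card by simp
      qed
      also have "\<dots> = real (card ?G) * h ^ (2 * n)" by simp
      also have "\<dots> \<le> real (N ^ n) * h ^ (2 * n)"
      proof (intro mult_right_mono of_nat_mono)
        show "card ?G \<le> N ^ n"
        proof (rule card_constrained_words[OF N])
          fix k assume "k < 2 * n"
          then obtain l d where l: "l < 2 * n" "l \<noteq> k" "d \<in> \<pi>" "{k, l} = {Min d div 2, Max d div 2}"
            using partner_index[OF \<pi> _ ne] by metis
          then have "c ! k = c ! l" if "c \<in> ?G" for c
            using that by (auto simp: doubleton_eq_iff)
          then show "\<exists>l<2 * n. l \<noteq> k \<and> (\<forall>c\<in>?G. c ! k = c ! l)" using l by blast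
        qed auto
      qed (use h in simp)
      finally show ?thesis by (simp add: mult.commute)
    qed
  qed
  let ?c = "norm ?U * (h * sqrt N * x1\<^sup>2)"
  show ?thesis
  \<comment> \<open>The constant 4 is the 2 of \<open>phi_bound\<close>, contained in
    \<open>mixed_moment_bound\<close>, times the 2 of \<open>pairings_mass\<close>.\<close>
  proof (rule norm_le_of_moments[where Z' = ?Y' and K = 4])
    show "?Y \<in> A" "?Y' \<in> A" using UA t by (auto intro!: A_sum A_compose val_A)
    show "is_adjoint ?Y ?Y'" by (rule is_adjoint_sum) (rule adj)
    show "0 \<le> ?c" using h by simp
    fix n
    let ?W = "\<lambda>c. oprod (map (\<lambda>j. val X (y c j) o\<^sub>L ev X (ps n ! j)) [0..<4 * n])"
    have psl: "letters r \<subseteq> {0..s}" if "r \<in> set (ps n)" for r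
      using that p letters_padj[of p] by (auto simp: ps_def split: if_splits)
    have evA: "ev X (ps n ! j) \<in> A" if "j < 4 * n" for j
    proof -
      have "ps n ! j \<in> set (ps n)" using that by (simp add: ps_def)
      from psl[OF this] show ?thesis by (auto intro!: ev_in subA X_A)
    qed
    have WA: "?W c \<in> A" for c
      using evA tz by (auto intro!: oprod_in subA A_compose val_A simp: y_def)
    have one: "cmod (\<phi> (?W c)) \<le>
      (\<Sum>\<pi>\<in>pairings (4 * n). q ^ crossings \<pi> * \<bar>\<Prod>d\<in>\<pi>. cov (y c (Min d)) (y c (Max d))\<bar>) * (2 * norm ?U ^ (2 * n))" for c
    proof -
      have len: "length (ps n) = 4 * n" by (simp add: ps_def)
      have "cmod (\<phi> (?W c)) \<le>
        (\<Sum>\<pi>\<in>pairings (4 * n). q ^ crossings \<pi> * \<bar>\<Prod>d\<in>\<pi>. cov (y c (Min d)) (y c (Max d))\<bar>) * (2 * (\<Prod>p\<leftarrow>ps n. norm (ev X p)))"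
      proof (rule mixed_moment_bound[of "y c" s "ps n", unfolded len])
        show "times_in {0..} (y c j)" for j unfolding y_def by (rule tz)
        show "cov (y c j) [(1, t)] = 0" if "t \<in> {0..s}" for j t
          using past that by (simp add: y_def z_def)
      qed (use s psl in auto)
      also have "\<dots> \<le> (\<Sum>\<pi>\<in>pairings (4 * n). q ^ crossings \<pi> * \<bar>\<Prod>d\<in>\<pi>. cov (y c (Min d)) (y c (Max d))\<bar>) * (2 * norm ?U ^ (2 * n))"
        using psnorm q0 by (intro mult_left_mono sum_nonneg) auto
      finally show ?thesis .
    qed
    have "Re (\<phi> (opow (?Y' o\<^sub>L ?Y) n)) \<le> cmod (\<phi> (opow (?Y' o\<^sub>L ?Y) n))"
      by (rule complex_Re_le_cmod)
    also have "\<dots> \<le> (\<Sum>c\<in>index_words N (2 * n). cmod (\<phi> (?W c)))"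
      unfolding word by (subst phi_sum[OF WA]) (rule norm_sum)
    also have "\<dots> \<le> (\<Sum>c\<in>index_words N (2 * n).
      (\<Sum>\<pi>\<in>pairings (4 * n). q ^ crossings \<pi> * \<bar>\<Prod>d\<in>\<pi>. cov (y c (Min d)) (y c (Max d))\<bar>) * (2 * norm ?U ^ (2 * n)))"
      by (rule sum_mono) (rule one)
    also have "\<dots> = (\<Sum>\<pi>\<in>pairings (4 * n). q ^ crossings \<pi> *
      (\<Sum>c\<in>index_words N (2 * n). \<bar>\<Prod>d\<in>\<pi>. cov (y c (Min d)) (y c (Max d))\<bar>)) * (2 * norm ?U ^ (2 * n))"
      unfolding sum_distrib_right[symmetric] by (subst sum.swap) (simp only: sum_distrib_left)
    also have "\<dots> \<le> (\<Sum>\<pi>\<in>pairings (4 * n). q ^ crossings \<pi> * (h ^ (2 * n) * real N ^ n)) * (2 * norm ?U ^ (2 * n))"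
      using count q0 by (intro mult_right_mono sum_mono mult_left_mono) auto
    also have "\<dots> = (\<Sum>\<pi>\<in>pairings (2 * (2 * n)). q ^ crossings \<pi>) * ((h ^ (2 * n) * real N ^ n) * (2 * norm ?U ^ (2 * n)))"
      by (simp add: sum_distrib_right mult.assoc)
    also have "\<dots> \<le> (2 * (x1\<^sup>2) ^ (2 * n)) * ((h ^ (2 * n) * real N ^ n) * (2 * norm ?U ^ (2 * n)))"
      using h by (intro mult_right_mono pairings_mass) auto
    also have "\<dots> = 4 * (?c\<^sup>2) ^ n"
    proof -
      have "?c\<^sup>2 = (norm ?U)\<^sup>2 * (h\<^sup>2 * real N * (x1\<^sup>2)\<^sup>2)"
        by (simp add: power_mult_distrib)
      then have "(?c\<^sup>2) ^ n = norm ?U ^ (2 * n) * (h ^ (2 * n) * real N ^ n * (x1\<^sup>2) ^ (2 * n))"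
        by (simp only: power_mult_distrib power_mult[of _ 2 n])
      then show ?thesis by simp
    qed
    finally show "Re (\<phi> (opow (?Y' o\<^sub>L ?Y) n)) \<le> 4 * (?c\<^sup>2) ^ n" .
  qed
qed

section \<open>From polynomials to the closed algebra of the past\<close>

lemma poly_subalgebra: "unital_subalgebra {ev X p |p. letters p \<subseteq> {0..s}}"
  unfolding unital_subalgebra_def
proof (intro conjI ballI allI)
  let ?B = "{ev X p |p. letters p \<subseteq> {0..s}}"
  have XA: "X ` letters p \<subseteq> A" if "letters p \<subseteq> {0..s}" for p using that by (auto intro!: X_A)
  show "?B \<subseteq> bounded_ops"
    using XA by (auto intro!: A_bounded_ops ev_in subA)
  have "id_blinfun = ev X [(1, [])]" by (simp add: ev_Cons)
  then show "id_blinfun \<in> ?B" by fastforce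
  fix U V assume "U \<in> ?B" "V \<in> ?B"
  then obtain p r where pr: "U = ev X p" "V = ev X r" "letters p \<subseteq> {0..s}" "letters r \<subseteq> {0..s}" by auto
  have "U + V = ev X (p @ r)" by (simp add: pr ev_append)
  moreover have "letters (p @ r) \<subseteq> {0..s}" using pr by simp
  ultimately show "U + V \<in> ?B" by blast
  have "U o\<^sub>L V = ev X (pmul p r)" by (simp add: pr ev_pmul[OF subA XA])
  moreover have "letters (pmul p r) \<subseteq> {0..s}" using pr letters_pmul[of p r] by blast
  ultimately show "U o\<^sub>L V \<in> ?B" by blast
next
  fix c U assume "U \<in> {ev X p |p. letters p \<subseteq> {0..s}}"
  then obtain p where p: "U = ev X p" "letters p \<subseteq> {0..s}" by auto
  have "op_scale c (ev X p) = ev X (map (\<lambda>x. (c * fst x, snd x)) p)"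
    by (induction p) (simp_all add: ev_Cons op_scale_add_right op_scale_op_scale)
  moreover have "letters (map (\<lambda>x. (c * fst x, snd x)) p) = letters p" by (simp add: letters_def)
  ultimately show "op_scale c U \<in> {ev X p |p. letters p \<subseteq> {0..s}}" using p by auto
qed

lemma filtration_subset: "filtration X s \<subseteq> closure {ev X p |p. letters p \<subseteq> {0..s}}"
  unfolding filtration_def
proof (intro closure_mono hull_minimal poly_subalgebra image_subsetI)
  fix t assume t: "t \<in> {0..s}"
  have "X t = ev X [(1, [t])]" by (simp add: ev_Cons)
  then show "X t \<in> {ev X p |p. letters p \<subseteq> {0..s}}" using t by fastforce
qed

text \<open>Both sides are continuous in U, and every element of the past algebra is a norm limit of
  polynomials.\<close>

lemma key_estimate:
  fixes a b :: "nat \<Rightarrow> combo"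
  assumes s: "0 \<le> s" and N: "N \<ge> 1" and h: "0 \<le> h"
    and t: "\<And>i. times_in {0..} (a i)" "\<And>i. times_in {0..} (b i)"
    and past: "\<And>i t. t \<in> {0..s} \<Longrightarrow> cov (a i) [(1, t)] = 0" "\<And>i t. t \<in> {0..s} \<Longrightarrow> cov (b i) [(1, t)] = 0"
    and aa: "\<And>i j. i < N \<Longrightarrow> j < N \<Longrightarrow> cov (a i) (a j) = (if i = j then h else 0)"
    and bb: "\<And>i j. i < N \<Longrightarrow> j < N \<Longrightarrow> cov (b i) (b j) = (if i = j then h else 0)"
    and ab: "\<And>i j. i < N \<Longrightarrow> j < N \<Longrightarrow> cov (a i) (b j) = 0"
    and U: "U \<in> filtration X s"
  shows "norm (\<Sum>i<N. val X (a i) o\<^sub>L U o\<^sub>L val X (b i)) \<le> norm U * (h * sqrt N * x1\<^sup>2)"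
proof -
  let ?C = "{U. norm (\<Sum>i<N. val X (a i) o\<^sub>L U o\<^sub>L val X (b i)) \<le> norm U * (h * sqrt N * x1\<^sup>2)}"
  have "closed ?C"
    by (intro closed_Collect_le continuous_intros bounded_bilinear.continuous_on[OF bounded_bilinear_blinfun_compose])
  moreover have "{ev X p |p. letters p \<subseteq> {0..s}} \<subseteq> ?C"
    using key_estimate_poly[OF s N h t past aa bb ab] by blast
  ultimately have "closure {ev X p |p. letters p \<subseteq> {0..s}} \<subseteq> ?C" by (rule closure_minimal[rotated])
  then show ?thesis using U filtration_subset by blast
qed

end

section \<open>The projective tensor product\<close>

definition rep_norm :: "('h::complex_hilbert op \<times> 'h op) list \<Rightarrow> real" where
  "rep_norm ps = (\<Sum>(U, V)\<leftarrow>ps. norm U * norm V)"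

definition rep_sharp :: "('h::complex_hilbert op \<times> 'h op) list \<Rightarrow> 'h op \<Rightarrow> 'h op" where
  "rep_sharp ps Y = (\<Sum>(U, V)\<leftarrow>ps. U o\<^sub>L Y o\<^sub>L V)"

lemma rep_simps [simp]:
  "rep_norm [] = 0" "rep_norm ((U, V) # ps) = norm U * norm V + rep_norm ps"
  "rep_norm (ps @ rs) = rep_norm ps + rep_norm rs"
  "rep_sharp [] Y = 0" "rep_sharp ((U, V) # ps) Y = (U o\<^sub>L Y o\<^sub>L V) + rep_sharp ps Y"
  "rep_sharp (ps @ rs) Y = rep_sharp ps Y + rep_sharp rs Y"
  by (simp_all add: rep_norm_def rep_sharp_def)

lemma rep_norm_nonneg: "0 \<le> rep_norm ps"
  by (induction ps) auto

lemma elem_tensor_scale: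
  assumes "U \<in> bounded_ops" "V \<in> bounded_ops"
  shows "elem_tensor (op_scale a U) V = scale_tensor a (elem_tensor U V)"
proof (rule ext)
  fix \<beta>
  show "elem_tensor (op_scale a U) V \<beta> = scale_tensor a (elem_tensor U V) \<beta>"
  proof (cases "bilinear_form \<beta>")
    case True
    then have "\<beta> (op_scale a U) V = a * \<beta> U V" using assms unfolding bilinear_form_def by blast
    then show ?thesis using True by (simp add: elem_tensor_def scale_tensor_def)
  qed (simp add: elem_tensor_def scale_tensor_def)
qed

lemma scale_tensor_add: "scale_tensor a (\<tau> + \<sigma>) = scale_tensor a \<tau> + scale_tensor a \<sigma>"
  by (simp add: scale_tensor_def fun_eq_iff algebra_simps)

lemma scale_tensor_zero: "scale_tensor a 0 = 0"
  by (simp add: scale_tensor_def fun_eq_iff)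

lemma scale_tensor_minus_one: "scale_tensor (-1) \<tau> = - \<tau>"
  by (simp add: scale_tensor_def fun_eq_iff)

lemma scale_tensor_diff: "scale_tensor a (\<tau> - \<sigma>) = scale_tensor a \<tau> - scale_tensor a \<sigma>"
  by (simp add: scale_tensor_def fun_eq_iff algebra_simps)

lemma represents_Nil: "represents S [] 0"
  by (simp add: represents_def)

lemma represents_append: "represents S ps \<tau> \<Longrightarrow> represents S rs \<sigma> \<Longrightarrow> represents S (ps @ rs) (\<tau> + \<sigma>)"
  by (simp add: represents_def)

lemma represents_mono: "S \<subseteq> S' \<Longrightarrow> represents S ps \<tau> \<Longrightarrow> represents S' ps \<tau>"
  by (auto simp: represents_def)

lemma sum_list_fun_apply: "(\<Sum>(U, V)\<leftarrow>ps. elem_tensor U V) \<beta> = (\<Sum>(U, V)\<leftarrow>ps. elem_tensor U V \<beta>)"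
  by (induction ps) (simp_all add: case_prod_beta)

lemma bilinear_form_sandwich:
  fixes Y :: "'h::complex_hilbert op"
  assumes "Y \<in> bounded_ops"
  shows "bilinear_form (\<lambda>U V. cinner x (blinfun_apply (U o\<^sub>L Y o\<^sub>L V) y))"
  using assms unfolding bilinear_form_def
  by (auto simp: bounded_ops_def cinner_add_right cinner_scaleC_right plus_blinfun.rep_eq
      blinfun.add_right)

text \<open>Tensors are functionals on bilinear forms, and the matrix coefficients of U Y V are
  bilinear forms in (U, V). Two representations of a tensor thus give operators with the same matrix
  coefficients.\<close>

lemma rep_sharp_unique:
  fixes Y :: "'h::complex_hilbert op"
  assumes "represents S ps \<tau>" "represents S' rs \<tau>" "Y \<in> bounded_ops"
  shows "rep_sharp ps Y = rep_sharp rs Y"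
proof (rule blinfun_eqI, rule cinner_eqI)
  fix y x
  let ?\<beta> = "\<lambda>(U :: 'h op) (V :: 'h op). cinner x (blinfun_apply (U o\<^sub>L Y o\<^sub>L V) y)"
  have b: "bilinear_form ?\<beta>" by (rule bilinear_form_sandwich[OF assms(3)])
  have *: "cinner x (blinfun_apply (rep_sharp ps Y) y) = (\<Sum>(U, V)\<leftarrow>ps. elem_tensor U V) ?\<beta>" for ps
  proof -
    have "elem_tensor U V ?\<beta> = ?\<beta> U V" for U V
      using b unfolding elem_tensor_def by (rule if_P)
    then show ?thesis
      unfolding sum_list_fun_apply
      by (induction ps) (auto simp: zero_blinfun.rep_eq cinner_zero_right plus_blinfun.rep_eq cinner_add_right)
  qed
  show "cinner x (blinfun_apply (rep_sharp ps Y) y) = cinner x (blinfun_apply (rep_sharp rs Y) y)"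
    unfolding * using assms(1,2) by (simp add: represents_def)
qed

lemma alg_sharp_eq:
  assumes "S \<subseteq> bounded_ops" "represents S ps \<tau>" "Y \<in> bounded_ops"
  shows "alg_sharp \<tau> Y = rep_sharp ps Y"
  unfolding alg_sharp_def
proof (rule the_equality)
  show "\<exists>ps'. represents bounded_ops ps' \<tau> \<and> rep_sharp ps Y = (\<Sum>(U, V)\<leftarrow>ps'. U o\<^sub>L Y o\<^sub>L V)"
    using represents_mono[OF assms(1,2)] by (auto simp: rep_sharp_def)
  fix W assume "\<exists>ps'. represents bounded_ops ps' \<tau> \<and> W = (\<Sum>(U, V)\<leftarrow>ps'. U o\<^sub>L Y o\<^sub>L V)"
  then show "W = rep_sharp ps Y"
    using rep_sharp_unique[OF _ assms(2,3)] by (auto simp: rep_sharp_def)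
qed

abbreviation tensor_cauchy :: "'h::complex_hilbert op set \<Rightarrow> (nat \<Rightarrow> 'h tensor) set" where
  "tensor_cauchy S \<equiv> cauchy_seqs (alg_tensor S) (tensor_norm S)"

context
  fixes S :: "'h::complex_hilbert op set"
  assumes sub: "unital_subalgebra S"
begin

lemma sub_bounded: "S \<subseteq> bounded_ops"
  using subalg_bounded_ops[OF sub] by blast

lemma represents_scale:
  assumes "represents S ps \<tau>"
  shows "represents S (map (\<lambda>(U, V). (op_scale a U, V)) ps) (scale_tensor a \<tau>)"
    "rep_norm (map (\<lambda>(U, V). (op_scale a U, V)) ps) \<le> cmod a * rep_norm ps"
    "rep_sharp (map (\<lambda>(U, V). (op_scale a U, V)) ps) Y = op_scale a (rep_sharp ps Y)"
proof -
  have ps: "set ps \<subseteq> S \<times> S" and \<tau>: "\<tau> = (\<Sum>(U, V)\<leftarrow>ps. elem_tensor U V)"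
    using assms by (auto simp: represents_def)
  have "(\<Sum>(U, V)\<leftarrow>map (\<lambda>(U, V). (op_scale a U, V)) ps. elem_tensor U V) = scale_tensor a (\<Sum>(U, V)\<leftarrow>ps. elem_tensor U V)"
    using ps
  proof (induction ps)
    case (Cons p ps)
    obtain U V where p: "p = (U, V)" by (cases p)
    have UV: "U \<in> bounded_ops" "V \<in> bounded_ops" using p Cons.prems sub_bounded by auto
    have "(\<Sum>(U, V)\<leftarrow>map (\<lambda>(U, V). (op_scale a U, V)) ps. elem_tensor U V) = scale_tensor a (\<Sum>(U, V)\<leftarrow>ps. elem_tensor U V)"
      using Cons by simp
    then show ?case
      unfolding p by (simp only: list.map sum_list.Cons prod.case elem_tensor_scale[OF UV] scale_tensor_add)
  qed (simp add: scale_tensor_zero)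
  then show "represents S (map (\<lambda>(U, V). (op_scale a U, V)) ps) (scale_tensor a \<tau>)"
    using ps \<tau> subalg_op_scale[OF sub] by (auto simp: represents_def)
  show "rep_norm (map (\<lambda>(U, V). (op_scale a U, V)) ps) \<le> cmod a * rep_norm ps"
  proof (induction ps)
    case (Cons p ps)
    obtain U V where p: "p = (U, V)" by (cases p)
    have "norm (op_scale a U) * norm V \<le> (cmod a * norm U) * norm V"
      by (intro mult_right_mono norm_op_scale) simp
    then show ?case using Cons by (simp add: p algebra_simps)
  qed simp
  show "rep_sharp (map (\<lambda>(U, V). (op_scale a U, V)) ps) Y = op_scale a (rep_sharp ps Y)"
    by (induction ps) (auto simp: op_scale_add_right op_scale_compose_left)
qed

lemma alg_tensor_rep: "\<tau> \<in> alg_tensor S \<Longrightarrow> \<exists>ps. represents S ps \<tau>"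
  by (simp add: alg_tensor_def)

lemma alg_tensorI: "represents S ps \<tau> \<Longrightarrow> \<tau> \<in> alg_tensor S"
  by (auto simp: alg_tensor_def)

lemma alg_tensor_closed:
  "0 \<in> alg_tensor S"
  "\<tau> \<in> alg_tensor S \<Longrightarrow> \<sigma> \<in> alg_tensor S \<Longrightarrow> \<tau> + \<sigma> \<in> alg_tensor S"
  "\<tau> \<in> alg_tensor S \<Longrightarrow> scale_tensor a \<tau> \<in> alg_tensor S"
  by (meson alg_tensorI alg_tensor_rep represents_Nil represents_append represents_scale(1))+

lemma alg_tensor_diff: "\<tau> \<in> alg_tensor S \<Longrightarrow> \<sigma> \<in> alg_tensor S \<Longrightarrow> \<tau> - \<sigma> \<in> alg_tensor S"
  using alg_tensor_closed(2)[of \<tau> "- \<sigma>"] alg_tensor_closed(3)[of \<sigma> "-1"] by (simp add: scale_tensor_minus_one)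

lemma tensor_norm_eq: "tensor_norm S \<tau> = Inf (rep_norm ` {ps. represents S ps \<tau>})"
  by (simp add: tensor_norm_def rep_norm_def)

lemma bdd_rep_norm: "bdd_below (rep_norm ` A)"
  by (rule bdd_belowI[of _ 0]) (auto simp: rep_norm_nonneg)

lemma tensor_norm_le: "represents S ps \<tau> \<Longrightarrow> tensor_norm S \<tau> \<le> rep_norm ps"
  unfolding tensor_norm_eq by (rule cInf_lower[OF _ bdd_rep_norm]) auto

lemma tensor_norm_greatest:
  "\<tau> \<in> alg_tensor S \<Longrightarrow> (\<And>ps. represents S ps \<tau> \<Longrightarrow> r \<le> rep_norm ps) \<Longrightarrow> r \<le> tensor_norm S \<tau>"
  unfolding tensor_norm_eq by (rule cInf_greatest) (auto dest: alg_tensor_rep)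

lemma tensor_norm_approx:
  assumes "\<tau> \<in> alg_tensor S" "0 < e"
  shows "\<exists>ps. represents S ps \<tau> \<and> rep_norm ps < tensor_norm S \<tau> + e"
proof (rule ccontr)
  assume "\<not> ?thesis"
  then have "tensor_norm S \<tau> + e \<le> tensor_norm S \<tau>"
    by (intro tensor_norm_greatest assms(1)) (meson not_le)
  then show False using assms(2) by simp
qed

lemma tensor_norm_nonneg: "\<tau> \<in> alg_tensor S \<Longrightarrow> 0 \<le> tensor_norm S \<tau>"
  by (rule tensor_norm_greatest) (auto simp: rep_norm_nonneg)

lemma tensor_norm_zero: "tensor_norm S 0 = 0"
  using tensor_norm_le[OF represents_Nil] tensor_norm_nonneg[OF alg_tensor_closed(1)] by simp

lemma tensor_norm_triangle:
  assumes "\<tau> \<in> alg_tensor S" "\<sigma> \<in> alg_tensor S"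
  shows "tensor_norm S (\<tau> + \<sigma>) \<le> tensor_norm S \<tau> + tensor_norm S \<sigma>"
proof (rule field_le_epsilon)
  fix e :: real assume e: "0 < e"
  obtain ps where ps: "represents S ps \<tau>" "rep_norm ps < tensor_norm S \<tau> + e / 2"
    using tensor_norm_approx[OF assms(1), of "e / 2"] e by auto
  obtain rs where rs: "represents S rs \<sigma>" "rep_norm rs < tensor_norm S \<sigma> + e / 2"
    using tensor_norm_approx[OF assms(2), of "e / 2"] e by auto
  show "tensor_norm S (\<tau> + \<sigma>) \<le> tensor_norm S \<tau> + tensor_norm S \<sigma> + e"
    using tensor_norm_le[OF represents_append[OF ps(1) rs(1)]] ps(2) rs(2) by simp
qed

lemma tensor_norm_scale:
  assumes "\<tau> \<in> alg_tensor S"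
  shows "tensor_norm S (scale_tensor a \<tau>) \<le> cmod a * tensor_norm S \<tau>"
proof (cases "a = 0")
  case True
  then have "scale_tensor a \<tau> = 0" by (simp add: scale_tensor_def fun_eq_iff)
  then show ?thesis using True by (simp add: tensor_norm_zero)
next
  case False
  have "tensor_norm S (scale_tensor a \<tau>) / cmod a \<le> tensor_norm S \<tau>"
  proof (rule tensor_norm_greatest[OF assms])
    fix ps assume "represents S ps \<tau>"
    from tensor_norm_le[OF represents_scale(1)[OF this]] represents_scale(2)[OF this]
    have "tensor_norm S (scale_tensor a \<tau>) \<le> cmod a * rep_norm ps" by (rule order_trans)
    then show "tensor_norm S (scale_tensor a \<tau>) / cmod a \<le> rep_norm ps"
      using False by (simp add: divide_le_eq mult.commute)
  qed
  then show ?thesis using False by (simp add: divide_le_eq mult.commute)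
qed

lemma tensor_norm_minus_commute:
  assumes "\<tau> \<in> alg_tensor S" "\<sigma> \<in> alg_tensor S"
  shows "tensor_norm S (\<tau> - \<sigma>) = tensor_norm S (\<sigma> - \<tau>)"
proof -
  have "tensor_norm S (x - y) \<le> tensor_norm S (y - x)" if "x \<in> alg_tensor S" "y \<in> alg_tensor S" for x y
    using tensor_norm_scale[OF alg_tensor_diff[OF that(2,1)], of "-1"] by (simp add: scale_tensor_minus_one)
  then show ?thesis using assms by (meson antisym)
qed

lemma tensor_norm_triangle_diff:
  assumes "\<tau> \<in> alg_tensor S" "\<sigma> \<in> alg_tensor S" "\<rho> \<in> alg_tensor S"
  shows "tensor_norm S (\<tau> - \<sigma>) \<le> tensor_norm S (\<tau> - \<rho>) + tensor_norm S (\<rho> - \<sigma>)"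
  using tensor_norm_triangle[of "\<tau> - \<rho>" "\<rho> - \<sigma>"] assms by (simp add: alg_tensor_diff)

lemma tensor_norm_abs_diff:
  assumes "\<tau> \<in> alg_tensor S" "\<sigma> \<in> alg_tensor S"
  shows "\<bar>tensor_norm S \<tau> - tensor_norm S \<sigma>\<bar> \<le> tensor_norm S (\<tau> - \<sigma>)"
  using tensor_norm_triangle[of "\<tau> - \<sigma>" \<sigma>] tensor_norm_triangle[of "\<sigma> - \<tau>" \<tau>] assms
    tensor_norm_minus_commute[OF assms] by (simp add: alg_tensor_diff)

lemma alg_sharp_rep: "represents S ps \<tau> \<Longrightarrow> Y \<in> bounded_ops \<Longrightarrow> alg_sharp \<tau> Y = rep_sharp ps Y"
  by (rule alg_sharp_eq[OF sub_bounded])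

lemma alg_sharp_add:
  assumes "\<tau> \<in> alg_tensor S" "\<sigma> \<in> alg_tensor S" "Y \<in> bounded_ops"
  shows "alg_sharp (\<tau> + \<sigma>) Y = alg_sharp \<tau> Y + alg_sharp \<sigma> Y"
proof -
  obtain ps rs where r: "represents S ps \<tau>" "represents S rs \<sigma>" using assms alg_tensor_rep by blast
  show ?thesis
    using alg_sharp_rep[OF r(1) assms(3)] alg_sharp_rep[OF r(2) assms(3)]
      alg_sharp_rep[OF represents_append[OF r] assms(3)] by simp
qed

lemma alg_sharp_scale:
  assumes "\<tau> \<in> alg_tensor S" "Y \<in> bounded_ops"
  shows "alg_sharp (scale_tensor a \<tau>) Y = op_scale a (alg_sharp \<tau> Y)"
proof -
  obtain ps where r: "represents S ps \<tau>" using assms alg_tensor_rep by blast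
  show ?thesis
    using alg_sharp_rep[OF r assms(2)] alg_sharp_rep[OF represents_scale(1)[OF r] assms(2)]
      represents_scale(3)[OF r] by simp
qed

lemma alg_sharp_diff:
  assumes "\<tau> \<in> alg_tensor S" "\<sigma> \<in> alg_tensor S" "Y \<in> bounded_ops"
  shows "alg_sharp (\<tau> - \<sigma>) Y = alg_sharp \<tau> Y - alg_sharp \<sigma> Y"
  using alg_sharp_add[of "\<tau> - \<sigma>" \<sigma> Y] assms by (simp add: alg_tensor_diff)

text \<open>Near-optimal representations turn a bound for elementary tensors into one for all
  tensors. The sum over k stays inside the norm throughout, since the key estimate controls it only
  as a whole.\<close>

lemma alg_sharp_sum_bound:
  assumes \<tau>: "\<tau> \<in> alg_tensor S" and Y: "\<And>k. k \<in> I \<Longrightarrow> Y k \<in> bounded_ops" and B: "0 \<le> B"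
    and b: "\<And>U V. U \<in> S \<Longrightarrow> V \<in> S \<Longrightarrow> norm (\<Sum>k\<in>I. (U o\<^sub>L Y k o\<^sub>L V) o\<^sub>L Z k) \<le> B * (norm U * norm V)"
  shows "norm (\<Sum>k\<in>I. alg_sharp \<tau> (Y k) o\<^sub>L Z k) \<le> B * tensor_norm S \<tau>"
proof (rule field_le_epsilon)
  fix e :: real assume e: "0 < e"
  \<comment> \<open>Dividing by B + 1 instead of B also covers B = 0.\<close>
  obtain ps where ps: "represents S ps \<tau>" "rep_norm ps < tensor_norm S \<tau> + e / (B + 1)"
    using tensor_norm_approx[OF \<tau>, of "e / (B + 1)"] e B by auto
  have "norm (\<Sum>k\<in>I. rep_sharp ps (Y k) o\<^sub>L Z k) \<le> B * rep_norm ps" if "set ps \<subseteq> S \<times> S" for ps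
    using that
  proof (induction ps)
    case (Cons p ps)
    obtain U V where p: "p = (U, V)" by (cases p)
    have "(\<Sum>k\<in>I. rep_sharp (p # ps) (Y k) o\<^sub>L Z k) =
        (\<Sum>k\<in>I. (U o\<^sub>L Y k o\<^sub>L V) o\<^sub>L Z k) + (\<Sum>k\<in>I. rep_sharp ps (Y k) o\<^sub>L Z k)"
      by (simp add: p compose_add_left sum.distrib)
    also have "norm \<dots> \<le> B * (norm U * norm V) + B * rep_norm ps"
      using Cons p b by (intro norm_triangle_le add_mono) auto
    finally show ?case by (simp add: p algebra_simps)
  qed (simp add: compose_zero_left)
  then have "norm (\<Sum>k\<in>I. rep_sharp ps (Y k) o\<^sub>L Z k) \<le> B * rep_norm ps"
    using ps(1) by (simp add: represents_def)
  also have "(\<Sum>k\<in>I. rep_sharp ps (Y k) o\<^sub>L Z k) = (\<Sum>k\<in>I. alg_sharp \<tau> (Y k) o\<^sub>L Z k)"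
    by (intro sum.cong refl) (simp add: alg_sharp_rep[OF ps(1) Y])
  also have "B * rep_norm ps \<le> B * (tensor_norm S \<tau> + e / (B + 1))"
    using ps(2) B by (intro mult_left_mono) auto
  also have "\<dots> = B * tensor_norm S \<tau> + e * (B / (B + 1))"
    by (simp add: algebra_simps)
  also have "e * (B / (B + 1)) \<le> e * 1"
    using e B by (intro mult_left_mono) auto
  finally show "norm (\<Sum>k\<in>I. alg_sharp \<tau> (Y k) o\<^sub>L Z k) \<le> B * tensor_norm S \<tau> + e" by simp
qed

lemma norm_alg_sharp_le:
  assumes "\<tau> \<in> alg_tensor S" "Y \<in> bounded_ops"
  shows "norm (alg_sharp \<tau> Y) \<le> norm Y * tensor_norm S \<tau>"
proof -
  have "norm (U o\<^sub>L Y o\<^sub>L V) \<le> norm Y * (norm U * norm V)" for U V :: "'h op"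
  proof -
    have "norm (U o\<^sub>L Y o\<^sub>L V) \<le> norm (U o\<^sub>L Y) * norm V" by (rule norm_blinfun_compose)
    also have "\<dots> \<le> (norm U * norm Y) * norm V" by (intro mult_right_mono norm_blinfun_compose) simp
    finally show ?thesis by (simp add: mult_ac)
  qed
  then show ?thesis
    using alg_sharp_sum_bound[of \<tau> "{()}" "\<lambda>_. Y" "norm Y" "\<lambda>_. id_blinfun"] assms by simp
qed

lemma alg_sharp_linear:
  assumes "\<tau> \<in> alg_tensor S" "Y \<in> bounded_ops" "Y' \<in> bounded_ops"
  shows "alg_sharp \<tau> (r *\<^sub>R Y + r' *\<^sub>R Y') = r *\<^sub>R alg_sharp \<tau> Y + r' *\<^sub>R alg_sharp \<tau> Y'"
proof -
  obtain ps where ps: "represents S ps \<tau>" using assms alg_tensor_rep by blast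
  have "rep_sharp ps (r *\<^sub>R Y + r' *\<^sub>R Y') = r *\<^sub>R rep_sharp ps Y + r' *\<^sub>R rep_sharp ps Y'" for ps
    by (induction ps) (auto simp: compose_ring scaleR_add_right)
  moreover have "r *\<^sub>R Y + r' *\<^sub>R Y' \<in> bounded_ops"
    using assms(2,3) by (auto simp: bounded_ops_def plus_blinfun.rep_eq scaleR_blinfun.rep_eq scaleC_add_right scaleC_scaleR)
  ultimately show ?thesis
    using alg_sharp_rep[OF ps] assms by simp
qed

section \<open>Passage to the completion\<close>

lemma tensor_cauchyD:
  assumes "c \<in> tensor_cauchy S"
  shows "c k \<in> alg_tensor S" "0 < e \<Longrightarrow> \<exists>M. \<forall>m\<ge>M. \<forall>n\<ge>M. tensor_norm S (c m - c n) < e"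
  using assms by (auto simp: cauchy_seqs_def)

lemma tensor_cauchy_zero: "0 \<in> tensor_cauchy S"
  using alg_tensor_closed(1) by (auto simp: cauchy_seqs_def tensor_norm_zero)

lemma tensor_cauchy_add:
  assumes c: "c \<in> tensor_cauchy S" and d: "d \<in> tensor_cauchy S" shows "c + d \<in> tensor_cauchy S"
  unfolding cauchy_seqs_def
proof (intro CollectI conjI allI impI)
  show "range (c + d) \<subseteq> alg_tensor S"
    using tensor_cauchyD(1)[OF c] tensor_cauchyD(1)[OF d] alg_tensor_closed(2) by auto
  fix e :: real assume e: "0 < e"
  obtain M where M: "\<forall>m\<ge>M. \<forall>n\<ge>M. tensor_norm S (c m - c n) < e / 2"
    using tensor_cauchyD(2)[OF c, of "e / 2"] e by auto
  obtain M' where M': "\<forall>m\<ge>M'. \<forall>n\<ge>M'. tensor_norm S (d m - d n) < e / 2"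
    using tensor_cauchyD(2)[OF d, of "e / 2"] e by auto
  have "tensor_norm S ((c + d) m - (c + d) n) < e" if "m \<ge> max M M'" "n \<ge> max M M'" for m n
  proof -
    have "(c + d) m - (c + d) n = (c m - c n) + (d m - d n)" by simp
    then have "tensor_norm S ((c + d) m - (c + d) n) \<le> tensor_norm S (c m - c n) + tensor_norm S (d m - d n)"
      using tensor_norm_triangle alg_tensor_diff tensor_cauchyD(1)[OF c] tensor_cauchyD(1)[OF d] by metis
    moreover have "tensor_norm S (c m - c n) < e / 2" "tensor_norm S (d m - d n) < e / 2"
      using M M' that by auto
    ultimately show ?thesis by linarith
  qed
  then show "\<exists>M. \<forall>m\<ge>M. \<forall>n\<ge>M. tensor_norm S ((c + d) m - (c + d) n) < e" by blast
qed

lemma tensor_cauchy_scale: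
  assumes c: "c \<in> tensor_cauchy S" shows "(\<lambda>k. scale_tensor a (c k)) \<in> tensor_cauchy S"
  unfolding cauchy_seqs_def
proof (intro CollectI conjI allI impI)
  show "range (\<lambda>k. scale_tensor a (c k)) \<subseteq> alg_tensor S"
    using tensor_cauchyD(1)[OF c] alg_tensor_closed(3) by auto
  fix e :: real assume e: "0 < e"
  obtain M where M: "\<forall>m\<ge>M. \<forall>n\<ge>M. tensor_norm S (c m - c n) < e / (cmod a + 1)"
    using tensor_cauchyD(2)[OF c, of "e / (cmod a + 1)"] e by (auto simp: add_nonneg_pos)
  have "tensor_norm S (scale_tensor a (c m) - scale_tensor a (c n)) < e" if "m \<ge> M" "n \<ge> M" for m n
  proof -
    have in_alg: "c m - c n \<in> alg_tensor S" using alg_tensor_diff tensor_cauchyD(1)[OF c] by blast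
    have "tensor_norm S (scale_tensor a (c m) - scale_tensor a (c n)) \<le> cmod a * tensor_norm S (c m - c n)"
      using tensor_norm_scale[OF in_alg] by (simp add: scale_tensor_diff)
    also have "\<dots> \<le> (cmod a + 1) * tensor_norm S (c m - c n)"
      using tensor_norm_nonneg[OF in_alg] by (simp add: mult_right_mono)
    also have "\<dots> < (cmod a + 1) * (e / (cmod a + 1))"
      using M that by (intro mult_strict_left_mono) (auto simp: add_nonneg_pos)
    also have "\<dots> = e" using add_nonneg_pos[of "cmod a" 1] by simp
    finally show ?thesis .
  qed
  then show "\<exists>M. \<forall>m\<ge>M. \<forall>n\<ge>M. tensor_norm S (scale_tensor a (c m) - scale_tensor a (c n)) < e" by blast
qed

lemma null_relD: "(c, d) \<in> null_rel (alg_tensor S) (tensor_norm S) \<longleftrightarrow>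
    c \<in> tensor_cauchy S \<and> d \<in> tensor_cauchy S \<and> (\<lambda>k. tensor_norm S (c k - d k)) \<longlonglongrightarrow> 0"
  by (simp add: null_rel_def)

lemma null_rel_refl: "c \<in> tensor_cauchy S \<Longrightarrow> (c, c) \<in> null_rel (alg_tensor S) (tensor_norm S)"
  by (simp add: null_relD tensor_norm_zero)

lemma null_rel_sym:
  "(c, d) \<in> null_rel (alg_tensor S) (tensor_norm S) \<Longrightarrow> (d, c) \<in> null_rel (alg_tensor S) (tensor_norm S)"
  unfolding null_relD
proof (elim conjE, intro conjI)
  assume c: "c \<in> tensor_cauchy S" "d \<in> tensor_cauchy S" and "(\<lambda>k. tensor_norm S (c k - d k)) \<longlonglongrightarrow> 0"
  then show "(\<lambda>k. tensor_norm S (d k - c k)) \<longlonglongrightarrow> 0"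
    by (simp add: tensor_norm_minus_commute[OF tensor_cauchyD(1)[OF c(2)] tensor_cauchyD(1)[OF c(1)]])
qed

lemma null_rel_trans:
  assumes cd: "(c, d) \<in> null_rel (alg_tensor S) (tensor_norm S)" and de: "(d, e) \<in> null_rel (alg_tensor S) (tensor_norm S)"
  shows "(c, e) \<in> null_rel (alg_tensor S) (tensor_norm S)"
proof -
  have c: "c \<in> tensor_cauchy S" "d \<in> tensor_cauchy S" "e \<in> tensor_cauchy S"
    using cd de by (auto simp: null_relD)
  note alg = c[THEN tensor_cauchyD(1)]
  have "(\<lambda>k. tensor_norm S (c k - e k)) \<longlonglongrightarrow> 0"
  proof (rule tendsto_sandwich[OF _ _ tendsto_const])
    show "(\<lambda>k. tensor_norm S (c k - d k) + tensor_norm S (d k - e k)) \<longlonglongrightarrow> 0"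
      using tendsto_add[of "\<lambda>k. tensor_norm S (c k - d k)" 0 _ "\<lambda>k. tensor_norm S (d k - e k)" 0] cd de
      by (simp add: null_relD)
  qed (auto intro!: always_eventually tensor_norm_triangle_diff tensor_norm_nonneg alg_tensor_diff alg)
  then show ?thesis using c by (simp add: null_relD)
qed

lemma proj_class_mem: "d \<in> proj_class S c \<longleftrightarrow> (c, d) \<in> null_rel (alg_tensor S) (tensor_norm S)"
  by (simp add: proj_class_def)

lemma proj_class_self: "c \<in> tensor_cauchy S \<Longrightarrow> c \<in> proj_class S c"
  by (simp add: proj_class_mem null_rel_refl)

lemma proj_class_eqI:
  assumes "(c, d) \<in> null_rel (alg_tensor S) (tensor_norm S)"
  shows "proj_class S c = proj_class S d"
proof (intro set_eqI iffI)
  show "e \<in> proj_class S c \<Longrightarrow> e \<in> proj_class S d" for e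
    unfolding proj_class_mem by (rule null_rel_trans[OF null_rel_sym[OF assms]])
  show "e \<in> proj_class S d \<Longrightarrow> e \<in> proj_class S c" for e
    unfolding proj_class_mem by (rule null_rel_trans[OF assms])
qed

lemma proj_tensor_eq: "proj_tensor S = proj_class S ` tensor_cauchy S"
  by (auto simp: proj_tensor_def completion_def quotient_def proj_class_def)

lemma tensor_norm_convergent:
  assumes c: "c \<in> tensor_cauchy S" shows "convergent (\<lambda>k. tensor_norm S (c k))"
proof (rule Cauchy_convergent, rule CauchyI)
  fix e :: real assume "0 < e"
  then obtain M where M: "\<forall>m\<ge>M. \<forall>n\<ge>M. tensor_norm S (c m - c n) < e"
    using tensor_cauchyD(2)[OF c] by blast
  have "norm (tensor_norm S (c m) - tensor_norm S (c n)) \<le> tensor_norm S (c m - c n)" for m n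
    using tensor_norm_abs_diff[OF tensor_cauchyD(1)[OF c] tensor_cauchyD(1)[OF c]] by simp
  then show "\<exists>M. \<forall>m\<ge>M. \<forall>n\<ge>M. norm (tensor_norm S (c m) - tensor_norm S (c n)) < e"
    using M le_less_trans by blast
qed

text \<open>Equivalent Cauchy sequences have norms with the same limit, which gives the definite
  description in \<open>completion_norm\<close> its meaning.\<close>

lemma proj_norm_tendsto:
  assumes c: "c \<in> tensor_cauchy S"
  shows "(\<lambda>k. tensor_norm S (c k)) \<longlonglongrightarrow> proj_norm S (proj_class S c)"
proof -
  obtain r where r: "(\<lambda>k. tensor_norm S (c k)) \<longlonglongrightarrow> r"
    using tensor_norm_convergent[OF c] by (auto simp: convergent_def)
  have all: "(\<lambda>k. tensor_norm S (d k)) \<longlonglongrightarrow> r" if d: "d \<in> proj_class S c" for d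
  proof -
    have d': "d \<in> tensor_cauchy S" "(\<lambda>k. tensor_norm S (c k - d k)) \<longlonglongrightarrow> 0"
      using d by (auto simp: proj_class_mem null_relD)
    have "(\<lambda>k. tensor_norm S (d k) - tensor_norm S (c k)) \<longlonglongrightarrow> 0"
    proof (rule tendsto_0_le[OF d'(2), where K = 1], rule always_eventually, rule allI)
      fix k
      show "norm (tensor_norm S (d k) - tensor_norm S (c k)) \<le> norm (tensor_norm S (c k - d k)) * 1"
        using tensor_norm_abs_diff[OF tensor_cauchyD(1)[OF c] tensor_cauchyD(1)[OF d'(1)], of k k] by simp
    qed
    from tendsto_add[OF this r] show ?thesis by simp
  qed
  have "proj_norm S (proj_class S c) = r"
    unfolding proj_norm_def completion_norm_def
  proof (rule the_equality)
    show "\<forall>d\<in>proj_class S c. (\<lambda>k. tensor_norm S (d k)) \<longlonglongrightarrow> r" using all by blast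
    fix r' assume "\<forall>d\<in>proj_class S c. (\<lambda>k. tensor_norm S (d k)) \<longlonglongrightarrow> r'"
    then have "(\<lambda>k. tensor_norm S (c k)) \<longlonglongrightarrow> r'"
      using proj_class_self[OF c] by blast
    then show "r' = r" using r by (rule LIMSEQ_unique)
  qed
  with r show ?thesis by simp
qed

lemma proj_norm_nonneg: "C \<in> proj_tensor S \<Longrightarrow> 0 \<le> proj_norm S C"
  unfolding proj_tensor_eq
proof (elim imageE)
  fix c assume c: "C = proj_class S c" "c \<in> tensor_cauchy S"
  show "0 \<le> proj_norm S C"
    unfolding c(1) by (rule LIMSEQ_le_const[OF proj_norm_tendsto[OF c(2)]])
      (use tensor_norm_nonneg[OF tensor_cauchyD(1)[OF c(2)]] in auto)
qed

lemma proj_norm_pos: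
  assumes "C \<in> proj_tensor S" "C \<noteq> proj_class S 0" shows "0 < proj_norm S C"
proof (rule ccontr)
  assume n: "\<not> 0 < proj_norm S C"
  obtain c where c: "c \<in> tensor_cauchy S" "C = proj_class S c" using assms(1) by (auto simp: proj_tensor_eq)
  have "proj_norm S C = 0" using n proj_norm_nonneg[OF assms(1)] by simp
  then have "(c, 0) \<in> null_rel (alg_tensor S) (tensor_norm S)"
    using proj_norm_tendsto[OF c(1)] c tensor_cauchy_zero by (simp add: null_relD)
  then have "proj_class S c = proj_class S 0"
    by (rule proj_class_eqI)
  then show False using assms(2) c by simp
qed

text \<open>\<open>alg_sharp\<close> is Lipschitz for the tensor norm. So its values along a Cauchy
  sequence converge, with the same limit for equivalent sequences, and the definite description in
  \<open>sharp\<close> is justified.\<close>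

lemma sharp_tendsto:
  assumes c: "c \<in> tensor_cauchy S" and Y: "Y \<in> bounded_ops"
  shows "(\<lambda>k. alg_sharp (c k) Y) \<longlonglongrightarrow> proj_class S c \<sharp> Y"
proof -
  have "Cauchy (\<lambda>k. alg_sharp (c k) Y)"
  proof (rule CauchyI)
    fix e :: real assume e: "0 < e"
    then obtain M where M: "\<forall>m\<ge>M. \<forall>n\<ge>M. tensor_norm S (c m - c n) < e / (norm Y + 1)"
      using tensor_cauchyD(2)[OF c, of "e / (norm Y + 1)"] by (auto simp: add_nonneg_pos)
    have "norm (alg_sharp (c m) Y - alg_sharp (c n) Y) < e" if "m \<ge> M" "n \<ge> M" for m n
    proof -
      have in_alg: "c m - c n \<in> alg_tensor S" using alg_tensor_diff tensor_cauchyD(1)[OF c] by blast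
      have "norm (alg_sharp (c m) Y - alg_sharp (c n) Y) \<le> norm Y * tensor_norm S (c m - c n)"
        using norm_alg_sharp_le[OF in_alg Y] alg_sharp_diff[OF tensor_cauchyD(1)[OF c] tensor_cauchyD(1)[OF c] Y] by metis
      also have "\<dots> \<le> (norm Y + 1) * tensor_norm S (c m - c n)"
        using tensor_norm_nonneg[OF in_alg] by (simp add: mult_right_mono)
      also have "\<dots> < (norm Y + 1) * (e / (norm Y + 1))"
        using M that by (intro mult_strict_left_mono) (auto simp: add_nonneg_pos)
      also have "\<dots> = e" using add_nonneg_pos[of "norm Y" 1] by simp
      finally show ?thesis .
    qed
    then show "\<exists>M. \<forall>m\<ge>M. \<forall>n\<ge>M. norm (alg_sharp (c m) Y - alg_sharp (c n) Y) < e" by blast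
  qed
  then obtain W where W: "(\<lambda>k. alg_sharp (c k) Y) \<longlonglongrightarrow> W"
    using Cauchy_convergent convergent_def by blast
  have all: "(\<lambda>k. alg_sharp (d k) Y) \<longlonglongrightarrow> W" if d: "d \<in> proj_class S c" for d
  proof -
    have d': "d \<in> tensor_cauchy S" "(\<lambda>k. tensor_norm S (c k - d k)) \<longlonglongrightarrow> 0"
      using d by (auto simp: proj_class_mem null_relD)
    have "(\<lambda>k. alg_sharp (c k) Y - alg_sharp (d k) Y) \<longlonglongrightarrow> 0"
    proof (rule tendsto_0_le[OF d'(2), where K = "norm Y"], rule always_eventually, rule allI)
      fix k
      note in_alg = tensor_cauchyD(1)[OF c, of k] tensor_cauchyD(1)[OF d'(1), of k]
      have "norm (alg_sharp (c k) Y - alg_sharp (d k) Y) \<le> norm Y * tensor_norm S (c k - d k)"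
        using norm_alg_sharp_le[OF alg_tensor_diff[OF in_alg] Y] alg_sharp_diff[OF in_alg Y] by metis
      also have "\<dots> \<le> norm (tensor_norm S (c k - d k)) * norm Y" by (simp add: mult_left_mono mult.commute)
      finally show "norm (alg_sharp (c k) Y - alg_sharp (d k) Y) \<le> norm (tensor_norm S (c k - d k)) * norm Y" .
    qed
    from tendsto_diff[OF W this] show ?thesis by simp
  qed
  have "proj_class S c \<sharp> Y = W"
    unfolding sharp_def
  proof (rule the_equality)
    show "\<forall>d\<in>proj_class S c. (\<lambda>k. alg_sharp (d k) Y) \<longlonglongrightarrow> W" using all by blast
    fix W' assume "\<forall>d\<in>proj_class S c. (\<lambda>k. alg_sharp (d k) Y) \<longlonglongrightarrow> W'"
    then have "(\<lambda>k. alg_sharp (c k) Y) \<longlonglongrightarrow> W'"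
      using proj_class_self[OF c] by blast
    then show "W' = W" using W by (rule LIMSEQ_unique)
  qed
  with W show ?thesis by simp
qed

lemma sharp_linear:
  assumes C: "C \<in> proj_tensor S" and Y: "Y \<in> bounded_ops" "Y' \<in> bounded_ops"
  shows "C \<sharp> (r *\<^sub>R Y + r' *\<^sub>R Y') = r *\<^sub>R (C \<sharp> Y) + r' *\<^sub>R (C \<sharp> Y')"
proof -
  obtain c where c: "c \<in> tensor_cauchy S" "C = proj_class S c" using C by (auto simp: proj_tensor_eq)
  have "r *\<^sub>R Y + r' *\<^sub>R Y' \<in> bounded_ops"
    using Y by (auto simp: bounded_ops_def plus_blinfun.rep_eq scaleR_blinfun.rep_eq scaleC_add_right scaleC_scaleR)
  from sharp_tendsto[OF c(1) this]
  have "(\<lambda>k. r *\<^sub>R alg_sharp (c k) Y + r' *\<^sub>R alg_sharp (c k) Y') \<longlonglongrightarrow> C \<sharp> (r *\<^sub>R Y + r' *\<^sub>R Y')"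
    unfolding c(2) by (simp add: alg_sharp_linear[OF tensor_cauchyD(1)[OF c(1)] Y])
  moreover have "(\<lambda>k. r *\<^sub>R alg_sharp (c k) Y + r' *\<^sub>R alg_sharp (c k) Y') \<longlonglongrightarrow> r *\<^sub>R (C \<sharp> Y) + r' *\<^sub>R (C \<sharp> Y')"
    unfolding c(2) by (intro tendsto_intros sharp_tendsto c Y)
  ultimately show ?thesis by (rule LIMSEQ_unique)
qed

lemma sharp_class_add:
  assumes "c \<in> tensor_cauchy S" "d \<in> tensor_cauchy S" "Y \<in> bounded_ops"
  shows "proj_class S (c + d) \<sharp> Y = (proj_class S c \<sharp> Y) + (proj_class S d \<sharp> Y)"
proof (rule LIMSEQ_unique)
  show "(\<lambda>k. alg_sharp ((c + d) k) Y) \<longlonglongrightarrow> proj_class S (c + d) \<sharp> Y"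
    by (intro sharp_tendsto tensor_cauchy_add assms)
  show "(\<lambda>k. alg_sharp ((c + d) k) Y) \<longlonglongrightarrow> (proj_class S c \<sharp> Y) + (proj_class S d \<sharp> Y)"
    using tendsto_add[OF sharp_tendsto[OF assms(1,3)] sharp_tendsto[OF assms(2,3)]]
    by (simp add: alg_sharp_add[OF tensor_cauchyD(1)[OF assms(1)] tensor_cauchyD(1)[OF assms(2)] assms(3)])
qed

lemma sharp_class_scale:
  assumes "c \<in> tensor_cauchy S" "Y \<in> bounded_ops"
  shows "proj_class S (\<lambda>k. scale_tensor a (c k)) \<sharp> Y = op_scale a (proj_class S c \<sharp> Y)"
proof (rule LIMSEQ_unique)
  show "(\<lambda>k. alg_sharp (scale_tensor a (c k)) Y) \<longlonglongrightarrow> proj_class S (\<lambda>k. scale_tensor a (c k)) \<sharp> Y"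
    by (intro sharp_tendsto tensor_cauchy_scale assms)
  show "(\<lambda>k. alg_sharp (scale_tensor a (c k)) Y) \<longlonglongrightarrow> op_scale a (proj_class S c \<sharp> Y)"
    using bounded_linear.tendsto[OF bounded_linear_op_scale sharp_tendsto[OF assms]]
    by (simp add: alg_sharp_scale[OF tensor_cauchyD(1)[OF assms(1)] assms(2)])
qed

lemma sharp_sum_bound:
  assumes C: "C \<in> proj_tensor S" and Y: "\<And>k. k \<in> I \<Longrightarrow> Y k \<in> bounded_ops" and B: "0 \<le> B"
    and b: "\<And>U V. U \<in> S \<Longrightarrow> V \<in> S \<Longrightarrow> norm (\<Sum>k\<in>I. (U o\<^sub>L Y k o\<^sub>L V) o\<^sub>L Z k) \<le> B * (norm U * norm V)"
  shows "norm (\<Sum>k\<in>I. (C \<sharp> Y k) o\<^sub>L Z k) \<le> B * proj_norm S C"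
proof -
  obtain c where c: "c \<in> tensor_cauchy S" "C = proj_class S c" using C by (auto simp: proj_tensor_eq)
  have "(\<lambda>j. norm (\<Sum>k\<in>I. alg_sharp (c j) (Y k) o\<^sub>L Z k)) \<longlonglongrightarrow> norm (\<Sum>k\<in>I. (C \<sharp> Y k) o\<^sub>L Z k)"
    unfolding c(2) by (intro tendsto_norm tendsto_sum tendsto_compose_op tendsto_const sharp_tendsto[OF c(1)] Y)
  moreover have "(\<lambda>j. B * tensor_norm S (c j)) \<longlonglongrightarrow> B * proj_norm S C"
    unfolding c(2) by (intro tendsto_mult tendsto_const proj_norm_tendsto c)
  moreover have "norm (\<Sum>k\<in>I. alg_sharp (c j) (Y k) o\<^sub>L Z k) \<le> B * tensor_norm S (c j)" for j
    by (rule alg_sharp_sum_bound[OF tensor_cauchyD(1)[OF c(1)] Y B b])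
  ultimately show ?thesis using LIMSEQ_le by blast
qed

lemma norm_sharp_le:
  assumes "C \<in> proj_tensor S" "Y \<in> bounded_ops"
  shows "norm (C \<sharp> Y) \<le> norm Y * proj_norm S C"
proof -
  have "norm (U o\<^sub>L Y o\<^sub>L V) \<le> norm Y * (norm U * norm V)" for U V :: "'h op"
  proof -
    have "norm (U o\<^sub>L Y o\<^sub>L V) \<le> norm (U o\<^sub>L Y) * norm V" by (rule norm_blinfun_compose)
    also have "\<dots> \<le> (norm U * norm Y) * norm V" by (intro mult_right_mono norm_blinfun_compose) simp
    finally show ?thesis by (simp add: mult_ac)
  qed
  then show ?thesis
    using sharp_sum_bound[of C "{()}" "\<lambda>_. Y" "norm Y" "\<lambda>_. id_blinfun"] assms by simp
qed

lemma sharp_in: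
  assumes C: "C \<in> proj_tensor S" and B: "unital_subalgebra B" "closed B" "S \<subseteq> B" and Y: "Y \<in> B"
  shows "C \<sharp> Y \<in> B"
proof -
  obtain c where c: "c \<in> tensor_cauchy S" "C = proj_class S c" using C by (auto simp: proj_tensor_eq)
  have Yb: "Y \<in> bounded_ops" using subalg_bounded_ops[OF B(1) Y] .
  have "alg_sharp (c k) Y \<in> B" for k
  proof -
    obtain ps where ps: "represents S ps (c k)" using alg_tensor_rep[OF tensor_cauchyD(1)[OF c(1)]] by blast
    have "rep_sharp ps Y \<in> B" if "set ps \<subseteq> S \<times> S" for ps
      using that B(3) Y
      by (induction ps) (auto intro!: subalg_zero[OF B(1)] subalg_add[OF B(1)] subalg_compose[OF B(1)])
    then show ?thesis using ps alg_sharp_rep[OF ps Yb] by (simp add: represents_def)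
  qed
  then show ?thesis
    unfolding c(2) by (rule closed_sequentially[OF B(2) _ sharp_tendsto[OF c(1) Yb]])
qed

end

section \<open>Enlarging the algebra under the projective tensor product\<close>

lemma tensor_norm_mono:
  assumes "unital_subalgebra S" "unital_subalgebra S'" "S \<subseteq> S'" "\<tau> \<in> alg_tensor S"
  shows "tensor_norm S' \<tau> \<le> tensor_norm S \<tau>" "\<tau> \<in> alg_tensor S'"
proof -
  obtain ps where "represents S ps \<tau>" using alg_tensor_rep[OF assms(1,4)] by blast
  then show "\<tau> \<in> alg_tensor S'" by (intro alg_tensorI[OF assms(2)] represents_mono[OF assms(3)])
  show "tensor_norm S' \<tau> \<le> tensor_norm S \<tau>"
    by (rule tensor_norm_greatest[OF assms(1,4)]) (rule tensor_norm_le[OF assms(2) represents_mono[OF assms(3)]])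
qed

lemma tensor_cauchy_mono:
  assumes S: "unital_subalgebra S" "unital_subalgebra S'" "S \<subseteq> S'" and c: "c \<in> tensor_cauchy S"
  shows "c \<in> tensor_cauchy S'"
proof -
  have "tensor_norm S' (c m - c n) \<le> tensor_norm S (c m - c n)" for m n
    using tensor_norm_mono(1)[OF S] alg_tensor_diff[OF S(1)] tensor_cauchyD(1)[OF S(1) c] by blast
  moreover have "range c \<subseteq> alg_tensor S'"
    using tensor_norm_mono(2)[OF S tensor_cauchyD(1)[OF S(1) c]] by auto
  moreover have "\<exists>M. \<forall>m\<ge>M. \<forall>n\<ge>M. tensor_norm S' (c m - c n) < e" if "0 < e" for e
  proof -
    obtain M where "\<forall>m\<ge>M. \<forall>n\<ge>M. tensor_norm S (c m - c n) < e"
      using tensor_cauchyD(2)[OF S(1) c \<open>0 < e\<close>] by blast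
    then show ?thesis using le_less_trans[OF calculation(1)] by blast
  qed
  ultimately show ?thesis by (simp add: cauchy_seqs_def)
qed

text \<open>A larger algebra admits more representations and so has a smaller tensor norm. Cauchy
  sequences and null sequences therefore stay what they are.\<close>

lemma proj_embed_class:
  assumes S: "unital_subalgebra S" "unital_subalgebra S'" "S \<subseteq> S'" and c: "c \<in> tensor_cauchy S"
  shows "proj_embed S' (proj_class S c) = proj_class S' c"
proof (intro equalityI subsetI)
  fix e assume "e \<in> proj_embed S' (proj_class S c)"
  then obtain d where d: "(c, d) \<in> null_rel (alg_tensor S) (tensor_norm S)" "(d, e) \<in> null_rel (alg_tensor S') (tensor_norm S')"
    by (auto simp: proj_embed_def proj_class_def)
  have cd: "d \<in> tensor_cauchy S" "(\<lambda>k. tensor_norm S (c k - d k)) \<longlonglongrightarrow> 0"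
    using d(1) by (auto simp: null_rel_def)
  have alg: "c k - d k \<in> alg_tensor S" for k
    using alg_tensor_diff[OF S(1)] tensor_cauchyD(1)[OF S(1)] c cd(1) by blast
  have "(\<lambda>k. tensor_norm S' (c k - d k)) \<longlonglongrightarrow> 0"
    by (rule tendsto_sandwich[OF _ _ tendsto_const cd(2)])
      (auto intro!: always_eventually tensor_norm_mono(1)[OF S alg] tensor_norm_nonneg[OF S(2)] tensor_norm_mono(2)[OF S alg])
  then have "(c, d) \<in> null_rel (alg_tensor S') (tensor_norm S')"
    using tensor_cauchy_mono[OF S] c cd(1) by (simp add: null_rel_def)
  from null_rel_trans[OF S(2) this d(2)] show "e \<in> proj_class S' c" by (simp add: proj_class_def)
next
  fix e assume "e \<in> proj_class S' c"
  moreover have "c \<in> proj_class S c" using null_rel_refl[OF S(1) c] by (simp add: proj_class_def)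
  ultimately show "e \<in> proj_embed S' (proj_class S c)" by (auto simp: proj_embed_def proj_class_def)
qed

lemma proj_embed_in:
  assumes "unital_subalgebra S" "unital_subalgebra S'" "S \<subseteq> S'" "C \<in> proj_tensor S"
  shows "proj_embed S' C \<in> proj_tensor S'"
  using assms proj_embed_class[OF assms(1-3)] tensor_cauchy_mono[OF assms(1-3)]
  by (auto simp: proj_tensor_eq)

lemma proj_embed_sharp:
  assumes S: "unital_subalgebra S" "unital_subalgebra S'" "S \<subseteq> S'" and C: "C \<in> proj_tensor S" and Y: "Y \<in> bounded_ops"
  shows "proj_embed S' C \<sharp> Y = C \<sharp> Y"
proof -
  obtain c where c: "c \<in> tensor_cauchy S" "C = proj_class S c" using C by (auto simp: proj_tensor_eq[OF S(1)])
  show ?thesis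
    unfolding c(2) proj_embed_class[OF S c(1)]
    by (rule LIMSEQ_unique[OF sharp_tendsto[OF S(2) tensor_cauchy_mono[OF S c(1)] Y] sharp_tendsto[OF S(1) c(1) Y]])
qed

section \<open>The interpolated area\<close>

text \<open>Gauge sums lie in the subspace and approximate the integral, and the subspace is
  closed.\<close>

lemma integral_in_closed_subspace:
  fixes f :: "real \<Rightarrow> 'a::real_normed_vector"
  assumes f: "(f has_integral y) {a..b}" and fin: "finite N" and B: "closed B" "0 \<in> B"
    "\<And>x y. x \<in> B \<Longrightarrow> y \<in> B \<Longrightarrow> x + y \<in> B" "\<And>r x. x \<in> B \<Longrightarrow> r *\<^sub>R x \<in> B"
    and fB: "\<And>x. x \<in> {a..b} - N \<Longrightarrow> f x \<in> B"
  shows "y \<in> B"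
proof -
  \<comment> \<open>A tag may hit an exceptional point, so the integrand is first set to 0 there;
    finitely many values do not affect the integral.\<close>
  define g where "g x = (if x \<in> {a..b} - N then f x else 0)" for x
  have "(g has_integral y) {a..b}"
    by (rule has_integral_spike_finite[OF fin _ f]) (simp add: g_def)
  have gB: "g x \<in> B" for x using fB B by (simp add: g_def)
  have "\<exists>z\<in>B. dist z y < e" if e: "e > 0" for e
  proof -
    obtain \<gamma> where \<gamma>: "gauge \<gamma>" "\<And>\<D>. \<D> tagged_division_of {a..b} \<Longrightarrow> \<gamma> fine \<D> \<Longrightarrow>
        norm (sum (\<lambda>(x,k). measure lborel k *\<^sub>R g x) \<D> - y) < e"
      using \<open>(g has_integral y) {a..b}\<close> e unfolding has_integral_real by metis
    obtain \<D> where \<D>: "\<D> tagged_division_of {a..b}" "\<gamma> fine \<D>"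
      using fine_division_exists_real[OF \<gamma>(1)] by blast
    have "sum (\<lambda>(x,k). measure lborel k *\<^sub>R g x) \<D>' \<in> B" for \<D>' :: "(real \<times> real set) set"
      by (induction \<D>' rule: infinite_finite_induct) (auto intro!: B gB)
    with \<gamma>(2)[OF \<D>] show ?thesis by (auto simp: dist_norm)
  qed
  then show ?thesis using closed_approachable[OF B(1)] by blast
qed

lemma sqrt_rescale:
  assumes "0 \<le> (a::real)" "0 < b" shows "a * b * sqrt (1 / b) = sqrt a * sqrt (a * b)"
proof -
  have "a * b * sqrt (1 / b) = (sqrt a * sqrt a) * ((sqrt b * sqrt b) / sqrt b)"
    using assms by (simp add: real_sqrt_divide)
  also have "\<dots> = sqrt a * sqrt (a * b)"
    using assms nonzero_mult_div_cancel_right[of "sqrt b" "sqrt b"]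
    by (simp only: real_sqrt_mult mult.assoc) simp
  finally show ?thesis .
qed

section \<open>Dyadic cells and the shape of the interpolation\<close>

lemma dyadic_step: "dyadic n (Suc i) - dyadic n i = 1 / 2 ^ n"
  by (simp add: dyadic_def field_simps)

lemma dyadic_mono: "i \<le> j \<Longrightarrow> dyadic n i \<le> dyadic n j"
  by (simp add: dyadic_def divide_right_mono)

lemma dyadic_nonneg: "0 \<le> dyadic n i"
  by (simp add: dyadic_def)

lemma dyadic_double: "dyadic (Suc n) (2 * i) = dyadic n i"
  by (simp add: dyadic_def)

lemma dyadic_cell_exists:
  assumes "0 \<le> u" shows "\<exists>i. dyadic n i \<le> u \<and> u < dyadic n (Suc i)"
proof -
  let ?i = "nat \<lfloor>u * 2 ^ n\<rfloor>"
  have "real ?i = of_int \<lfloor>u * 2 ^ n\<rfloor>" using assms by simp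
  then have "real ?i \<le> u * 2 ^ n" "u * 2 ^ n < real ?i + 1" by linarith+
  then show ?thesis
    by (intro exI[of _ ?i]) (simp add: dyadic_def divide_le_eq less_divide_eq add.commute)
qed

lemma dyadic_cell_unique:
  assumes "dyadic n i \<le> u" "u < dyadic n (Suc i)" shows "nat \<lfloor>u * 2 ^ n\<rfloor> = i"
proof -
  have "real i \<le> u * 2 ^ n" "u * 2 ^ n < real i + 1"
    using assms by (simp_all add: dyadic_def divide_le_eq less_divide_eq add.commute)
  then have "\<lfloor>u * 2 ^ n\<rfloor> = int i" by (simp add: floor_unique)
  then show ?thesis by simp
qed

text \<open>The right end of the cell is included: there \<open>interp\<close> already uses the
  formula of the next cell, and both give the value of X.\<close>

lemma interp_cell:
  assumes "dyadic n i \<le> u" "u \<le> dyadic n (Suc i)"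
  shows "interp X n u = X (dyadic n i) + ((u - dyadic n i) * 2 ^ n) *\<^sub>R (X (dyadic n (Suc i)) - X (dyadic n i))"
proof (cases "u = dyadic n (Suc i)")
  case True
  have "dyadic n (Suc i) < dyadic n (Suc (Suc i))" using dyadic_step[of n "Suc i"] zero_less_power[of "2::real" n] by (simp add: dyadic_def divide_strict_right_mono)
  then have "nat \<lfloor>u * 2 ^ n\<rfloor> = Suc i" using dyadic_cell_unique[of n "Suc i" u] True by simp
  then show ?thesis using dyadic_step[of n i] True by (simp add: interp_def Let_def)
next
  case False
  then have "nat \<lfloor>u * 2 ^ n\<rfloor> = i" using assms by (intro dyadic_cell_unique) auto
  then show ?thesis unfolding interp_def Let_def dyadic_step by simp
qed

lemma interp_dyadic: "interp X n (dyadic n i) = X (dyadic n i)"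
  using interp_cell[of n i "dyadic n i"] dyadic_mono[of i "Suc i"] by simp

lemma interp_diff_cell:
  assumes "dyadic n i \<le> u" "u \<le> dyadic n (Suc i)" "dyadic n i \<le> v" "v \<le> dyadic n (Suc i)"
  shows "interp X n v - interp X n u = ((v - u) * 2 ^ n) *\<^sub>R (X (dyadic n (Suc i)) - X (dyadic n i))"
proof -
  have "(v - u) * 2 ^ n = (v - dyadic n i) * 2 ^ n - (u - dyadic n i) * 2 ^ n"
    by (simp add: algebra_simps)
  then show ?thesis
    unfolding interp_cell[OF assms(1,2)] interp_cell[OF assms(3,4)]
    by (simp only: scaleR_left_diff_distrib add_diff_cancel_left)
qed

lemma interp_vector_derivative:
  fixes X :: "real \<Rightarrow> 'h::complex_hilbert op"
  assumes "dyadic n i < u" "u < dyadic n (Suc i)"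
  shows "(interp X n has_vector_derivative 2 ^ n *\<^sub>R (X (dyadic n (Suc i)) - X (dyadic n i))) (at u)"
proof (rule has_vector_derivative_transform_within_open[where S = "{dyadic n i<..<dyadic n (Suc i)}"])
  let ?\<delta> = "X (dyadic n (Suc i)) - X (dyadic n i)"
  show "((\<lambda>v. X (dyadic n i) + ((v - dyadic n i) * 2 ^ n) *\<^sub>R ?\<delta>) has_vector_derivative 2 ^ n *\<^sub>R ?\<delta>) (at u)"
    by (auto intro!: derivative_eq_intros simp: has_vector_derivative_def algebra_simps)
  show "X (dyadic n i) + ((v - dyadic n i) * 2 ^ n) *\<^sub>R ?\<delta> = interp X n v"
    if "v \<in> {dyadic n i<..<dyadic n (Suc i)}" for v
    using that interp_cell[of n i v X] by simp
qed (use assms in auto)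

text \<open>The exceptional points up to time t: off the grid the interpolation is locally affine,
  hence differentiable.\<close>

definition grid :: "nat \<Rightarrow> real \<Rightarrow> real set" where
  "grid n t = dyadic n ` {i. dyadic n i \<le> t}"

lemma finite_grid: "finite (grid n t)"
proof -
  have "i \<le> nat \<lceil>t * 2 ^ n\<rceil>" if "dyadic n i \<le> t" for i
  proof -
    have "real i \<le> t * 2 ^ n" using that by (simp add: dyadic_def divide_le_eq)
    then show ?thesis by linarith
  qed
  then have "{i. dyadic n i \<le> t} \<subseteq> {..nat \<lceil>t * 2 ^ n\<rceil>}" by auto
  then show ?thesis unfolding grid_def by (intro finite_imageI) (meson finite_atMost finite_subset)
qed

lemma off_grid_cell:
  assumes "0 \<le> u" "u \<le> t" "u \<notin> grid n t"
  shows "\<exists>i. dyadic n i < u \<and> u < dyadic n (Suc i)"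
proof -
  obtain i where i: "dyadic n i \<le> u" "u < dyadic n (Suc i)" using dyadic_cell_exists[OF assms(1)] by blast
  then have "dyadic n i \<noteq> u" using assms by (auto simp: grid_def)
  then show ?thesis using i by (intro exI[of _ i]) simp
qed

text \<open>Intervals grow at their right end by one cell at a time. The premise
  \<open>short\<close> also has to cover intervals inside a single cell, about which the induction
  hypothesis says nothing.\<close>

lemma dyadic_induct:
  assumes t: "0 \<le> t"
    and short: "\<And>i t. dyadic n i \<le> t \<Longrightarrow> t \<le> dyadic n (Suc i) \<Longrightarrow> (\<And>s. 0 \<le> s \<Longrightarrow> s \<le> dyadic n i \<Longrightarrow> P s (dyadic n i)) \<Longrightarrow> (\<And>s. 0 \<le> s \<Longrightarrow> s \<le> t \<Longrightarrow> P s t)"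
    and zero: "P 0 0"
  shows "0 \<le> s \<Longrightarrow> s \<le> t \<Longrightarrow> P s t"
proof -
  have main: "P s (dyadic n i)" if "0 \<le> s" "s \<le> dyadic n i" for s i
    using that
  proof (induction i arbitrary: s)
    case 0
    then show ?case using zero by (simp add: dyadic_def)
  next
    case (Suc i)
    show ?case by (rule short[of i]) (use Suc dyadic_mono[of i "Suc i" n] in auto)
  qed
  assume s: "0 \<le> s" "s \<le> t"
  obtain i where "dyadic n i \<le> t" "t < dyadic n (Suc i)" using dyadic_cell_exists[OF t] by blast
  then show "P s t" using short[of i t s] main s by simp
qed

section \<open>The algebras of the past and the regularity of the interpolation\<close>

context q_brownian
begin

lemma x1_nonneg: "0 \<le> x1"
  by (simp add: x1_def)

text \<open>An intersection of subalgebras is closed under the operations. That it consists of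
  complex-linear operators follows from \<open>A\<close> being one of the intersected
  algebras.\<close>

lemma hull_subalgebra: "unital_subalgebra (unital_subalgebra hull (X ` {0..t}))"
proof -
  have mem: "U \<in> unital_subalgebra hull (X ` {0..t}) \<longleftrightarrow>
      (\<forall>B. unital_subalgebra B \<longrightarrow> X ` {0..t} \<subseteq> B \<longrightarrow> U \<in> B)" for U
    by (auto simp: hull_def)
  have XA: "X ` {0..t} \<subseteq> A" using X_A by auto
  show ?thesis
    unfolding unital_subalgebra_def[of "_ hull _"]
  proof (intro conjI ballI allI)
    let ?H = "unital_subalgebra hull (X ` {0..t})"
    have "?H \<subseteq> A" using hull_minimal[OF XA, of unital_subalgebra] subA by simp
    then show "?H \<subseteq> bounded_ops" using A_bounded_ops by blast
    show "id_blinfun \<in> ?H" unfolding mem by (simp add: subalg_id)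
    fix U V assume "U \<in> ?H" "V \<in> ?H"
    then show "U + V \<in> ?H" "U o\<^sub>L V \<in> ?H" unfolding mem by (simp_all add: subalg_add subalg_compose)
  next
    fix a U assume "U \<in> unital_subalgebra hull (X ` {0..t})"
    then show "op_scale a U \<in> unital_subalgebra hull (X ` {0..t})" unfolding mem by (simp add: subalg_op_scale)
  qed
qed

abbreviation F :: "real \<Rightarrow> 'h op set" where "F \<equiv> filtration X"

lemma F_A: "F t \<subseteq> A"
proof -
  have "X ` {0..t} \<subseteq> A" using X_A by auto
  then have "unital_subalgebra hull (X ` {0..t}) \<subseteq> A" using hull_minimal[of _ A unital_subalgebra] subA by simp
  then show ?thesis unfolding filtration_def using closedA by (rule closure_minimal)
qed

lemma F_closed: "closed (F t)"
  by (simp add: filtration_def)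

lemma F_sub: "unital_subalgebra (F t)"
  unfolding unital_subalgebra_def
proof (intro conjI ballI allI)
  let ?H = "unital_subalgebra hull (X ` {0..t})"
  note H = hull_subalgebra[of t]
  show "F t \<subseteq> bounded_ops" using F_A A_bounded_ops by blast
  show "id_blinfun \<in> F t"
    unfolding filtration_def using subalg_id[OF H] closure_subset by blast
  fix U V assume "U \<in> F t" "V \<in> F t"
  then obtain u v where uv: "\<And>k. u k \<in> ?H" "u \<longlonglongrightarrow> U" "\<And>k. v k \<in> ?H" "v \<longlonglongrightarrow> V"
    unfolding filtration_def closure_sequential by metis
  show "U + V \<in> F t"
    unfolding filtration_def closure_sequential using uv tendsto_add[OF uv(2,4)] subalg_add[OF H]
    by (intro exI[of _ "\<lambda>k. u k + v k"]) auto
  show "U o\<^sub>L V \<in> F t"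
    unfolding filtration_def closure_sequential using uv tendsto_compose_op[OF uv(2,4)] subalg_compose[OF H]
    by (intro exI[of _ "\<lambda>k. u k o\<^sub>L v k"]) auto
next
  let ?H = "unital_subalgebra hull (X ` {0..t})"
  fix a U assume "U \<in> F t"
  then obtain u where u: "\<And>k. u k \<in> ?H" "u \<longlonglongrightarrow> U"
    unfolding filtration_def closure_sequential by metis
  show "op_scale a U \<in> F t"
    unfolding filtration_def closure_sequential
    using u bounded_linear.tendsto[OF bounded_linear_op_scale u(2)] subalg_op_scale[OF hull_subalgebra]
    by (intro exI[of _ "\<lambda>k. op_scale a (u k)"]) auto
qed

lemma F_mono: "s \<le> t \<Longrightarrow> F s \<subseteq> F t"
  unfolding filtration_def by (intro closure_mono hull_mono image_mono) auto

lemma X_F: "0 \<le> u \<Longrightarrow> u \<le> t \<Longrightarrow> X u \<in> F t"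
  unfolding filtration_def by (rule subsetD[OF closure_subset], rule hull_inc) auto

text \<open>At time u the interpolation already uses X at the right end of the cell of u, so
  adaptedness is stated at grid times only.\<close>

lemma interp_F:
  assumes "0 \<le> u" "u \<le> dyadic n j" shows "interp X n u \<in> F (dyadic n j)"
proof -
  obtain i where i: "dyadic n i \<le> u" "u < dyadic n (Suc i)" using dyadic_cell_exists[OF assms(1)] by blast
  show ?thesis
  proof (cases "u = dyadic n j")
    case True then show ?thesis by (simp add: interp_dyadic X_F dyadic_nonneg)
  next
    case False
    then have "dyadic n i < dyadic n j" using i assms by simp
    then have "Suc i \<le> j" using dyadic_mono[of j i n] by (meson not_le not_less_eq_eq)
    then have "X (dyadic n (Suc i)) \<in> F (dyadic n j)" "X (dyadic n i) \<in> F (dyadic n j)"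
      by (auto intro!: X_F dyadic_nonneg dyadic_mono)
    then show ?thesis
      using i by (simp add: interp_cell[of n i u] subalg_add[OF F_sub] subalg_scaleR[OF F_sub] subalg_diff[OF F_sub])
  qed
qed

lemma interp_A: "0 \<le> u \<Longrightarrow> interp X n u \<in> A"
proof -
  assume "0 \<le> u"
  then obtain i where "u < dyadic n (Suc i)" using dyadic_cell_exists by blast
  then show ?thesis using interp_F[of u n "Suc i"] \<open>0 \<le> u\<close> F_A by fastforce
qed

lemma norm_dyadic_increment: "norm (X (dyadic n (Suc i)) - X (dyadic n i)) \<le> sqrt (1 / 2 ^ n) * x1"
  using norm_increment_le[OF dyadic_nonneg dyadic_mono[of i "Suc i" n]] dyadic_step[of n i] by simp

text \<open>The increment is the fraction (v - u) 2^n of that over the full cell, and a number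
  between 0 and 1 is at most its square root.\<close>

lemma norm_interp_cell_le:
  assumes "dyadic n i \<le> u" "u \<le> v" "v \<le> dyadic n (Suc i)"
  shows "norm (interp X n v - interp X n u) \<le> sqrt (v - u) * x1"
proof -
  have 1: "(v - u) * 2 ^ n \<le> 1"
  proof -
    have "v - u \<le> 1 / 2 ^ n" using assms dyadic_step[of n i] by linarith
    then show ?thesis by (simp add: field_simps)
  qed
  have 0: "0 \<le> (v - u) * 2 ^ n" using assms by simp
  have "norm (interp X n v - interp X n u) = (v - u) * 2 ^ n * norm (X (dyadic n (Suc i)) - X (dyadic n i))"
    using assms by (subst interp_diff_cell[of n i]) auto
  also have "\<dots> \<le> (v - u) * 2 ^ n * (sqrt (1 / 2 ^ n) * x1)"
    using 0 by (intro mult_left_mono norm_dyadic_increment) auto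
  also have "\<dots> = sqrt (v - u) * sqrt ((v - u) * 2 ^ n) * x1"
    using sqrt_rescale[of "v - u" "2 ^ n"] assms by simp
  also have "\<dots> \<le> sqrt (v - u) * 1 * x1"
    using 1 0 assms x1_nonneg by (intro mult_right_mono mult_left_mono) auto
  finally show ?thesis by simp
qed

text \<open>The 3 counts the partial cell after u, the complete cells, on whose ends the
  interpolation agrees with X, and the partial cell before v.\<close>

lemma norm_interp_le:
  assumes "0 \<le> u" "u \<le> v"
  shows "norm (interp X n v - interp X n u) \<le> 3 * x1 * sqrt (v - u)"
proof -
  obtain i where i: "dyadic n i \<le> u" "u < dyadic n (Suc i)" using dyadic_cell_exists[OF assms(1)] by blast
  obtain j where j: "dyadic n j \<le> v" "v < dyadic n (Suc j)" using dyadic_cell_exists[of v n] assms by auto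
  show ?thesis
  proof (cases "v \<le> dyadic n (Suc i)")
    case True
    have "norm (interp X n v - interp X n u) \<le> sqrt (v - u) * x1"
      by (rule norm_interp_cell_le[OF i(1) assms(2) True])
    also have "\<dots> \<le> 3 * x1 * sqrt (v - u)" using x1_nonneg assms by (simp add: mult.commute)
    finally show ?thesis .
  next
    case False
    then have "dyadic n (Suc i) < dyadic n (Suc j)" using j by simp
    then have "Suc i \<le> j" using dyadic_mono[of "Suc j" "Suc i" n] by (meson not_le not_less_eq_eq)
    then have ij: "dyadic n (Suc i) \<le> dyadic n j" by (rule dyadic_mono)
    let ?a = "dyadic n (Suc i)" and ?b = "dyadic n j"
    have *: "sqrt (y - x) * x1 \<le> sqrt (v - u) * x1" if "u \<le> x" "y \<le> v" for x y
      using that x1_nonneg by (intro mult_right_mono) auto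
    have "norm (interp X n ?a - interp X n u) \<le> sqrt (v - u) * x1"
      using norm_interp_cell_le[OF i(1), of ?a] i *[of u ?a] ij j by auto
    moreover have "norm (interp X n ?b - interp X n ?a) \<le> sqrt (v - u) * x1"
      using norm_increment_le[OF dyadic_nonneg ij] i *[of ?a ?b] j by (auto simp: interp_dyadic)
    moreover have "norm (interp X n v - interp X n ?b) \<le> sqrt (v - u) * x1"
      using norm_interp_cell_le[OF _ j(1), of n j] j *[of ?b v] ij i by auto
    moreover have "interp X n v - interp X n u =
        (interp X n ?a - interp X n u) + (interp X n ?b - interp X n ?a) + (interp X n v - interp X n ?b)" by simp
    ultimately show ?thesis
      using norm_triangle_ineq[of "(interp X n ?a - interp X n u) + (interp X n ?b - interp X n ?a)" "interp X n v - interp X n ?b"]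
        norm_triangle_ineq[of "interp X n ?a - interp X n u" "interp X n ?b - interp X n ?a"]
      by (simp add: algebra_simps)
  qed
qed

lemma norm_interp_error:
  assumes "0 \<le> u" shows "norm (interp X n u - X u) \<le> 2 * x1 * sqrt (1 / 2 ^ n)"
proof -
  obtain i where i: "dyadic n i \<le> u" "u < dyadic n (Suc i)" using dyadic_cell_exists[OF assms(1)] by blast
  have d: "u - dyadic n i \<le> 1 / 2 ^ n" using i dyadic_step[of n i] by simp
  have le: "sqrt (u - dyadic n i) * x1 \<le> sqrt (1 / 2 ^ n) * x1"
    using d x1_nonneg by (intro mult_right_mono real_sqrt_le_mono) auto
  have "norm (interp X n u - X (dyadic n i)) \<le> sqrt (u - dyadic n i) * x1"
    using norm_interp_cell_le[of n i "dyadic n i" u] i by (simp add: interp_dyadic)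
  moreover have "norm (X u - X (dyadic n i)) \<le> sqrt (u - dyadic n i) * x1"
    using norm_increment_le[OF dyadic_nonneg i(1)] .
  moreover have "interp X n u - X u = (interp X n u - X (dyadic n i)) - (X u - X (dyadic n i))" by simp
  ultimately show ?thesis
    using norm_triangle_ineq4[of "interp X n u - X (dyadic n i)" "X u - X (dyadic n i)"] le by (simp add: mult.commute)
qed

abbreviation dX :: "nat \<Rightarrow> real \<Rightarrow> 'h op" where
  "dX n u \<equiv> vector_derivative (interp X n) (at u)"

lemma dX_cell: "dyadic n i < u \<Longrightarrow> u < dyadic n (Suc i) \<Longrightarrow> dX n u = 2 ^ n *\<^sub>R (X (dyadic n (Suc i)) - X (dyadic n i))"
  by (rule vector_derivative_at[OF interp_vector_derivative])

lemma norm_dX_le: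
  assumes "0 \<le> u" "u \<le> t" "u \<notin> grid n t"
  shows "norm (dX n u) \<le> sqrt (2 ^ n) * x1"
proof -
  obtain i where i: "dyadic n i < u" "u < dyadic n (Suc i)" using off_grid_cell[OF assms] by blast
  have "norm (dX n u) \<le> 2 ^ n * (sqrt (1 / 2 ^ n) * x1)"
    unfolding dX_cell[OF i] using norm_dyadic_increment by simp
  also have "2 ^ n * (sqrt (1 / 2 ^ n) * x1) = sqrt (2 ^ n) * x1"
  proof -
    have "2 ^ n * sqrt (1 / 2 ^ n) = sqrt (2 ^ n)"
      by (simp add: real_sqrt_divide real_div_sqrt)
    then show ?thesis by (simp flip: mult.assoc)
  qed
  finally show ?thesis .
qed

lemma has_integral_dX:
  assumes "0 \<le> s" "s \<le> t"
  shows "(dX n has_integral (interp X n t - interp X n s)) {s..t}"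
proof (rule fundamental_theorem_of_calculus_interior_strong[OF finite_grid[of n t] assms(2)])
  show "(interp X n has_vector_derivative dX n u) (at u)" if "u \<in> {s<..<t} - grid n t" for u
  proof -
    have "0 \<le> u" "u \<le> t" "u \<notin> grid n t" using that assms by auto
    then obtain i where i: "dyadic n i < u" "u < dyadic n (Suc i)" using off_grid_cell by blast
    show ?thesis unfolding dX_cell[OF i] by (rule interp_vector_derivative[OF i])
  qed
  show "continuous_on {s..t} (interp X n)"
  proof (rule continuous_onI)
    fix x e :: real assume x: "x \<in> {s..t}" and e: "0 < e"
    \<comment> \<open>Inverts the modulus of continuity 3 * x1 * sqrt r; the added 1 keeps the
      denominator positive.\<close>
    let ?d = "(e / (3 * x1 + 1))\<^sup>2"
    have "dist (interp X n y) (interp X n x) \<le> e" if y: "y \<in> {s..t}" "dist y x < ?d" for y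
    proof -
      have "sqrt \<bar>y - x\<bar> \<le> sqrt ?d" using y by (intro real_sqrt_le_mono) (simp add: dist_real_def)
      then have sq: "sqrt \<bar>y - x\<bar> \<le> e / (3 * x1 + 1)" using e x1_nonneg by simp
      have "dist (interp X n y) (interp X n x) \<le> 3 * x1 * sqrt \<bar>y - x\<bar>"
        using norm_interp_le[of x y n] norm_interp_le[of y x n] x y assms
        by (cases "x \<le> y") (auto simp: dist_norm norm_minus_commute)
      also have "\<dots> \<le> (3 * x1 + 1) * (e / (3 * x1 + 1))"
        using sq x1_nonneg e by (intro mult_mono) auto
      also have "\<dots> = e" using x1_nonneg by simp
      finally show ?thesis .
    qed
    moreover have "0 < ?d" using e x1_nonneg by simp
    ultimately show "\<exists>d>0. \<forall>x'\<in>{s..t}. dist x' x < d \<longrightarrow> dist (interp X n x') (interp X n x) \<le> e" by blast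
  qed
qed

end

section \<open>The area at a fixed level and its change under refinement\<close>

context q_brownian
begin

text \<open>The base point w is separate from the lower limit of integration, because splitting the
  interval in Chen's relation leaves the base point in place.\<close>

abbreviation integrand :: "nat \<Rightarrow> real \<Rightarrow> 'h ctensor \<Rightarrow> real \<Rightarrow> 'h op" where
  "integrand n w C u \<equiv> (C \<sharp> (interp X n u - interp X n w)) o\<^sub>L dX n u"

abbreviation area :: "nat \<Rightarrow> real \<Rightarrow> real \<Rightarrow> 'h ctensor \<Rightarrow> 'h op" where
  "area n s t C \<equiv> integral {s..t} (integrand n s C)"

context
  fixes S :: "'h op set" and C :: "'h ctensor"
  assumes S: "unital_subalgebra S" and C: "C \<in> proj_tensor S"
begin

lemma sharp_add:
  assumes "Y \<in> A" "Y' \<in> A" shows "C \<sharp> (Y + Y') = (C \<sharp> Y) + (C \<sharp> Y')"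
  using sharp_linear[OF S C, of Y Y' 1 1] assms by (simp add: A_bounded_ops)

lemma sharp_scaleR:
  assumes "Y \<in> A" shows "C \<sharp> (r *\<^sub>R Y) = r *\<^sub>R (C \<sharp> Y)"
  using sharp_linear[OF S C, of Y Y r 0] assms by (simp add: A_bounded_ops)

lemma sharp_diff:
  assumes "Y \<in> A" "Y' \<in> A" shows "C \<sharp> (Y - Y') = (C \<sharp> Y) - (C \<sharp> Y')"
  using sharp_linear[OF S C, of Y Y' 1 "-1"] assms by (simp add: A_bounded_ops)

lemma sharp_zero: "C \<sharp> 0 = 0"
  using sharp_scaleR[OF A_id, of 0] by simp

lemma norm_sharp_compose_le:
  assumes "Y \<in> A" shows "norm ((C \<sharp> Y) o\<^sub>L Z) \<le> norm Y * norm Z * proj_norm S C"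
proof -
  have "norm ((C \<sharp> Y) o\<^sub>L Z) \<le> norm (C \<sharp> Y) * norm Z" by (rule norm_blinfun_compose)
  also have "\<dots> \<le> (norm Y * proj_norm S C) * norm Z"
    by (intro mult_right_mono norm_sharp_le[OF S C]) (auto simp: assms A_bounded_ops)
  finally show ?thesis by (simp add: mult_ac)
qed

lemma has_integral_cell:
  assumes w: "0 \<le> w" and cell: "dyadic n i \<le> \<alpha>" "\<alpha> \<le> \<beta>" "\<beta> \<le> dyadic n (Suc i)"
  defines "Q \<equiv> 2 ^ n *\<^sub>R (X (dyadic n (Suc i)) - X (dyadic n i))"
  shows "(integrand n w C has_integral
    ((\<beta> - \<alpha>) *\<^sub>R ((C \<sharp> (interp X n \<alpha> - interp X n w)) o\<^sub>L Q) + ((\<beta> - \<alpha>)\<^sup>2 / 2) *\<^sub>R ((C \<sharp> Q) o\<^sub>L Q))) {\<alpha>..\<beta>}"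
proof -
  have \<alpha>0: "0 \<le> \<alpha>" using cell(1) dyadic_nonneg[of n i] by linarith
  have QA: "Q \<in> A" unfolding Q_def by (intro A_scaleR A_diff X_A dyadic_nonneg)
  have PA: "interp X n \<alpha> - interp X n w \<in> A" by (intro A_diff interp_A \<alpha>0 w)
  define K where "K = (C \<sharp> (interp X n \<alpha> - interp X n w)) o\<^sub>L Q"
  define L where "L = (C \<sharp> Q) o\<^sub>L Q"
  \<comment> \<open>On a cell the integrand is K + (u - \<alpha>) L, and H is its primitive that
    vanishes at \<alpha>.\<close>
  define H where "H u = (u - \<alpha>) *\<^sub>R K + ((u - \<alpha>)\<^sup>2 / 2) *\<^sub>R L" for u
  have "(integrand n w C has_integral (H \<beta> - H \<alpha>)) {\<alpha>..\<beta>}"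
  proof (rule fundamental_theorem_of_calculus_interior[OF cell(2)])
    show "continuous_on {\<alpha>..\<beta>} H" unfolding H_def by (intro continuous_intros) simp
    fix u assume u: "u \<in> {\<alpha><..<\<beta>}"
    have d: "dX n u = Q" unfolding Q_def by (rule dX_cell) (use u cell in auto)
    have "interp X n u - interp X n \<alpha> = (u - \<alpha>) *\<^sub>R Q"
      unfolding Q_def using interp_diff_cell[of n i \<alpha> u X] u cell by simp
    then have e: "interp X n u - interp X n w = (interp X n \<alpha> - interp X n w) + (u - \<alpha>) *\<^sub>R Q"
      by (simp add: algebra_simps)
    have "integrand n w C u = K + (u - \<alpha>) *\<^sub>R L"
      unfolding d e K_def L_def
      by (simp add: sharp_add[OF PA A_scaleR[OF QA]] sharp_scaleR[OF QA] compose_add_left compose_scaleR_left)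
    moreover have "(H has_vector_derivative K + (u - \<alpha>) *\<^sub>R L) (at u)"
      unfolding H_def has_vector_derivative_def
      by (auto intro!: derivative_eq_intros simp: fun_eq_iff algebra_simps diff_divide_distrib)
    ultimately show "(H has_vector_derivative integrand n w C u) (at u)" by simp
  qed
  then show ?thesis by (simp add: H_def K_def L_def)
qed

lemma integrand_integrable:
  assumes "0 \<le> w" "0 \<le> s" "s \<le> t"
  shows "integrand n w C integrable_on {s..t}"
proof (rule dyadic_induct[where P = "\<lambda>s t. integrand n w C integrable_on {s..t}" and n = n])
  fix i t s
  assume t: "dyadic n i \<le> t" "t \<le> dyadic n (Suc i)" and s: "0 \<le> s" "s \<le> t"
    and IH: "\<And>s. 0 \<le> s \<Longrightarrow> s \<le> dyadic n i \<Longrightarrow> integrand n w C integrable_on {s..dyadic n i}"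
  show "integrand n w C integrable_on {s..t}"
  proof (cases "s \<le> dyadic n i")
    case True
    then show ?thesis
      by (rule Henstock_Kurzweil_Integration.integrable_combine[OF _ t(1) IH[OF s(1)]])
        (use True has_integral_cell[OF assms(1) order_refl t] in \<open>auto intro: has_integral_integrable\<close>)
  next
    case False
    then show ?thesis
      using has_integral_cell[OF assms(1), of n i s t] t s by (auto intro: has_integral_integrable)
  qed
qed (use assms integrable_on_refl[of "integrand n w C" "0::real"] in auto)

text \<open>Chen's relation: after u the increment from s is split at u, and its constant part only
  multiplies the integral of the derivative.\<close>

lemma area_chen:
  assumes s: "0 \<le> s" and su: "s \<le> u" and ut: "u \<le> t"
  shows "area n s t C = area n s u C + area n u t C +
    ((C \<sharp> (interp X n u - interp X n s)) o\<^sub>L (interp X n t - interp X n u))"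
proof -
  let ?W = "C \<sharp> (interp X n u - interp X n s)"
  have u: "0 \<le> u" using assms by simp
  have "(integrand n u C has_integral area n u t C) {u..t}"
    by (rule integrable_integral[OF integrand_integrable[OF u u ut]])
  moreover have "((\<lambda>v. ?W o\<^sub>L dX n v) has_integral (?W o\<^sub>L (interp X n t - interp X n u))) {u..t}"
    using has_integral_linear[OF has_integral_dX[OF u ut]
        bounded_bilinear.bounded_linear_right[OF bounded_bilinear_blinfun_compose, of ?W]]
    by (simp add: comp_def)
  ultimately have "((\<lambda>v. integrand n u C v + (?W o\<^sub>L dX n v)) has_integral
      (area n u t C + (?W o\<^sub>L (interp X n t - interp X n u)))) {u..t}"
    by (rule has_integral_add)
  moreover have "integrand n u C v + (?W o\<^sub>L dX n v) = integrand n s C v" if "v \<in> {u..t}" for v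
  proof -
    have "interp X n v - interp X n u \<in> A" "interp X n u - interp X n s \<in> A"
      using that u s by (auto intro!: A_diff interp_A)
    from sharp_add[OF this] show ?thesis by (simp add: compose_add_left)
  qed
  ultimately have "integral {u..t} (integrand n s C) = area n u t C + (?W o\<^sub>L (interp X n t - interp X n u))"
    using has_integral_cong[of "{u..t}"] by (metis (no_types, lifting) integral_unique)
  moreover have "integral {s..u} (integrand n s C) + integral {u..t} (integrand n s C) = area n s t C"
    by (rule Henstock_Kurzweil_Integration.integral_combine[OF su ut])
      (rule integrand_integrable[OF s s order_trans[OF su ut]])
  ultimately show ?thesis
    by (metis (no_types, lifting) add.assoc)
qed

text \<open>On a cell the path is a segment, and the integral of r dr supplies the factor
  1/2.\<close>

lemma area_cell:
  assumes "dyadic n i \<le> \<alpha>" "\<alpha> \<le> \<beta>" "\<beta> \<le> dyadic n (Suc i)"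
  shows "area n \<alpha> \<beta> C = (1/2) *\<^sub>R ((C \<sharp> (interp X n \<beta> - interp X n \<alpha>)) o\<^sub>L (interp X n \<beta> - interp X n \<alpha>))"
proof -
  have \<alpha>0: "0 \<le> \<alpha>" using assms(1) dyadic_nonneg[of n i] by linarith
  let ?Q = "2 ^ n *\<^sub>R (X (dyadic n (Suc i)) - X (dyadic n i))"
  have QA: "?Q \<in> A" by (intro A_scaleR A_diff X_A dyadic_nonneg)
  have d: "interp X n \<beta> - interp X n \<alpha> = (\<beta> - \<alpha>) *\<^sub>R ?Q"
    using interp_diff_cell[of n i \<alpha> \<beta> X] assms by simp
  have "area n \<alpha> \<beta> C = ((\<beta> - \<alpha>)\<^sup>2 / 2) *\<^sub>R ((C \<sharp> ?Q) o\<^sub>L ?Q)"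
    using integral_unique[OF has_integral_cell[OF \<alpha>0 assms]] by (simp add: sharp_zero compose_zero_left)
  then show ?thesis
    unfolding d by (simp add: sharp_scaleR[OF QA] compose_scaleR_left compose_scaleR_right power2_eq_square
        del: scaleR_scaleR) (simp add: power2_eq_square)
qed

text \<open>A crude bound, growing with n because the derivative is only of order sqrt (2 ^ n). It
  is good enough on intervals of at most about one cell, and for any property of a fixed
  level.\<close>

lemma norm_area_le:
  assumes s: "0 \<le> s" "s \<le> t"
  shows "norm (area n s t C) \<le> 3 * x1\<^sup>2 * sqrt (2 ^ n) * ((t - s) * sqrt (t - s)) * proj_norm S C"
proof -
  have P: "0 \<le> proj_norm S C" by (rule proj_norm_nonneg[OF S C])
  let ?B = "(3 * x1 * sqrt (t - s)) * (sqrt (2 ^ n) * x1) * proj_norm S C"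
  have "norm (area n s t C) \<le> ?B * measure lborel (cbox s t)"
  proof (rule has_integral_bound_spike_finite[OF _ finite_grid[of n t]])
    show "0 \<le> ?B" using P x1_nonneg s by simp
    show "(integrand n s C has_integral area n s t C) (cbox s t)"
      using integrable_integral[OF integrand_integrable[OF s(1) s]] by simp
    fix u assume "u \<in> cbox s t - grid n t"
    then have u: "s \<le> u" "u \<le> t" "u \<notin> grid n t" by auto
    have "norm (integrand n s C u) \<le> norm (interp X n u - interp X n s) * norm (dX n u) * proj_norm S C"
      by (rule norm_sharp_compose_le) (use u s in \<open>auto intro!: A_diff interp_A\<close>)
    also have "\<dots> \<le> ?B"
    proof (intro mult_right_mono[OF _ P] mult_mono)
      have "norm (interp X n u - interp X n s) \<le> 3 * x1 * sqrt (u - s)" by (rule norm_interp_le[OF s(1) u(1)])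
      also have "\<dots> \<le> 3 * x1 * sqrt (t - s)" using u x1_nonneg by (intro mult_left_mono) auto
      finally show "norm (interp X n u - interp X n s) \<le> 3 * x1 * sqrt (t - s)" .
      show "norm (dX n u) \<le> sqrt (2 ^ n) * x1" using norm_dX_le[of u t n] u s by simp
    qed (use x1_nonneg s in auto)
    finally show "norm (integrand n s C u) \<le> ?B" .
  qed
  then show ?thesis using s by (simp add: power2_eq_square mult_ac)
qed

lemma area_in:
  assumes B: "unital_subalgebra B" "closed B" "S \<subseteq> B"
    and s: "0 \<le> s" "s \<le> t" and x: "\<And>u. s \<le> u \<Longrightarrow> u \<le> t \<Longrightarrow> interp X n u \<in> B"
    and d: "\<And>u. s \<le> u \<Longrightarrow> u \<le> t \<Longrightarrow> u \<notin> grid n t \<Longrightarrow> dX n u \<in> B"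
  shows "area n s t C \<in> B"
proof (rule integral_in_closed_subspace[OF integrable_integral[OF integrand_integrable[OF s(1) s]] finite_grid[of n t] B(2)])
  fix u assume "u \<in> {s..t} - grid n t"
  then have u: "s \<le> u" "u \<le> t" "u \<notin> grid n t" by auto
  have "C \<sharp> (interp X n u - interp X n s) \<in> B"
    by (rule sharp_in[OF S C B]) (use u s x in \<open>auto intro!: subalg_diff[OF B(1)]\<close>)
  then show "integrand n s C u \<in> B" using d[OF u] by (rule subalg_compose[OF B(1)])
qed (auto intro: subalg_zero[OF B(1)] subalg_add[OF B(1)] subalg_scaleR[OF B(1)])

lemma dX_in:
  assumes B: "unital_subalgebra B" and X: "\<And>u. 0 \<le> u \<Longrightarrow> u \<le> dyadic n j \<Longrightarrow> X u \<in> B"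
    and u: "0 \<le> u" "u \<le> dyadic n j" "u \<notin> grid n (dyadic n j)"
  shows "dX n u \<in> B"
proof -
  obtain i where i: "dyadic n i < u" "u < dyadic n (Suc i)" using off_grid_cell[OF u] by blast
  then have "dyadic n i < dyadic n j" using u by simp
  then have "Suc i \<le> j" using dyadic_mono[of j i n] by (meson not_le not_less_eq_eq)
  then have "X (dyadic n (Suc i)) \<in> B" "X (dyadic n i) \<in> B"
    by (auto intro!: X dyadic_nonneg dyadic_mono)
  then show ?thesis unfolding dX_cell[OF i] by (intro subalg_scaleR[OF B] subalg_diff[OF B])
qed

lemma area_A:
  assumes SA: "S \<subseteq> A" and s: "0 \<le> s" "s \<le> t" shows "area n s t C \<in> A"
proof (rule area_in[OF subA closedA SA s])
  show "interp X n u \<in> A" if "s \<le> u" for u using that s by (intro interp_A) simp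
  fix u assume u: "s \<le> u" "u \<le> t" "u \<notin> grid n t"
  then obtain i where i: "dyadic n i < u" "u < dyadic n (Suc i)" using off_grid_cell[of u t n] s by auto
  show "dX n u \<in> A" unfolding dX_cell[OF i] by (intro A_scaleR A_diff X_A dyadic_nonneg)
qed

lemma area_F:
  assumes SF: "S \<subseteq> F (dyadic n j)" and s: "0 \<le> s" "s \<le> dyadic n j" shows "area n s (dyadic n j) C \<in> F (dyadic n j)"
proof (rule area_in[OF F_sub F_closed SF s])
  show "interp X n u \<in> F (dyadic n j)" if "s \<le> u" "u \<le> dyadic n j" for u
    using that s by (intro interp_F) auto
  show "dX n u \<in> F (dyadic n j)" if "s \<le> u" "u \<le> dyadic n j" "u \<notin> grid n (dyadic n j)" for u
    by (rule dX_in[OF F_sub X_F]) (use that s in auto)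
qed

text \<open>With increments a and b over the two halves of a cell, refinement replaces half the
  square of a + b by the two half squares plus the product of a and b in their order in time; only
  an antisymmetric term is left. The cross terms of Chen's relation cancel, since both paths agree
  with X on the coarser grid.\<close>

lemma area_level_diff:
  assumes "i \<le> j"
  shows "area (Suc n) (dyadic n i) (dyadic n j) C - area n (dyadic n i) (dyadic n j) C =
    (1/2) *\<^sub>R (\<Sum>k\<in>{i..<j}.
      ((C \<sharp> (X (dyadic (Suc n) (Suc (2 * k))) - X (dyadic n k))) o\<^sub>L (X (dyadic n (Suc k)) - X (dyadic (Suc n) (Suc (2 * k))))) -
      ((C \<sharp> (X (dyadic n (Suc k)) - X (dyadic (Suc n) (Suc (2 * k))))) o\<^sub>L (X (dyadic (Suc n) (Suc (2 * k))) - X (dyadic n k))))"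
  using assms
proof (induction j rule: dec_induct)
  case base
  show ?case by simp
next
  case (step j)
  let ?m = "dyadic (Suc n) (Suc (2 * j))"
  let ?a = "X ?m - X (dyadic n j)" and ?b = "X (dyadic n (Suc j)) - X ?m"
  have t: "dyadic n j = dyadic (Suc n) (2 * j)" "dyadic n (Suc j) = dyadic (Suc n) (Suc (Suc (2 * j)))"
    by (simp_all add: dyadic_def field_simps)
  have le: "dyadic n j \<le> ?m" "?m \<le> dyadic n (Suc j)" "dyadic n i \<le> dyadic n j" "dyadic n j \<le> dyadic n (Suc j)"
    using step(1) by (auto simp: t(1)[symmetric] intro!: dyadic_mono) (simp_all add: t dyadic_mono)
  have A: "?a \<in> A" "?b \<in> A" by (intro A_diff X_A dyadic_nonneg)+
  have x: "interp X (Suc n) (dyadic n k) = X (dyadic n k)" "interp X n (dyadic n k) = X (dyadic n k)" for k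
    using interp_dyadic[of X "Suc n" "2 * k"] by (simp_all add: dyadic_double interp_dyadic)
  have xm: "interp X (Suc n) ?m = X ?m" by (rule interp_dyadic)
  have chen: "area m (dyadic n i) (dyadic n (Suc j)) C = area m (dyadic n i) (dyadic n j) C + area m (dyadic n j) (dyadic n (Suc j)) C +
      ((C \<sharp> (interp X m (dyadic n j) - interp X m (dyadic n i))) o\<^sub>L (interp X m (dyadic n (Suc j)) - interp X m (dyadic n j)))" for m
    by (rule area_chen[OF dyadic_nonneg le(3,4)])
  have n: "area n (dyadic n j) (dyadic n (Suc j)) C = (1/2) *\<^sub>R ((C \<sharp> (?a + ?b)) o\<^sub>L (?a + ?b))"
    using area_cell[OF order_refl le(4) order_refl] by (simp add: x)
  have "area (Suc n) (dyadic n j) (dyadic n (Suc j)) C = area (Suc n) (dyadic n j) ?m C + area (Suc n) ?m (dyadic n (Suc j)) C + ((C \<sharp> ?a) o\<^sub>L ?b)"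
    using area_chen[OF dyadic_nonneg le(1,2), of "Suc n"] by (simp add: x xm)
  also have "area (Suc n) (dyadic n j) ?m C = (1/2) *\<^sub>R ((C \<sharp> ?a) o\<^sub>L ?a)"
    using area_cell[of "Suc n" "2 * j" "dyadic n j" ?m] le by (simp add: x xm t(1)[symmetric])
  also have "area (Suc n) ?m (dyadic n (Suc j)) C = (1/2) *\<^sub>R ((C \<sharp> ?b) o\<^sub>L ?b)"
    using area_cell[of "Suc n" "Suc (2 * j)" ?m "dyadic n (Suc j)"] le by (simp add: x xm t(2)[symmetric])
  finally have n1: "area (Suc n) (dyadic n j) (dyadic n (Suc j)) C =
      (1/2) *\<^sub>R ((C \<sharp> ?a) o\<^sub>L ?a) + (1/2) *\<^sub>R ((C \<sharp> ?b) o\<^sub>L ?b) + ((C \<sharp> ?a) o\<^sub>L ?b)" .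
  have half: "V - (1/2) *\<^sub>R V = (1/2) *\<^sub>R V" for V :: "'h op"
    using scaleR_left_diff_distrib[of 1 "1/2" V] by simp
  have "area (Suc n) (dyadic n j) (dyadic n (Suc j)) C - area n (dyadic n j) (dyadic n (Suc j)) C =
      (1/2) *\<^sub>R (((C \<sharp> ?a) o\<^sub>L ?b) - ((C \<sharp> ?b) o\<^sub>L ?a))"
    unfolding n n1 sharp_add[OF A] compose_add_left compose_add_right scaleR_add_right scaleR_diff_right
    using half[of "(C \<sharp> ?a) o\<^sub>L ?b"] by (simp add: algebra_simps)
  then show ?case
    using step.IH step(1) unfolding chen by (simp add: x scaleR_add_right algebra_simps)
qed

end

end

lemma geometric_limit:
  fixes f :: "nat \<Rightarrow> 'a::banach"
  assumes d: "\<And>k. k \<ge> n \<Longrightarrow> norm (f (Suc k) - f k) \<le> K * r ^ k" and r: "0 \<le> r" "r < 1"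
  shows "f \<longlonglongrightarrow> lim f" "norm (lim f - f n) \<le> K * r ^ n / (1 - r)"
proof -
  let ?g = "\<lambda>k. f (Suc (k + n)) - f (k + n)"
  have gn: "norm (?g k) \<le> (K * r ^ n) * r ^ k" for k
    using d[of "k + n"] by (simp add: power_add mult_ac)
  have sg: "summable (\<lambda>k. (K * r ^ n) * r ^ k)"
    using r by (intro summable_mult summable_geometric) simp
  have sn: "summable (\<lambda>k. norm (?g k))"
    by (rule summable_comparison_test'[OF sg, of 0]) (simp add: gn)
  have part: "(\<Sum>k<m. ?g k) = f (m + n) - f n" for m
    using sum_lessThan_telescope[of "\<lambda>k. f (k + n)" m] by simp
  have "(\<lambda>m. f (m + n) - f n) \<longlonglongrightarrow> suminf ?g"
    using summable_LIMSEQ[OF summable_norm_cancel[OF sn]] by (simp only: part)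
  from tendsto_add[OF this tendsto_const[of "f n"]] have "(\<lambda>m. f (m + n)) \<longlonglongrightarrow> suminf ?g + f n" by simp
  then have lim: "f \<longlonglongrightarrow> suminf ?g + f n" by (rule LIMSEQ_offset)
  then show "f \<longlonglongrightarrow> lim f" by (simp add: limI)
  have "norm (lim f - f n) = norm (suminf ?g)" using limI[OF lim] by simp
  also have "\<dots> \<le> (\<Sum>k. norm (?g k))" by (rule summable_norm[OF sn])
  also have "\<dots> \<le> (\<Sum>k. (K * r ^ n) * r ^ k)" by (rule suminf_le[OF gn sn sg])
  also have "\<dots> = K * r ^ n / (1 - r)"
    using r by (subst suminf_mult) (auto simp: summable_geometric suminf_geometric divide_inverse)
  finally show "norm (lim f - f n) \<le> K * r ^ n / (1 - r)" .
qed

lemma norm_diff_via: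
  fixes a b l :: "'a::real_normed_vector"
  assumes "norm a \<le> A" "norm b \<le> B" "norm (l - b) \<le> D"
  shows "norm (a - l) \<le> A + B + D"
  using norm_triangle_ineq4[of "a - b" "l - b"] norm_triangle_ineq4[of a b] assms by simp

section \<open>Estimates between levels and the limiting area\<close>

context q_brownian
begin

definition step_combo :: "nat \<Rightarrow> nat \<Rightarrow> combo" where
  "step_combo n l = [(1, dyadic n (Suc l)), (- 1, dyadic n l)]"

lemma val_step_combo: "val X (step_combo n l) = X (dyadic n (Suc l)) - X (dyadic n l)"
  by (simp add: step_combo_def)

lemma times_in_step_combo: "times_in {0..} (step_combo n l)"
  by (simp add: step_combo_def times_in_def dyadic_nonneg)

lemma cov_step_combo: "cov (step_combo n k) (step_combo n l) = (if k = l then 1 / 2 ^ n else 0)"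
proof -
  have "step_combo n l = [(1, 1 / 2 ^ n + real l * (1 / 2 ^ n)), (- 1, real l * (1 / 2 ^ n))]" for l
    by (simp add: step_combo_def dyadic_def add_divide_distrib)
  then show ?thesis
    using cov_increments[of "1 / 2 ^ n" "1 / 2 ^ n" "1 / 2 ^ n" 1 k 1 l] by simp
qed

lemma cov_step_combo_past: "u \<le> dyadic n l \<Longrightarrow> cov (step_combo n l) [(1, u)] = 0"
  using dyadic_mono[of l "Suc l" n] by (simp add: step_combo_def cov_def)

text \<open>For an elementary tensor with factors U and V, the factor U only multiplies from the
  left and leaves the sum, whereas V stands between the two increments and is the element to which
  the key estimate applies.\<close>

lemma alternating_sum_bound:
  fixes N :: nat and \<alpha> \<beta> :: "nat \<Rightarrow> nat"
  assumes s: "0 \<le> s" and C: "C \<in> proj_tensor (F s)" and N: "1 \<le> N"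
    and a: "\<And>k. s \<le> dyadic n (\<alpha> k)" "inj_on \<alpha> {..<N}" and b: "\<And>k. s \<le> dyadic n (\<beta> k)" "inj_on \<beta> {..<N}"
    and ab: "\<And>k l. k < N \<Longrightarrow> l < N \<Longrightarrow> \<alpha> k \<noteq> \<beta> l"
  shows "norm (\<Sum>k<N. (C \<sharp> (X (dyadic n (Suc (\<alpha> k))) - X (dyadic n (\<alpha> k)))) o\<^sub>L (X (dyadic n (Suc (\<beta> k))) - X (dyadic n (\<beta> k))))
    \<le> (1 / 2 ^ n * sqrt N * x1\<^sup>2) * proj_norm (F s) C"
  unfolding val_step_combo[symmetric]
proof (rule sharp_sum_bound[OF F_sub C])
  let ?B = "1 / 2 ^ n * sqrt N * x1\<^sup>2"
  show "val X (step_combo n (\<alpha> k)) \<in> bounded_ops" for k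
    by (intro A_bounded_ops val_A times_in_step_combo)
  show "0 \<le> ?B" by simp
  fix U V assume UV: "U \<in> F s" "V \<in> F s"
  have key: "norm (\<Sum>k<N. val X (step_combo n (\<alpha> k)) o\<^sub>L V o\<^sub>L val X (step_combo n (\<beta> k))) \<le> norm V * ?B"
  proof (rule key_estimate[OF s N _ times_in_step_combo times_in_step_combo _ _ _ _ _ UV(2)])
    show "cov (step_combo n (\<alpha> i)) [(1, t)] = 0" "cov (step_combo n (\<beta> i)) [(1, t)] = 0" if "t \<in> {0..s}" for i t
      using that a(1)[of i] b(1)[of i] by (auto intro!: cov_step_combo_past)
    show "cov (step_combo n (\<alpha> i)) (step_combo n (\<alpha> j)) = (if i = j then 1 / 2 ^ n else 0)"
      "cov (step_combo n (\<beta> i)) (step_combo n (\<beta> j)) = (if i = j then 1 / 2 ^ n else 0)"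
      "cov (step_combo n (\<alpha> i)) (step_combo n (\<beta> j)) = 0" if "i < N" "j < N" for i j
      using that a(2) b(2) ab by (auto simp: cov_step_combo inj_on_def)
  qed simp
  have "(\<Sum>k<N. (U o\<^sub>L val X (step_combo n (\<alpha> k)) o\<^sub>L V) o\<^sub>L val X (step_combo n (\<beta> k))) =
      U o\<^sub>L (\<Sum>k<N. val X (step_combo n (\<alpha> k)) o\<^sub>L V o\<^sub>L val X (step_combo n (\<beta> k)))"
    by (simp add: compose_sum_right op_assoc)
  also have "norm \<dots> \<le> norm U * (norm V * ?B)"
    by (rule order_trans[OF norm_blinfun_compose]) (intro mult_left_mono key norm_ge_zero)
  finally show "norm (\<Sum>k<N. (U o\<^sub>L val X (step_combo n (\<alpha> k)) o\<^sub>L V) o\<^sub>L val X (step_combo n (\<beta> k))) \<le> ?B * (norm U * norm V)"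
    by (simp add: mult_ac)
qed

text \<open>The key estimate is used with h = 2^-(n+1) and N cells. The interval has length N 2^-n,
  so h sqrt N is half the product of sqrt (2^-n) and the square root of this length.\<close>

lemma norm_area_level_diff_grid:
  assumes s: "0 \<le> s" "s \<le> dyadic n i" and C: "C \<in> proj_tensor (F s)" and ij: "i \<le> j"
  shows "norm (area (Suc n) (dyadic n i) (dyadic n j) C - area n (dyadic n i) (dyadic n j) C) \<le>
    x1\<^sup>2 * sqrt (1 / 2 ^ n) * sqrt (dyadic n j - dyadic n i) * proj_norm (F s) C"
proof (cases "i = j")
  case True
  then show ?thesis using area_level_diff[OF F_sub C ij, of n] by simp
next
  case False
  define N where "N = j - i"
  have N: "1 \<le> N" using False ij by (simp add: N_def)
  \<comment> \<open>Cell i + k of level n consists of the cells \<open>\<alpha> k\<close> and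
    \<open>\<alpha> k + 1\<close> of level n + 1.\<close>
  define \<alpha> where "\<alpha> k = 2 * (i + k)" for k
  have t: "dyadic n (i + k) = dyadic (Suc n) (\<alpha> k)" "dyadic n (Suc (i + k)) = dyadic (Suc n) (Suc (Suc (\<alpha> k)))" for k
    by (simp_all add: dyadic_def \<alpha>_def field_simps)
  have past: "s \<le> dyadic (Suc n) (\<alpha> k)" "s \<le> dyadic (Suc n) (Suc (\<alpha> k))" for k
    using s dyadic_mono[of i "i + k" n] dyadic_mono[of "\<alpha> k" "Suc (\<alpha> k)" "Suc n"] by (auto simp: t(1)[symmetric])
  let ?a = "\<lambda>k. X (dyadic (Suc n) (Suc (\<alpha> k))) - X (dyadic (Suc n) (\<alpha> k))"
  let ?b = "\<lambda>k. X (dyadic (Suc n) (Suc (Suc (\<alpha> k)))) - X (dyadic (Suc n) (Suc (\<alpha> k)))"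
  let ?B = "(1 / 2 ^ Suc n * sqrt N * x1\<^sup>2) * proj_norm (F s) C"
  have ne: "\<alpha> k \<noteq> Suc (\<alpha> l)" for k l unfolding \<alpha>_def by presburger
  have "norm (\<Sum>k<N. (C \<sharp> ?a k) o\<^sub>L ?b k) \<le> ?B"
    by (rule alternating_sum_bound[OF s(1) C N, where \<beta> = "\<lambda>k. Suc (\<alpha> k)"])
      (use past ne in \<open>auto simp: \<alpha>_def inj_on_def\<close>)
  moreover have "norm (\<Sum>k<N. (C \<sharp> ?b k) o\<^sub>L ?a k) \<le> ?B"
    by (rule alternating_sum_bound[OF s(1) C N, where \<alpha> = "\<lambda>k. Suc (\<alpha> k)"])
      (use past ne[symmetric] in \<open>auto simp: \<alpha>_def inj_on_def\<close>)
  moreover have "area (Suc n) (dyadic n i) (dyadic n j) C - area n (dyadic n i) (dyadic n j) C =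
      (1/2) *\<^sub>R ((\<Sum>k<N. (C \<sharp> ?a k) o\<^sub>L ?b k) - (\<Sum>k<N. (C \<sharp> ?b k) o\<^sub>L ?a k))"
    unfolding area_level_diff[OF F_sub C ij] sum_subtractf[symmetric]
    by (subst sum.atLeastLessThan_shift_0)
      (simp add: N_def atLeast0LessThan comp_def t, simp add: \<alpha>_def)
  ultimately have "norm (area (Suc n) (dyadic n i) (dyadic n j) C - area n (dyadic n i) (dyadic n j) C) \<le> ?B"
    using norm_triangle_ineq4[of "\<Sum>k<N. (C \<sharp> ?a k) o\<^sub>L ?b k" "\<Sum>k<N. (C \<sharp> ?b k) o\<^sub>L ?a k"] by simp
  also have "\<dots> = (1/2) * (x1\<^sup>2 * (1 / 2 ^ n * sqrt N) * proj_norm (F s) C)" by simp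
  also have "1 / 2 ^ n * sqrt N = sqrt (1 / 2 ^ n) * sqrt (dyadic n j - dyadic n i)"
  proof -
    have "dyadic n j - dyadic n i = real N * (1 / 2 ^ n)"
      using ij by (simp add: dyadic_def N_def diff_divide_distrib of_nat_diff)
    then have "sqrt (1 / 2 ^ n) * sqrt (dyadic n j - dyadic n i) = (sqrt (1 / 2 ^ n) * sqrt (1 / 2 ^ n)) * sqrt N"
      by (simp only: real_sqrt_mult mult_ac)
    then show ?thesis by simp
  qed
  also have "(1/2) * (x1\<^sup>2 * (sqrt (1 / 2 ^ n) * sqrt (dyadic n j - dyadic n i)) * proj_norm (F s) C) \<le>
      1 * (x1\<^sup>2 * (sqrt (1 / 2 ^ n) * sqrt (dyadic n j - dyadic n i)) * proj_norm (F s) C)"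
    using proj_norm_nonneg[OF F_sub C] dyadic_mono[OF ij, of n] by (intro mult_right_mono) auto
  finally show ?thesis by (simp add: mult_ac)
qed

text \<open>At each end of the interval, 6 = 3 * 2 stands for the area over the incomplete cell and
  9 = 3 * 3 for the cross term of two increments.\<close>

lemma edge_terms_sum: "(6 * a * (b * c) * p + 9 * a * (b * c) * p) + (6 * a * (b * c) * p + 9 * a * (b * c) * p) = 30 * a * b * c * (p::real)"
  by simp

text \<open>The ends cost 30 at each of the two levels, and the complete cells between them cost
  1.\<close>

lemma level_terms_sum: "(30 * a * b * c * p + 30 * a * b * c * p) + a * b * c * p = 61 * a * c * p * (b::real)"
  by simp

text \<open>Chen's relation cuts off the pieces at both ends. Each cross term has one increment over
  a short piece, and the crude \<open>norm_area_le\<close> handles the short areas. The condition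
  \<open>2 ^ m * d \<le> 2\<close> admits, for d the mesh of level n, both m = n and the finer m = n
  + 1.\<close>

lemma norm_area_edges:
  assumes s: "0 \<le> s" "s \<le> a" "a \<le> b" "b \<le> t" and C: "C \<in> proj_tensor (F s)"
    and d: "a - s \<le> d" "t - b \<le> d" "d \<le> t - s" "2 ^ m * d \<le> 2" "0 \<le> d"
  shows "norm (area m s t C - area m a b C) \<le> 30 * x1\<^sup>2 * sqrt d * sqrt (t - s) * proj_norm (F s) C"
proof -
  let ?P = "proj_norm (F s) C" and ?\<delta> = "t - s"
  let ?x = "interp X m"
  have P: "0 \<le> ?P" by (rule proj_norm_nonneg[OF F_sub C])
  have ge: "0 \<le> a" "0 \<le> b" using s by auto
  have sq: "sqrt d \<le> sqrt ?\<delta>" using d by simp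
  have small: "norm (area m u v C) \<le> 6 * x1\<^sup>2 * (sqrt d * sqrt ?\<delta>) * ?P" if "0 \<le> u" "u \<le> v" "v - u \<le> d" for u v
  proof -
    have "sqrt (2 ^ m) * sqrt d \<le> sqrt 2"
      unfolding real_sqrt_mult[symmetric] using d by (intro real_sqrt_le_mono) simp
    also have "sqrt 2 \<le> 2" by (rule real_le_lsqrt) auto
    finally have s2: "sqrt (2 ^ m) * sqrt d \<le> 2" .
    have "sqrt (2 ^ m) * ((v - u) * sqrt (v - u)) \<le> sqrt (2 ^ m) * (d * sqrt d)"
      using that d by (intro mult_left_mono mult_mono) auto
    also have "\<dots> = (sqrt (2 ^ m) * sqrt d) * (sqrt d * sqrt d)" using d by simp
    also have "\<dots> \<le> 2 * (sqrt d * sqrt ?\<delta>)"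
      using s2 sq d by (intro mult_mono mult_left_mono) auto
    finally have "3 * x1\<^sup>2 * (sqrt (2 ^ m) * ((v - u) * sqrt (v - u))) * ?P \<le> 3 * x1\<^sup>2 * (2 * (sqrt d * sqrt ?\<delta>)) * ?P"
      using P by (intro mult_right_mono mult_left_mono) auto
    then show ?thesis using norm_area_le[OF F_sub C that(1,2), of m] by (simp add: mult_ac)
  qed
  have cross: "norm ((C \<sharp> (?x v - ?x u)) o\<^sub>L (?x z - ?x w)) \<le> 9 * x1\<^sup>2 * (sqrt d * sqrt ?\<delta>) * ?P"
    if "0 \<le> u" "u \<le> v" "0 \<le> w" "w \<le> z" "sqrt (v - u) * sqrt (z - w) \<le> sqrt d * sqrt ?\<delta>" for u v w z
  proof -
    have "norm ((C \<sharp> (?x v - ?x u)) o\<^sub>L (?x z - ?x w)) \<le> norm (?x v - ?x u) * norm (?x z - ?x w) * ?P"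
      by (rule norm_sharp_compose_le[OF F_sub C]) (use that in \<open>auto intro!: A_diff interp_A\<close>)
    also have "\<dots> \<le> (3 * x1 * sqrt (v - u)) * (3 * x1 * sqrt (z - w)) * ?P"
      using that P x1_nonneg by (intro mult_right_mono mult_mono norm_interp_le) auto
    also have "\<dots> = 9 * x1\<^sup>2 * (sqrt (v - u) * sqrt (z - w)) * ?P" by (simp add: power2_eq_square)
    also have "\<dots> \<le> 9 * x1\<^sup>2 * (sqrt d * sqrt ?\<delta>) * ?P"
      using that(5) P by (intro mult_right_mono mult_left_mono) auto
    finally show ?thesis .
  qed
  have c1: "norm ((C \<sharp> (?x a - ?x s)) o\<^sub>L (?x b - ?x a)) \<le> 9 * x1\<^sup>2 * (sqrt d * sqrt ?\<delta>) * ?P"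
    using s d ge by (intro cross mult_mono real_sqrt_le_mono) auto
  have c2: "norm ((C \<sharp> (?x b - ?x s)) o\<^sub>L (?x t - ?x b)) \<le> 9 * x1\<^sup>2 * (sqrt d * sqrt ?\<delta>) * ?P"
  proof (rule cross)
    have "sqrt (b - s) * sqrt (t - b) \<le> sqrt ?\<delta> * sqrt d"
      using s d ge by (intro mult_mono real_sqrt_le_mono) auto
    then show "sqrt (b - s) * sqrt (t - b) \<le> sqrt d * sqrt ?\<delta>" by (simp add: mult.commute)
  qed (use s ge in auto)
  have e1: "norm (area m s a C) \<le> 6 * x1\<^sup>2 * (sqrt d * sqrt ?\<delta>) * ?P"
    and e2: "norm (area m b t C) \<le> 6 * x1\<^sup>2 * (sqrt d * sqrt ?\<delta>) * ?P"
    using small s d ge by auto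
  have "area m s t C = area m s b C + area m b t C + ((C \<sharp> (?x b - ?x s)) o\<^sub>L (?x t - ?x b))"
    using s ge by (intro area_chen[OF F_sub C]) auto
  moreover have "area m s b C = area m s a C + area m a b C + ((C \<sharp> (?x a - ?x s)) o\<^sub>L (?x b - ?x a))"
    using s ge by (intro area_chen[OF F_sub C]) auto
  ultimately have eq: "area m s t C - area m a b C = (area m s a C + ((C \<sharp> (?x a - ?x s)) o\<^sub>L (?x b - ?x a))) +
      (area m b t C + ((C \<sharp> (?x b - ?x s)) o\<^sub>L (?x t - ?x b)))"
    by simp
  show ?thesis
    unfolding eq edge_terms_sum[symmetric]
    by (intro norm_triangle_mono c1 c2 e1 e2)
qed

lemma norm_area_level_diff:
  assumes s: "0 \<le> s" and d: "1 / 2 ^ n \<le> t - s" and C: "C \<in> proj_tensor (F s)"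
  shows "norm (area (Suc n) s t C - area n s t C) \<le> 61 * x1\<^sup>2 * sqrt (t - s) * proj_norm (F s) C * sqrt (1 / 2 ^ n)"
proof -
  let ?P = "proj_norm (F s) C" and ?d = "1 / 2 ^ n :: real"
  have P: "0 \<le> ?P" by (rule proj_norm_nonneg[OF F_sub C])
  have d0: "0 < ?d" by simp
  then have t: "0 \<le> t" "s \<le> t" using s d by linarith+
  obtain k where k: "dyadic n k \<le> s" "s < dyadic n (Suc k)" using dyadic_cell_exists[OF s] by blast
  obtain j where j: "dyadic n j \<le> t" "t < dyadic n (Suc j)" using dyadic_cell_exists[OF t(1)] by blast
  \<comment> \<open>The first grid point strictly after s. As t - s is at least one mesh, it does
    not exceed t.\<close>
  let ?i = "Suc k"
  have si: "dyadic n ?i - s \<le> ?d" using k dyadic_step[of n k] by linarith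
  have "dyadic n ?i \<le> t" using si d by linarith
  then have "dyadic n ?i < dyadic n (Suc j)" using j by linarith
  then have ij: "?i \<le> j" using dyadic_mono[of "Suc j" ?i n] by (meson not_le not_less_eq_eq)
  have le: "s \<le> dyadic n ?i" "dyadic n ?i \<le> dyadic n j" using k dyadic_mono[OF ij] by auto
  have tj: "t - dyadic n j \<le> ?d" using j dyadic_step[of n j] by linarith
  have edge: "norm (area m s t C - area m (dyadic n ?i) (dyadic n j) C) \<le> 30 * x1\<^sup>2 * sqrt ?d * sqrt (t - s) * ?P"
    if "2 ^ m * ?d \<le> 2" for m
    by (rule norm_area_edges[OF s le(1,2) j(1) C si tj d that]) simp
  have mid: "norm (area (Suc n) (dyadic n ?i) (dyadic n j) C - area n (dyadic n ?i) (dyadic n j) C) \<le>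
      x1\<^sup>2 * sqrt ?d * sqrt (t - s) * ?P"
  proof -
    have "sqrt (dyadic n j - dyadic n ?i) \<le> sqrt (t - s)" using j le by (intro real_sqrt_le_mono) linarith
    then have "x1\<^sup>2 * sqrt ?d * sqrt (dyadic n j - dyadic n ?i) * ?P \<le> x1\<^sup>2 * sqrt ?d * sqrt (t - s) * ?P"
      using P by (intro mult_right_mono mult_left_mono) auto
    then show ?thesis using norm_area_level_diff_grid[OF s le(1) C ij] by linarith
  qed
  let ?D = "\<lambda>m. area m s t C - area m (dyadic n ?i) (dyadic n j) C"
  let ?G = "area (Suc n) (dyadic n ?i) (dyadic n j) C - area n (dyadic n ?i) (dyadic n j) C"
  have eq: "area (Suc n) s t C - area n s t C = (?D (Suc n) - ?D n) + ?G" by simp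
  have "norm ((?D (Suc n) - ?D n) + ?G) \<le> (norm (?D (Suc n)) + norm (?D n)) + norm ?G"
    by (intro norm_triangle_mono norm_triangle_ineq4 order_refl)
  also have "\<dots> \<le> (30 * x1\<^sup>2 * sqrt ?d * sqrt (t - s) * ?P + 30 * x1\<^sup>2 * sqrt ?d * sqrt (t - s) * ?P) + x1\<^sup>2 * sqrt ?d * sqrt (t - s) * ?P"
    by (rule add_mono[OF add_mono[OF edge edge] mid]) simp_all
  finally show ?thesis unfolding eq level_terms_sum .
qed

definition levy :: "real \<Rightarrow> real \<Rightarrow> 'h ctensor \<Rightarrow> 'h op" where
  "levy s t C = lim (\<lambda>n. area n s t C)"

context
  fixes s t :: real and C :: "'h ctensor"
  assumes s: "0 \<le> s" and st: "s < t" and C: "C \<in> proj_tensor (F s)"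
begin

lemma level_exists: "\<exists>n. 1 / 2 ^ n \<le> t - s"
proof -
  obtain n where "(1 / 2 :: real) ^ n < t - s" using real_arch_pow_inv[of "t - s" "1 / 2"] st by auto
  then show ?thesis by (intro exI[of _ n]) (simp add: power_one_over less_imp_le)
qed

text \<open>The changes of level are summed as a geometric series of ratio sqrt (1 / 2). This is at
  most 3/4, so the sum costs a factor 4, and 244 = 4 * 61.\<close>

lemma levy_limit:
  assumes n: "1 / 2 ^ n \<le> t - s"
  shows "(\<lambda>n. area n s t C) \<longlonglongrightarrow> levy s t C"
    "norm (levy s t C - area n s t C) \<le> 244 * x1\<^sup>2 * sqrt (t - s) * proj_norm (F s) C * sqrt (1 / 2 ^ n)"
proof -
  let ?K = "61 * x1\<^sup>2 * sqrt (t - s) * proj_norm (F s) C" and ?r = "sqrt (1 / 2)"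
  have K: "0 \<le> ?K" using proj_norm_nonneg[OF F_sub C] st by simp
  have rn: "sqrt (1 / 2 ^ k) = ?r ^ k" for k by (simp add: real_sqrt_power[symmetric] power_one_over)
  have r34: "?r \<le> 3 / 4" by (rule real_le_lsqrt) (auto simp: power2_eq_square)
  have step: "norm (area (Suc k) s t C - area k s t C) \<le> ?K * ?r ^ k" if "k \<ge> n" for k
  proof -
    have "(1::real) / 2 ^ k \<le> 1 / 2 ^ n" using that by (intro divide_left_mono power_increasing) auto
    then show ?thesis using norm_area_level_diff[OF s _ C, of k t] n by (simp only: rn)
  qed
  have r01: "0 \<le> ?r" "?r < 1" using r34 by auto
  show "(\<lambda>n. area n s t C) \<longlonglongrightarrow> levy s t C"
    unfolding levy_def by (rule geometric_limit(1)[OF step r01])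
  have "norm (levy s t C - area n s t C) \<le> ?K * ?r ^ n / (1 - ?r)"
    unfolding levy_def by (rule geometric_limit(2)[OF step r01])
  also have "\<dots> \<le> ?K * ?r ^ n / (1 / 4)"
    using K r34 by (intro divide_left_mono) auto
  finally show "norm (levy s t C - area n s t C) \<le> 244 * x1\<^sup>2 * sqrt (t - s) * proj_norm (F s) C * sqrt (1 / 2 ^ n)"
    by (simp add: rn)
qed

lemma area_tendsto_levy: "(\<lambda>n. area n s t C) \<longlonglongrightarrow> levy s t C"
  using level_exists levy_limit(1) by blast

lemma norm_area_short:
  assumes "2 ^ n * (t - s) \<le> 2"
  shows "norm (area n s t C) \<le> 6 * x1\<^sup>2 * (t - s) * proj_norm (F s) C"
proof -
  have P: "0 \<le> proj_norm (F s) C" by (rule proj_norm_nonneg[OF F_sub C])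
  have "sqrt (2 ^ n) * sqrt (t - s) \<le> sqrt 2"
    unfolding real_sqrt_mult[symmetric] using assms by (rule real_sqrt_le_mono)
  also have "sqrt 2 \<le> 2" by (rule real_le_lsqrt) auto
  finally have s2: "sqrt (2 ^ n) * sqrt (t - s) \<le> 2" .
  have "norm (area n s t C) \<le> 3 * x1\<^sup>2 * sqrt (2 ^ n) * ((t - s) * sqrt (t - s)) * proj_norm (F s) C"
    using norm_area_le[OF F_sub C s, of t n] st by simp
  also have "\<dots> = 3 * x1\<^sup>2 * ((sqrt (2 ^ n) * sqrt (t - s)) * (t - s)) * proj_norm (F s) C"
    by (simp only: mult_ac)
  also have "\<dots> \<le> 3 * x1\<^sup>2 * (2 * (t - s)) * proj_norm (F s) C"
    using st P s2 by (intro mult_right_mono mult_left_mono) auto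
  also have "\<dots> = 6 * x1\<^sup>2 * (t - s) * proj_norm (F s) C"
    by (simp only: mult.left_commute[of _ 2] mult.assoc)
  finally show ?thesis .
qed

text \<open>If the interval is shorter than the mesh of level n, the comparison goes through the
  coarsest level m whose mesh fits into the interval. By minimality of m that mesh is comparable to
  t - s, so both areas and the error at level m are of order t - s; 256 = 6 + 6 + 244.\<close>

lemma levy_error:
  "norm (area n s t C - levy s t C) \<le>
    (if 1 / 2 ^ n \<le> t - s then 256 * x1\<^sup>2 * (sqrt (t - s) * sqrt (1 / 2 ^ n)) else 256 * x1\<^sup>2 * (t - s)) * proj_norm (F s) C"
proof -
  have P: "0 \<le> proj_norm (F s) C" by (rule proj_norm_nonneg[OF F_sub C])
  show ?thesis
  proof (cases "1 / 2 ^ n \<le> t - s")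
    case True
    have "norm (area n s t C - levy s t C) \<le> 244 * x1\<^sup>2 * (sqrt (t - s) * sqrt (1 / 2 ^ n)) * proj_norm (F s) C"
      using levy_limit(2)[OF True] by (simp add: norm_minus_commute mult_ac)
    also have "\<dots> \<le> 256 * x1\<^sup>2 * (sqrt (t - s) * sqrt (1 / 2 ^ n)) * proj_norm (F s) C"
      using P st by (intro mult_right_mono) auto
    finally show ?thesis using True by simp
  next
    case False
    define m where "m = (LEAST m. 1 / 2 ^ m \<le> t - s)"
    have m: "1 / 2 ^ m \<le> t - s" unfolding m_def by (rule LeastI_ex[OF level_exists])
    have "m \<noteq> 0"
    proof
      assume "m = 0"
      then have "(1::real) / 2 ^ n \<le> t - s" using m by (simp add: order_trans[of _ 1])
      then show False using False by simp
    qed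
    then obtain m' where m': "m = Suc m'" by (cases m) auto
    have "\<not> 1 / 2 ^ m' \<le> t - s" using not_less_Least[of m' "\<lambda>m. 1 / 2 ^ m \<le> t - s"] m' by (simp add: m_def)
    then have m2: "2 ^ m * (t - s) \<le> 2" by (simp add: m' field_simps)
    have n2: "2 ^ n * (t - s) \<le> 2" using False by (simp add: field_simps)
    have "sqrt (1 / 2 ^ m) \<le> sqrt (t - s)" using m by (rule real_sqrt_le_mono)
    have "norm (levy s t C - area m s t C) \<le> 244 * x1\<^sup>2 * sqrt (t - s) * proj_norm (F s) C * sqrt (1 / 2 ^ m)"
      by (rule levy_limit(2)[OF m])
    also have "\<dots> \<le> 244 * x1\<^sup>2 * sqrt (t - s) * proj_norm (F s) C * sqrt (t - s)"
      using P st \<open>sqrt (1 / 2 ^ m) \<le> sqrt (t - s)\<close> by (intro mult_left_mono) auto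
    also have "\<dots> = 244 * x1\<^sup>2 * (sqrt (t - s) * sqrt (t - s)) * proj_norm (F s) C"
      by (simp only: mult_ac)
    finally have "norm (levy s t C - area m s t C) \<le> 244 * x1\<^sup>2 * (t - s) * proj_norm (F s) C"
      using st by simp
    then have "norm (area n s t C - levy s t C) \<le>
        6 * x1\<^sup>2 * (t - s) * proj_norm (F s) C + 6 * x1\<^sup>2 * (t - s) * proj_norm (F s) C + 244 * x1\<^sup>2 * (t - s) * proj_norm (F s) C"
      by (rule norm_diff_via[OF norm_area_short[OF n2] norm_area_short[OF m2]])
    also have "\<dots> = 256 * x1\<^sup>2 * (t - s) * proj_norm (F s) C"
      by (simp only: distrib_right[symmetric] mult.assoc) simp
    finally show ?thesis using False by simp
  qed
qed

text \<open>The interpolation looks ahead within its cell, so the areas up to t need not belong to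
  the past of t. Those up to the last grid point before t do, and they have the same limit.\<close>

lemma levy_F: "levy s t C \<in> F t"
proof -
  have t: "0 \<le> t" using s st by simp
  obtain n0 where n0: "1 / 2 ^ n0 \<le> t - s" using level_exists by blast
  define j where "j n = nat \<lfloor>t * 2 ^ n\<rfloor>" for n
  have j: "dyadic n (j n) \<le> t" "t < dyadic n (Suc (j n))" for n
  proof -
    obtain i where i: "dyadic n i \<le> t" "t < dyadic n (Suc i)" using dyadic_cell_exists[OF t] by blast
    then have "j n = i" unfolding j_def by (rule dyadic_cell_unique)
    then show "dyadic n (j n) \<le> t" "t < dyadic n (Suc (j n))" using i by auto
  qed
  let ?P = "proj_norm (F s) C"
  have near: "t - dyadic n (j n) \<le> 1 / 2 ^ n" for n using j[of n] dyadic_step[of n "j n"] by linarith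
  have sj: "s \<le> dyadic n (j n)" if "n \<ge> n0" for n
  proof -
    have "(1::real) / 2 ^ n \<le> 1 / 2 ^ n0" using that by (intro divide_left_mono power_increasing) auto
    then show ?thesis using near[of n] n0 by linarith
  qed
  have err: "norm (area n s t C - area n s (dyadic n (j n)) C) \<le> 30 * x1\<^sup>2 * sqrt (1 / 2 ^ n) * sqrt (t - s) * ?P" if "n \<ge> n0" for n
  \<comment> \<open>The left piece is empty here, with a = s.\<close>
  proof (rule norm_area_edges[OF s order_refl sj[OF that] j(1) C])
    have "(1::real) / 2 ^ n \<le> 1 / 2 ^ n0" using that by (intro divide_left_mono power_increasing) auto
    then show "1 / 2 ^ n \<le> t - s" using n0 by linarith
  qed (use near in auto)
  have "(\<lambda>n. sqrt (1 / 2 ^ n)) \<longlonglongrightarrow> sqrt 0"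
    by (intro tendsto_real_sqrt) (simp add: LIMSEQ_divide_realpow_zero)
  then have "(\<lambda>n. 30 * x1\<^sup>2 * sqrt (1 / 2 ^ n) * sqrt (t - s) * ?P) \<longlonglongrightarrow> 30 * x1\<^sup>2 * 0 * sqrt (t - s) * ?P"
    by (intro tendsto_intros) simp
  then have "(\<lambda>n. 30 * x1\<^sup>2 * sqrt (1 / 2 ^ n) * sqrt (t - s) * ?P) \<longlonglongrightarrow> 0" by simp
  then have "(\<lambda>n. area n s t C - area n s (dyadic n (j n)) C) \<longlonglongrightarrow> 0"
    by (rule Lim_null_comparison[rotated]) (use err in \<open>auto intro!: eventually_sequentiallyI[of n0]\<close>)
  from tendsto_diff[OF area_tendsto_levy this]
  have "(\<lambda>n. area n s (dyadic n (j n)) C) \<longlonglongrightarrow> levy s t C" by simp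
  then have "(\<lambda>n. area (n + n0) s (dyadic (n + n0) (j (n + n0))) C) \<longlonglongrightarrow> levy s t C" by (rule LIMSEQ_ignore_initial_segment)
  moreover have "area (n + n0) s (dyadic (n + n0) (j (n + n0))) C \<in> F t" for n
    by (rule subsetD[OF F_mono[OF j(1)] area_F[OF F_sub C F_mono[OF sj] s sj]]) simp_all
  ultimately show ?thesis by (rule closed_sequentially[OF F_closed, rotated])
qed

end

end

section \<open>Convergence in the path spaces\<close>

text \<open>Gives up part of the exponent of the interval length \<delta> in exchange for a positive
  power of the mesh d, which makes the error vanish in the Hoelder norm. Below the mesh the roles of
  the two bounds are exchanged.\<close>

lemma sqrt_rate:
  assumes \<delta>: "0 < \<delta>" and d: "0 < (d::real)" and \<eta>: "1 / 2 \<le> \<eta>" "\<eta> < 1"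
  shows "(if d \<le> \<delta> then sqrt \<delta> * sqrt d else \<delta>) \<le> \<delta> powr \<eta> * d powr (1 - \<eta>)"
proof (cases "d \<le> \<delta>")
  case True
  have "sqrt \<delta> * sqrt d = \<delta> powr \<eta> * (\<delta> powr (1 / 2 - \<eta>) * d powr (1 / 2))"
    using \<delta> d by (simp add: powr_half_sqrt[symmetric] powr_add[symmetric])
  also have "\<dots> \<le> \<delta> powr \<eta> * (d powr (1 / 2 - \<eta>) * d powr (1 / 2))"
    using \<eta> True d by (intro mult_left_mono mult_right_mono powr_mono2') auto
  also have "d powr (1 / 2 - \<eta>) * d powr (1 / 2) = d powr (1 - \<eta>)"
    by (simp add: powr_add[symmetric])
  finally show ?thesis using True by simp
next
  case False
  have "\<delta> = \<delta> powr \<eta> * \<delta> powr (1 - \<eta>)" using \<delta> by (simp add: powr_add[symmetric])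
  also have "\<dots> \<le> \<delta> powr \<eta> * d powr (1 - \<eta>)"
    using False \<eta> \<delta> by (intro mult_left_mono powr_mono2) auto
  finally show ?thesis using False by simp
qed

lemma hoelder_rate:
  assumes \<delta>: "0 < \<delta>" and d: "0 < (d::real)" and \<gamma>: "0 < \<gamma>" "\<gamma> < 1 / 2"
  shows "(if d \<le> \<delta> then sqrt d else sqrt \<delta>) \<le> \<delta> powr \<gamma> * d powr (1 / 2 - \<gamma>)"
proof (cases "d \<le> \<delta>")
  case True
  have "sqrt d = d powr \<gamma> * d powr (1 / 2 - \<gamma>)" using d by (simp add: powr_half_sqrt[symmetric] powr_add[symmetric])
  also have "\<dots> \<le> \<delta> powr \<gamma> * d powr (1 / 2 - \<gamma>)" using True d \<gamma> by (intro mult_right_mono powr_mono2) auto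
  finally show ?thesis using True by simp
next
  case False
  have "sqrt \<delta> = \<delta> powr \<gamma> * \<delta> powr (1 / 2 - \<gamma>)" using \<delta> by (simp add: powr_half_sqrt[symmetric] powr_add[symmetric])
  also have "\<dots> \<le> \<delta> powr \<gamma> * d powr (1 / 2 - \<gamma>)" using False \<delta> \<gamma> by (intro mult_left_mono powr_mono2) auto
  finally show ?thesis using False by simp
qed

text \<open>Lowers a Hoelder exponent on a bounded interval. The square of T + 1 is a single
  constant for every loss of exponent up to 2.\<close>

lemma powr_interval_le:
  fixes \<delta> T \<theta> \<eta> :: real
  assumes "0 < \<delta>" "\<delta> \<le> T" "\<theta> \<le> \<eta>" "\<eta> - \<theta> \<le> 2"
  shows "\<delta> powr \<eta> \<le> (T + 1)\<^sup>2 * \<delta> powr \<theta>"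
proof -
  have "\<delta> powr \<eta> = \<delta> powr (\<eta> - \<theta>) * \<delta> powr \<theta>" using assms by (simp add: powr_add[symmetric])
  also have "\<delta> powr (\<eta> - \<theta>) \<le> (T + 1) powr (\<eta> - \<theta>)" using assms by (intro powr_mono2) auto
  also have "\<dots> \<le> (T + 1) powr 2" using assms by (intro powr_mono) auto
  also have "(T + 1) powr 2 = (T + 1)\<^sup>2" using assms by (simp add: powr_numeral)
  finally show ?thesis by (simp add: mult_right_mono)
qed

lemma dyadic_powr_tendsto: "0 < a \<Longrightarrow> (\<lambda>n. (1 / 2 ^ n) powr a) \<longlonglongrightarrow> (0::real)"
  by (rule tendsto_zero_powrI[OF _ tendsto_const]) (simp_all add: LIMSEQ_divide_realpow_zero)

lemma C2_norm_le:
  assumes S: "\<And>s. 0 \<le> s \<Longrightarrow> unital_subalgebra (G s)"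
    and L: "\<And>s t U. 0 \<le> s \<Longrightarrow> s < t \<Longrightarrow> t \<le> T \<Longrightarrow> U \<in> proj_tensor (G s) \<Longrightarrow>
      norm (L s t U) \<le> B * (t - s) powr r * proj_norm (G s) U"
  shows "C2_norm G T r L \<le> ereal B"
  unfolding C2_norm_def
proof (rule SUP_least, clarify, rule SUP_least)
  fix s t U assume st: "0 \<le> s" "s < t" "t \<le> T" and U: "U \<in> proj_tensor (G s) - {proj_class (G s) 0}"
  have "0 < proj_norm (G s) U" using U proj_norm_pos[OF S[OF st(1)]] by auto
  moreover have "0 < (t - s) powr r" using st by simp
  ultimately have "0 < \<bar>t - s\<bar> powr r * proj_norm (G s) U" using st by simp
  moreover have "norm (L s t U) \<le> B * (\<bar>t - s\<bar> powr r * proj_norm (G s) U)"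
    using L[OF st, of U] U st by (simp add: mult.assoc)
  ultimately show "ereal (norm (L s t U) / (\<bar>t - s\<bar> powr r * proj_norm (G s) U)) \<le> ereal B"
    by (simp add: divide_le_eq)
qed

text \<open>In \<open>ereal\<close> the supremum of the empty set is -\<infinity>, so a lower bound
  for \<open>C2_norm\<close> requires a nonzero class. The tensor 1 \<otimes> 1 is told apart from 0
  by letting it act on the identity.\<close>

lemma exists_nonzero_class:
  fixes S :: "'h::complex_hilbert op set"
  assumes S: "unital_subalgebra S" and ne: "(id_blinfun :: 'h op) \<noteq> 0"
  shows "\<exists>U. U \<in> proj_tensor S - {proj_class S 0}"
proof -
  let ?c = "\<lambda>_::nat. elem_tensor (id_blinfun :: 'h op) id_blinfun"
  have rep: "represents S [(id_blinfun, id_blinfun)] (?c k)" for k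
    using subalg_id[OF S] by (simp add: represents_def)
  then have c: "?c \<in> tensor_cauchy S"
    using alg_tensorI[OF S] by (auto simp: cauchy_seqs_def tensor_norm_zero[OF S])
  have idb: "(id_blinfun :: 'h op) \<in> bounded_ops" by (rule subalg_bounded_ops[OF S subalg_id[OF S]])
  have "alg_sharp (?c k) id_blinfun = id_blinfun" for k
    using alg_sharp_rep[OF S rep idb] by simp
  then have "(\<lambda>k::nat. id_blinfun :: 'h op) \<longlonglongrightarrow> proj_class S ?c \<sharp> id_blinfun"
    using sharp_tendsto[OF S c idb] by simp
  then have 1: "proj_class S ?c \<sharp> id_blinfun = id_blinfun"
    by (simp add: LIMSEQ_const_iff)
  have "alg_sharp ((0 :: nat \<Rightarrow> 'h tensor) k) id_blinfun = 0" for k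
    using alg_sharp_rep[OF S represents_Nil idb] by simp
  then have "(\<lambda>k::nat. 0 :: 'h op) \<longlonglongrightarrow> proj_class S 0 \<sharp> id_blinfun"
    using sharp_tendsto[OF S tensor_cauchy_zero[OF S] idb] by simp
  then have "proj_class S 0 \<sharp> (id_blinfun :: 'h op) = 0"
    by (simp add: LIMSEQ_const_iff)
  then have "proj_class S ?c \<noteq> proj_class S 0" using 1 ne by metis
  then show ?thesis using c by (intro exI[of _ "proj_class S ?c"]) (auto simp: proj_tensor_eq[OF S])
qed

lemma C2_norm_nonneg:
  fixes G :: "real \<Rightarrow> 'h::complex_hilbert op set"
  assumes S: "unital_subalgebra (G 0)" and ne: "(id_blinfun :: 'h op) \<noteq> 0" and T: "0 < T"
  shows "0 \<le> C2_norm G T r L"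
proof -
  obtain U where U: "U \<in> proj_tensor (G 0) - {proj_class (G 0) 0}" using exists_nonzero_class[OF S ne] by blast
  have "0 \<le> norm (L 0 T U) / (\<bar>T - 0\<bar> powr r * proj_norm (G 0) U)"
    using U proj_norm_nonneg[OF S, of U] by simp
  then have "0 \<le> ereal (norm (L 0 T U) / (\<bar>T - 0\<bar> powr r * proj_norm (G 0) U))" by simp
  also have "\<dots> \<le> (SUP U\<in>proj_tensor (G 0) - {proj_class (G 0) 0}.
       ereal (norm (L 0 T U) / (\<bar>T - 0\<bar> powr r * proj_norm (G 0) U)))"
    by (rule SUP_upper[OF U])
  also have "\<dots> \<le> C2_norm G T r L"
    unfolding C2_norm_def using T
    by (intro SUP_upper2[of "(0, T)"]) auto
  finally show ?thesis .
qed

section \<open>The limit as a product Levy area, and convergence of the approximations\<close>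

context q_brownian
begin

lemma id_nonzero: "(id_blinfun :: 'h op) \<noteq> 0"
  using phi_id by (metis phi_zero zero_neq_one)

lemma interp_area_eq:
  assumes s: "0 \<le> s" and C: "C \<in> proj_tensor (F s)"
  shows "interp_area X n s t (proj_embed A C) = area n s t C"
  unfolding interp_area_def
proof (rule integral_cong)
  fix u assume "u \<in> {s..t}"
  then have "interp X n u - interp X n s \<in> A" using s by (auto intro!: A_diff interp_A)
  then show "(proj_embed A C \<sharp> (interp X n u - interp X n s)) o\<^sub>L dX n u = integrand n s C u"
    using proj_embed_sharp[OF F_sub subA F_A C] by (simp add: A_bounded_ops)
qed

lemma class_in: "c \<in> tensor_cauchy (F s) \<Longrightarrow> proj_class (F s) c \<in> proj_tensor (F s)"
  by (simp add: proj_tensor_eq[OF F_sub])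

lemma area_class_add:
  assumes s: "0 \<le> s" "s \<le> t" and c: "c \<in> tensor_cauchy (F s)" "d \<in> tensor_cauchy (F s)"
  shows "area n s t (proj_class (F s) (c + d)) = area n s t (proj_class (F s) c) + area n s t (proj_class (F s) d)"
proof -
  have "integrand n s (proj_class (F s) (c + d)) u = integrand n s (proj_class (F s) c) u + integrand n s (proj_class (F s) d) u"
    if "u \<in> {s..t}" for u
  proof -
    have "interp X n u - interp X n s \<in> bounded_ops" using s that by (intro A_bounded_ops A_diff interp_A) auto
    then show ?thesis by (simp add: sharp_class_add[OF F_sub c] compose_add_left)
  qed
  then have "area n s t (proj_class (F s) (c + d)) =
      integral {s..t} (\<lambda>u. integrand n s (proj_class (F s) c) u + integrand n s (proj_class (F s) d) u)"
    by (intro integral_cong)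
  also have "\<dots> = area n s t (proj_class (F s) c) + area n s t (proj_class (F s) d)"
    by (rule Henstock_Kurzweil_Integration.integral_add) (intro integrand_integrable[OF F_sub class_in] c s)+
  finally show ?thesis .
qed

lemma area_class_scale:
  assumes s: "0 \<le> s" "s \<le> t" and c: "c \<in> tensor_cauchy (F s)"
  shows "area n s t (proj_class (F s) (\<lambda>k. scale_tensor a (c k))) = op_scale a (area n s t (proj_class (F s) c))"
proof -
  have "integrand n s (proj_class (F s) (\<lambda>k. scale_tensor a (c k))) u = (op_scale a \<circ> integrand n s (proj_class (F s) c)) u"
    if "u \<in> {s..t}" for u
  proof -
    have "interp X n u - interp X n s \<in> bounded_ops" using s that by (intro A_bounded_ops A_diff interp_A) auto
    then show ?thesis by (simp add: sharp_class_scale[OF F_sub c] op_scale_compose_left)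
  qed
  then have "area n s t (proj_class (F s) (\<lambda>k. scale_tensor a (c k))) =
      integral {s..t} (op_scale a \<circ> integrand n s (proj_class (F s) c))"
    by (intro integral_cong)
  also have "\<dots> = op_scale a (area n s t (proj_class (F s) c))"
    by (rule integral_linear[OF integrand_integrable[OF F_sub class_in[OF c] s(1) s] bounded_linear_op_scale])
  finally show ?thesis .
qed

lemma levy_class_add:
  assumes s: "0 \<le> s" "s < t" and c: "c \<in> tensor_cauchy (F s)" "d \<in> tensor_cauchy (F s)"
  shows "levy s t (proj_class (F s) (c + d)) = levy s t (proj_class (F s) c) + levy s t (proj_class (F s) d)"
proof (rule LIMSEQ_unique)
  show "(\<lambda>n. area n s t (proj_class (F s) (c + d))) \<longlonglongrightarrow> levy s t (proj_class (F s) (c + d))"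
    by (intro area_tendsto_levy s class_in tensor_cauchy_add[OF F_sub] c)
  show "(\<lambda>n. area n s t (proj_class (F s) (c + d))) \<longlonglongrightarrow> levy s t (proj_class (F s) c) + levy s t (proj_class (F s) d)"
    using tendsto_add[OF area_tendsto_levy[OF s class_in[OF c(1)]] area_tendsto_levy[OF s class_in[OF c(2)]]]
    by (simp add: area_class_add[OF s(1) less_imp_le[OF s(2)] c])
qed

lemma levy_class_scale:
  assumes s: "0 \<le> s" "s < t" and c: "c \<in> tensor_cauchy (F s)"
  shows "levy s t (proj_class (F s) (\<lambda>k. scale_tensor a (c k))) = op_scale a (levy s t (proj_class (F s) c))"
proof (rule LIMSEQ_unique)
  show "(\<lambda>n. area n s t (proj_class (F s) (\<lambda>k. scale_tensor a (c k)))) \<longlonglongrightarrow> levy s t (proj_class (F s) (\<lambda>k. scale_tensor a (c k)))"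
    by (intro area_tendsto_levy s class_in tensor_cauchy_scale[OF F_sub] c)
  show "(\<lambda>n. area n s t (proj_class (F s) (\<lambda>k. scale_tensor a (c k)))) \<longlonglongrightarrow> op_scale a (levy s t (proj_class (F s) c))"
    using bounded_linear.tendsto[OF bounded_linear_op_scale area_tendsto_levy[OF s class_in[OF c]]]
    by (simp add: area_class_scale[OF s(1) less_imp_le[OF s(2)] c])
qed

text \<open>Chen's relation for the interpolations passes to the limit. The cross term converges
  because the interpolations converge in norm at each time and \<open>sharp\<close> is
  continuous.\<close>

lemma levy_chen:
  assumes s: "0 \<le> s" "s < u" "u < t" and C: "C \<in> proj_tensor (F s)"
  shows "levy s t C - levy s u C - levy u t (proj_embed (F u) C) = (C \<sharp> (X u - X s)) o\<^sub>L (X t - X u)"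
proof -
  have su: "F s \<subseteq> F u" using s by (intro F_mono) simp
  have Cu: "proj_embed (F u) C \<in> proj_tensor (F u)" by (rule proj_embed_in[OF F_sub F_sub su C])
  have u0: "0 \<le> u" "0 \<le> t" "s \<le> u" "u \<le> t" "s < t" using s by auto
  have e: "area n u t (proj_embed (F u) C) = area n u t C" for n
  proof (rule integral_cong)
    fix v assume "v \<in> {u..t}"
    then have "interp X n v - interp X n u \<in> bounded_ops" using u0 by (intro A_bounded_ops A_diff interp_A) auto
    then show "integrand n u (proj_embed (F u) C) v = integrand n u C v"
      by (simp add: proj_embed_sharp[OF F_sub F_sub su C])
  qed
  have xlim: "(\<lambda>n. interp X n v) \<longlonglongrightarrow> X v" if "0 \<le> v" for v
  proof -
    have "(\<lambda>n. sqrt (1 / 2 ^ n)) \<longlonglongrightarrow> sqrt 0"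
      by (intro tendsto_real_sqrt) (simp add: LIMSEQ_divide_realpow_zero)
    then have "(\<lambda>n. 2 * x1 * sqrt (1 / 2 ^ n)) \<longlonglongrightarrow> 2 * x1 * 0"
      by (intro tendsto_intros) simp
    then have "(\<lambda>n. interp X n v - X v) \<longlonglongrightarrow> 0"
      by (intro Lim_null_comparison[OF always_eventually[OF allI[OF norm_interp_error[OF that]]]]) simp
    then show ?thesis by (simp add: LIM_zero_iff)
  qed
  have slim: "(\<lambda>n. C \<sharp> (interp X n u - interp X n s)) \<longlonglongrightarrow> C \<sharp> (X u - X s)"
  proof -
    have A: "interp X n u - interp X n s \<in> A" "X u - X s \<in> A" for n
      using u0 s by (auto intro!: A_diff interp_A X_A)
    have l: "(\<lambda>n. (interp X n u - interp X n s) - (X u - X s)) \<longlonglongrightarrow> 0"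
      using tendsto_diff[OF xlim[OF u0(1)] xlim[OF s(1)]] by (simp add: LIM_zero)
    have "(\<lambda>n. (C \<sharp> (interp X n u - interp X n s)) - (C \<sharp> (X u - X s))) \<longlonglongrightarrow> 0"
    proof (rule tendsto_0_le[OF l, where K = "proj_norm (F s) C"], rule always_eventually, rule allI)
      fix n
      show "norm ((C \<sharp> (interp X n u - interp X n s)) - (C \<sharp> (X u - X s))) \<le>
          norm ((interp X n u - interp X n s) - (X u - X s)) * proj_norm (F s) C"
        unfolding sharp_diff[OF F_sub C A, symmetric]
        by (rule norm_sharp_le[OF F_sub C A_bounded_ops[OF A_diff[OF A]]])
    qed
    then show ?thesis by (simp add: LIM_zero_iff)
  qed
  have "(\<lambda>n. (C \<sharp> (interp X n u - interp X n s)) o\<^sub>L (interp X n t - interp X n u)) \<longlonglongrightarrow> ((C \<sharp> (X u - X s)) o\<^sub>L (X t - X u))"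
    by (intro tendsto_compose_op slim tendsto_diff xlim u0)
  moreover have "(C \<sharp> (interp X n u - interp X n s)) o\<^sub>L (interp X n t - interp X n u) =
      area n s t C - area n s u C - area n u t (proj_embed (F u) C)" for n
    unfolding e area_chen[OF F_sub C s(1) u0(3,4)] by simp
  ultimately have 1: "(\<lambda>n. area n s t C - area n s u C - area n u t (proj_embed (F u) C)) \<longlonglongrightarrow> ((C \<sharp> (X u - X s)) o\<^sub>L (X t - X u))"
    by simp
  have 2: "(\<lambda>n. area n s t C - area n s u C - area n u t (proj_embed (F u) C)) \<longlonglongrightarrow>
      levy s t C - levy s u C - levy u t (proj_embed (F u) C)"
    by (intro tendsto_diff area_tendsto_levy s u0 C Cu)
  show ?thesis by (rule LIMSEQ_unique[OF 2 1])
qed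

text \<open>The constant grows with n, which is enough for membership of each approximation in the
  space.\<close>

lemma norm_area_powr:
  assumes \<theta>: "0 < \<theta>" "\<theta> < 1" and s: "0 \<le> s" "s < t" "t \<le> T" and C: "C \<in> proj_tensor (F s)"
  shows "norm (area n s t C) \<le> (3 * x1\<^sup>2 * sqrt (2 ^ n) * (T + 1)\<^sup>2) * (t - s) powr \<theta> * proj_norm (F s) C"
proof -
  have "(t - s) * sqrt (t - s) = (t - s) powr (3 / 2)"
    using s powr_add[of "t - s" 1 "1/2"] by (simp add: powr_half_sqrt[symmetric])
  also have "\<dots> \<le> (T + 1)\<^sup>2 * (t - s) powr \<theta>"
    using s \<theta> by (intro powr_interval_le) auto
  finally have "3 * x1\<^sup>2 * sqrt (2 ^ n) * ((t - s) * sqrt (t - s)) * proj_norm (F s) C \<le>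
      3 * x1\<^sup>2 * sqrt (2 ^ n) * ((T + 1)\<^sup>2 * (t - s) powr \<theta>) * proj_norm (F s) C"
    using proj_norm_nonneg[OF F_sub C] by (intro mult_right_mono mult_left_mono) auto
  then show ?thesis using norm_area_le[OF F_sub C s(1), of t n] s by (simp add: mult.assoc)
qed

text \<open>\<open>sqrt_rate\<close> asks for an exponent of at least 1/2; a smaller \<theta> is
  reached from 1/2 at the price of the factor (T + 1)^2.\<close>

lemma levy_error_powr:
  assumes \<theta>: "0 < \<theta>" "\<theta> < 1" and s: "0 \<le> s" "s < t" "t \<le> T" and C: "C \<in> proj_tensor (F s)"
  shows "norm (area n s t C - levy s t C) \<le>
    (256 * x1\<^sup>2 * (T + 1)\<^sup>2 * (1 / 2 ^ n) powr (1 - max \<theta> (1/2))) * (t - s) powr \<theta> * proj_norm (F s) C"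
proof -
  let ?\<eta> = "max \<theta> (1/2)" and ?d = "1 / 2 ^ n :: real" and ?P = "proj_norm (F s) C"
  have P: "0 \<le> ?P" by (rule proj_norm_nonneg[OF F_sub C])
  have "norm (area n s t C - levy s t C) \<le> 256 * x1\<^sup>2 * (if ?d \<le> t - s then sqrt (t - s) * sqrt ?d else t - s) * ?P"
    using levy_error[OF s(1,2) C, of n] by (simp split: if_splits)
  also have "\<dots> \<le> 256 * x1\<^sup>2 * ((t - s) powr ?\<eta> * ?d powr (1 - ?\<eta>)) * ?P"
    using s \<theta> P by (intro mult_right_mono mult_left_mono sqrt_rate) auto
  also have "\<dots> \<le> 256 * x1\<^sup>2 * (((T + 1)\<^sup>2 * (t - s) powr \<theta>) * ?d powr (1 - ?\<eta>)) * ?P"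
    using s \<theta> P by (intro mult_right_mono mult_left_mono powr_interval_le) auto
  finally show ?thesis by (simp add: mult_ac)
qed

text \<open>Comparison with level 0, so that 259 = 3 + 256.\<close>

lemma norm_levy_powr:
  assumes \<theta>: "0 < \<theta>" "\<theta> < 1" and s: "0 \<le> s" "s < t" "t \<le> T" and C: "C \<in> proj_tensor (F s)"
  shows "norm (levy s t C) \<le> (259 * x1\<^sup>2 * (T + 1)\<^sup>2) * (t - s) powr \<theta> * proj_norm (F s) C"
proof -
  have "norm (levy s t C) \<le> norm (area 0 s t C) + norm (area 0 s t C - levy s t C)"
    using norm_triangle_ineq4[of "area 0 s t C" "area 0 s t C - levy s t C"] by simp
  also have "\<dots> \<le> (3 * x1\<^sup>2 * sqrt (2 ^ 0) * (T + 1)\<^sup>2) * (t - s) powr \<theta> * proj_norm (F s) C +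
      (256 * x1\<^sup>2 * (T + 1)\<^sup>2 * (1 / 2 ^ 0) powr (1 - max \<theta> (1/2))) * (t - s) powr \<theta> * proj_norm (F s) C"
    by (intro add_mono norm_area_powr levy_error_powr assms)
  finally show ?thesis by (simp add: algebra_simps)
qed

lemma area_op_family: "(\<lambda>s t U. interp_area X n s t (proj_embed A U)) \<in> op_families F (\<lambda>_. A) T"
  unfolding op_families_def bounded_linear_maps_def
proof (intro CollectI allI impI conjI ballI)
  fix s t :: real assume st: "0 \<le> s \<and> s < t \<and> t \<le> T"
  then have s: "0 \<le> s" "s \<le> t" by auto
  note eq = interp_area_eq[OF s(1)]
  show "interp_area X n s t (proj_embed A C) \<in> A" if "C \<in> proj_tensor (F s)" for C
    unfolding eq[OF that] by (rule area_A[OF F_sub that F_A s])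
  show "interp_area X n s t (proj_embed A (proj_class (F s) (c + d))) =
      interp_area X n s t (proj_embed A (proj_class (F s) c)) + interp_area X n s t (proj_embed A (proj_class (F s) d))"
    if "c \<in> tensor_cauchy (F s)" "d \<in> tensor_cauchy (F s)" for c d
    using that by (simp add: eq class_in tensor_cauchy_add[OF F_sub] area_class_add[OF s])
  show "interp_area X n s t (proj_embed A (proj_class (F s) (\<lambda>k. scale_tensor a (c k)))) =
      op_scale a (interp_area X n s t (proj_embed A (proj_class (F s) c)))"
    if "c \<in> tensor_cauchy (F s)" for a c
    using that by (simp add: eq class_in tensor_cauchy_scale[OF F_sub] area_class_scale[OF s])
  show "\<exists>K. \<forall>C\<in>proj_tensor (F s). norm (interp_area X n s t (proj_embed A C)) \<le> K * proj_norm (F s) C"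
    using norm_area_le[OF F_sub _ s] eq by (intro exI ballI) auto
qed

text \<open>The target G serves two purposes: the past algebras for the product Levy area, and the
  constant \<open>A\<close> for the convergence.\<close>

lemma levy_op_family: "(\<And>t. F t \<subseteq> G t) \<Longrightarrow> levy \<in> op_families F G T"
  unfolding op_families_def bounded_linear_maps_def
proof (intro CollectI allI impI conjI ballI)
  assume G: "\<And>t. F t \<subseteq> G t"
  fix s t :: real assume st: "0 \<le> s \<and> s < t \<and> t \<le> T"
  then have s: "0 \<le> s" "s < t" by auto
  show "levy s t C \<in> G t" if "C \<in> proj_tensor (F s)" for C
    using levy_F[OF s that] G by blast
  show "levy s t (proj_class (F s) (c + d)) = levy s t (proj_class (F s) c) + levy s t (proj_class (F s) d)"
    if "c \<in> tensor_cauchy (F s)" "d \<in> tensor_cauchy (F s)" for c d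
    by (rule levy_class_add[OF s that])
  show "levy s t (proj_class (F s) (\<lambda>k. scale_tensor a (c k))) = op_scale a (levy s t (proj_class (F s) c))"
    if "c \<in> tensor_cauchy (F s)" for a c
    by (rule levy_class_scale[OF s that])
  show "\<exists>K. \<forall>C\<in>proj_tensor (F s). norm (levy s t C) \<le> K * proj_norm (F s) C"
    using norm_levy_powr[of "1/2" s t T] st by (intro exI ballI) auto
qed

lemma levy_C2:
  assumes "\<And>t. F t \<subseteq> G t" "0 < \<theta>" "\<theta> < 1"
  shows "levy \<in> C2_space F G T \<theta>"
proof -
  have "C2_norm F T \<theta> levy \<le> ereal (259 * x1\<^sup>2 * (T + 1)\<^sup>2)"
    by (rule C2_norm_le[OF F_sub norm_levy_powr[OF assms(2,3)]])
  then have "C2_norm F T \<theta> levy < \<infinity>" by (rule le_less_trans) simp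
  then show ?thesis using levy_op_family[OF assms(1)] by (simp add: C2_space_def)
qed

lemma area_C2:
  assumes "0 < \<theta>" "\<theta> < 1"
  shows "(\<lambda>s t U. interp_area X n s t (proj_embed A U)) \<in> C2_space F (\<lambda>_. A) T \<theta>"
proof -
  have "C2_norm F T \<theta> (\<lambda>s t U. interp_area X n s t (proj_embed A U)) \<le> ereal (3 * x1\<^sup>2 * sqrt (2 ^ n) * (T + 1)\<^sup>2)"
    by (rule C2_norm_le[OF F_sub]) (simp add: interp_area_eq norm_area_powr[OF assms])
  then have "C2_norm F T \<theta> (\<lambda>s t U. interp_area X n s t (proj_embed A U)) < \<infinity>" by (rule le_less_trans) simp
  then show ?thesis using area_op_family by (simp add: C2_space_def)
qed

lemma area_C2_tendsto:
  assumes T: "0 < T" and \<theta>: "0 < \<theta>" "\<theta> < 1"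
  shows "C2_tendsto F (\<lambda>_. A) T \<theta> (\<lambda>n s t U. interp_area X n s t (proj_embed A U)) levy"
  unfolding C2_tendsto_def
proof (intro conjI allI area_C2 levy_C2 \<theta> F_A)
  let ?B = "\<lambda>n. 256 * x1\<^sup>2 * (T + 1)\<^sup>2 * (1 / 2 ^ n) powr (1 - max \<theta> (1/2))"
  have "?B \<longlonglongrightarrow> 256 * x1\<^sup>2 * (T + 1)\<^sup>2 * 0"
    using \<theta> by (intro tendsto_mult tendsto_const dyadic_powr_tendsto) auto
  then have B: "(\<lambda>n. ereal (?B n)) \<longlonglongrightarrow> 0" by (simp add: zero_ereal_def)
  show "(\<lambda>n. C2_norm F T \<theta> (\<lambda>s t U. interp_area X n s t (proj_embed A U) - levy s t U)) \<longlonglongrightarrow> 0"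
  proof (rule tendsto_sandwich[OF _ _ tendsto_const B]; intro always_eventually allI)
    show "0 \<le> C2_norm F T \<theta> (\<lambda>s t U. interp_area X n s t (proj_embed A U) - levy s t U)" for n
      by (rule C2_norm_nonneg[OF F_sub id_nonzero T])
    show "C2_norm F T \<theta> (\<lambda>s t U. interp_area X n s t (proj_embed A U) - levy s t U) \<le> ereal (?B n)" for n
      by (rule C2_norm_le[OF F_sub]) (simp add: interp_area_eq levy_error_powr[OF \<theta>])
  qed
qed

lemma interp_C1_tendsto:
  assumes T: "0 < T" and \<gamma>: "0 < \<gamma>" "\<gamma> < 1 / 2"
  shows "(\<lambda>n. C1_norm T \<gamma> (\<lambda>t. interp X n t - X t)) \<longlonglongrightarrow> 0"
proof -
  \<comment> \<open>Here 4 is 2 + 2, from the errors of interpolation at s and t, and also 3 + 1,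
    from the increments of the interpolation and of X; \<open>hoelder_rate\<close> combines the two
    bounds.\<close>
  let ?B = "\<lambda>n. 4 * x1 * (1 / 2 ^ n) powr (1 / 2 - \<gamma>)"
  have "?B \<longlonglongrightarrow> 4 * x1 * 0"
    using \<gamma> by (intro tendsto_mult tendsto_const dyadic_powr_tendsto) auto
  then have B: "(\<lambda>n. ereal (?B n)) \<longlonglongrightarrow> 0" by (simp add: zero_ereal_def)
  show ?thesis
  proof (rule tendsto_sandwich[OF _ _ tendsto_const B]; intro always_eventually allI)
    fix n
    have "0 \<le> ereal (norm ((interp X n T - X T) - (interp X n 0 - X 0)) / \<bar>T - 0\<bar> powr \<gamma>)" by simp
    also have "\<dots> \<le> C1_norm T \<gamma> (\<lambda>t. interp X n t - X t)"
      unfolding C1_norm_def using T by (intro SUP_upper2[of "(0, T)"]) auto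
    finally show "0 \<le> C1_norm T \<gamma> (\<lambda>t. interp X n t - X t)" .
    show "C1_norm T \<gamma> (\<lambda>t. interp X n t - X t) \<le> ereal (?B n)"
      unfolding C1_norm_def
    proof (rule SUP_least, clarify)
      fix s t :: real assume st: "0 \<le> s" "s < t" "t \<le> T"
      let ?d = "1 / 2 ^ n :: real" and ?D = "(interp X n t - X t) - (interp X n s - X s)"
      have 1: "norm ?D \<le> 4 * x1 * sqrt ?d"
        using norm_triangle_ineq4[of "interp X n t - X t" "interp X n s - X s"]
          norm_interp_error[of t n] norm_interp_error[of s n] st by simp
      have D: "?D = (interp X n t - interp X n s) - (X t - X s)" by simp
      have 2: "norm ?D \<le> 4 * x1 * sqrt (t - s)"
        unfolding D using norm_triangle_ineq4[of "interp X n t - interp X n s" "X t - X s"]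
          norm_interp_le[of s t n] norm_increment_le[of s t] st by (simp add: mult_ac)
      have "norm ?D \<le> 4 * x1 * (if ?d \<le> t - s then sqrt ?d else sqrt (t - s))"
        using 1 2 by simp
      also have "\<dots> \<le> 4 * x1 * ((t - s) powr \<gamma> * ?d powr (1 / 2 - \<gamma>))"
        using st \<gamma> x1_nonneg by (intro mult_left_mono hoelder_rate) auto
      finally have "norm ?D \<le> ?B n * \<bar>t - s\<bar> powr \<gamma>" using st by (simp add: mult_ac)
      moreover have "0 < \<bar>t - s\<bar> powr \<gamma>" using st by simp
      ultimately show "ereal (norm ?D / \<bar>t - s\<bar> powr \<gamma>) \<le> ereal (?B n)"
        by (simp add: divide_le_eq)
    qed
  qed
qed

lemma levy_product_levy_area: "product_levy_area X levy"
  unfolding product_levy_area_def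
proof (intro conjI allI impI ballI)
  show "levy \<in> C2_space F F T (2 * \<gamma>)" if "1 / 3 < \<gamma> \<and> \<gamma> < 1 / 2" for T \<gamma>
    using that by (intro levy_C2) auto
  show "levy s t C - levy s u C - levy u t (proj_embed (F u) C) = (C \<sharp> (X u - X s)) o\<^sub>L (X t - X u)"
    if "0 \<le> s \<and> s < u \<and> u < t" "C \<in> proj_tensor (F s)" for s u t C
    using that by (intro levy_chen) auto
qed

end

theorem theorem3p1:
  fixes A :: "'h::complex_hilbert op set" and \<phi> :: "'h op \<Rightarrow> complex"
    and q :: real and X :: "real \<Rightarrow> 'h op"
  assumes "nc_probability_space A \<phi>"
    and "0 \<le> q" and "q < 1"
    and "q_brownian_motion A \<phi> q X"
  shows "\<exists>X2S :: real \<Rightarrow> real \<Rightarrow> 'h ctensor \<Rightarrow> 'h op.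
    product_levy_area X X2S \<and>
    (\<forall>T>0. \<forall>\<gamma>. 0 < \<gamma> \<and> \<gamma> < 1 / 2 \<longrightarrow>
      (\<lambda>n. C1_norm T \<gamma> (\<lambda>t. interp X n t - X t)) \<longlonglongrightarrow> 0 \<and>
      C2_tendsto (filtration X) (\<lambda>_. A) T (2 * \<gamma>)
        (\<lambda>n s t U. interp_area X n s t (proj_embed A U)) X2S)"
proof -
  interpret q_brownian A \<phi> q X using assms by unfold_locales
  show ?thesis
    by (intro exI[of _ levy] conjI allI impI levy_product_levy_area interp_C1_tendsto area_C2_tendsto) auto
qed

end
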